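(* Let $F$ be a number field and let $v$ be a place of $F$. Then there exists a deterministic polynomial-time algorithm which, given $a,b \in F^\times$, evaluates the Hilbert symbol $(a,b)_v$.
   Context: A number field $F$ is specified by the minimal polynomial of a primitive element with rational coefficients; elements of $F$ are given by their rational coordinates in the basis of powers of the primitive element. Polynomial time means polynomial in the bit size of the input. For a field $K$ with $\operatorname{char} K \neq 2$ and $a,b\in K^\times$, $\left(\frac{a,b}{K}\right)$ denotes the $K$-algebra with $K$-basis $1,i,j,ij$ and multiplication determined by $i^2=a$, $j^2=b$, $ji=-ij$. The Hilbert symbol is $(a,b)_K = 1$ if $\left(\frac{a,b}{K}\right)\cong \mathrm{M}_2(K)$ as $K$-algebras, and $(a,b)_K=-1$ otherwise. For a place $v$ of $F$ with completion $F_v$, write $(a,b)_v=(a,b)_{F_v}$. *)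

theory Defs
  imports
    Complex_Main
    "HOL-Computational_Algebra.Polynomial"
    "HOL-Algebra.QuotRing"
    "HOL-Algebra.Module"
begin

section \<open>Number fields\<close>

definition minimal_polynomial :: "rat poly \<Rightarrow> 'f::field_char_0 \<Rightarrow> bool" where
  "minimal_polynomial m \<theta> \<longleftrightarrow>
     lead_coeff m = 1 \<and> poly (map_poly of_rat m) \<theta> = 0 \<and>
     (\<forall>p. p \<noteq> 0 \<and> poly (map_poly of_rat p) \<theta> = 0 \<longrightarrow> degree m \<le> degree p)"

text \<open>The whole type \<^typ>\<open>'f\<close> is the number field with primitive element \<open>\<theta>\<close>, whose minimal
  polynomial over the rationals is \<open>m\<close>.\<close>

definition number_field :: "rat poly \<Rightarrow> 'f::field_char_0 \<Rightarrow> bool" where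
  "number_field m \<theta> \<longleftrightarrow>
     minimal_polynomial m \<theta> \<and> (\<forall>x. \<exists>p. x = poly (map_poly of_rat p) \<theta>)"

definition coordinates :: "rat poly \<Rightarrow> 'f::field_char_0 \<Rightarrow> 'f \<Rightarrow> rat list" where
  "coordinates m \<theta> x =
     (THE cs. length cs = degree m \<and> x = (\<Sum>k<degree m. of_rat (cs ! k) * \<theta> ^ k))"


section \<open>Places and completions\<close>

definition absolute_value :: "('f::field \<Rightarrow> real) \<Rightarrow> bool" where
  "absolute_value v \<longleftrightarrow>
     (\<forall>x. v x \<ge> 0) \<and> (\<forall>x. v x = 0 \<longleftrightarrow> x = 0) \<and>
     (\<forall>x y. v (x * y) = v x * v y) \<and> (\<forall>x y. v (x + y) \<le> v x + v y)"

definition equivalent_av :: "('f::field \<Rightarrow> real) \<Rightarrow> ('f \<Rightarrow> real) \<Rightarrow> bool" where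
  "equivalent_av v w \<longleftrightarrow> (\<exists>s>0. \<forall>x. w x = v x powr s)"

text \<open>A place is an equivalence class of nontrivial absolute values.  In particular the class of a
  complex place contains the usual modulus but not its square.\<close>

definition places :: "('f::field \<Rightarrow> real) set set" where
  "places =
     {{w. absolute_value w \<and> equivalent_av v w} | v.
        absolute_value v \<and> (\<exists>x. x \<noteq> 0 \<and> v x \<noteq> 1)}"

text \<open>The completion is the ring of Cauchy sequences modulo the null sequences.  Equivalent absolute
  values have the same Cauchy sequences and the same null sequences, so quantifying over all
  members of the place amounts to using any one of them.\<close>

definition cauchy_ring :: "('f::field \<Rightarrow> real) set \<Rightarrow> (nat \<Rightarrow> 'f) ring" where
  "cauchy_ring V =
     \<lparr>carrier = {X. \<forall>v\<in>V. \<forall>e>0. \<exists>N. \<forall>m\<ge>N. \<forall>n\<ge>N. v (X m - X n) < e},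
      mult = (\<lambda>X Y n. X n * Y n), one = (\<lambda>n. 1),
      zero = (\<lambda>n. 0), add = (\<lambda>X Y n. X n + Y n)\<rparr>"

definition null_sequences :: "('f::field \<Rightarrow> real) set \<Rightarrow> (nat \<Rightarrow> 'f) set" where
  "null_sequences V = {X. \<forall>v\<in>V. (\<lambda>n. v (X n)) \<longlonglongrightarrow> 0}"

definition completion :: "('f::field \<Rightarrow> real) set \<Rightarrow> (nat \<Rightarrow> 'f) set ring" where
  "completion V = cauchy_ring V Quot null_sequences V"

definition to_completion :: "('f::field \<Rightarrow> real) set \<Rightarrow> 'f \<Rightarrow> (nat \<Rightarrow> 'f) set" where
  "to_completion V a = null_sequences V +>\<^bsub>cauchy_ring V\<^esub> (\<lambda>n. a)"


section \<open>Quaternion algebras and the Hilbert symbol\<close>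

context
  fixes K :: "('k, 'm) ring_scheme" (structure)
begin

text \<open>The tuple \<open>(x0, x1, x2, x3)\<close> stands for \<open>x0 + x1 i + x2 j + x3 ij\<close>.  The product is the
  \<open>K\<close>-bilinear associative one determined by \<open>i\<^sup>2 = a\<close>, \<open>j\<^sup>2 = b\<close>, \<open>ji = -ij\<close>; e.g.
  \<open>i(ij) = a j\<close>, \<open>(ij)i = -a j\<close>, \<open>j(ij) = -b i\<close>, \<open>(ij)j = b i\<close>, \<open>(ij)\<^sup>2 = -ab\<close>.\<close>

definition quaternion_algebra :: "'k \<Rightarrow> 'k \<Rightarrow> ('k, 'k \<times> 'k \<times> 'k \<times> 'k) module" where
  "quaternion_algebra a b =
     \<lparr>carrier = carrier K \<times> carrier K \<times> carrier K \<times> carrier K,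
      mult = (\<lambda>(x0, x1, x2, x3) (y0, y1, y2, y3).
        (x0 \<otimes> y0 \<oplus> a \<otimes> x1 \<otimes> y1 \<oplus> b \<otimes> x2 \<otimes> y2 \<ominus> a \<otimes> b \<otimes> x3 \<otimes> y3,
         x0 \<otimes> y1 \<oplus> x1 \<otimes> y0 \<ominus> b \<otimes> x2 \<otimes> y3 \<oplus> b \<otimes> x3 \<otimes> y2,
         x0 \<otimes> y2 \<oplus> x2 \<otimes> y0 \<oplus> a \<otimes> x1 \<otimes> y3 \<ominus> a \<otimes> x3 \<otimes> y1,
         x0 \<otimes> y3 \<oplus> x3 \<otimes> y0 \<oplus> x1 \<otimes> y2 \<ominus> x2 \<otimes> y1)),
      one = (\<one>, \<zero>, \<zero>, \<zero>),
      zero = (\<zero>, \<zero>, \<zero>, \<zero>),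
      add = (\<lambda>(x0, x1, x2, x3) (y0, y1, y2, y3). (x0 \<oplus> y0, x1 \<oplus> y1, x2 \<oplus> y2, x3 \<oplus> y3)),
      smult = (\<lambda>c (x0, x1, x2, x3). (c \<otimes> x0, c \<otimes> x1, c \<otimes> x2, c \<otimes> x3))\<rparr>"

text \<open>Matrices are listed row by row.\<close>

definition matrix_algebra_2 :: "('k, 'k \<times> 'k \<times> 'k \<times> 'k) module" where
  "matrix_algebra_2 =
     \<lparr>carrier = carrier K \<times> carrier K \<times> carrier K \<times> carrier K,
      mult = (\<lambda>(p, q, r, s) (p', q', r', s').
        (p \<otimes> p' \<oplus> q \<otimes> r', p \<otimes> q' \<oplus> q \<otimes> s', r \<otimes> p' \<oplus> s \<otimes> r', r \<otimes> q' \<oplus> s \<otimes> s')),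
      one = (\<one>, \<zero>, \<zero>, \<one>),
      zero = (\<zero>, \<zero>, \<zero>, \<zero>),
      add = (\<lambda>(p, q, r, s) (p', q', r', s'). (p \<oplus> p', q \<oplus> q', r \<oplus> r', s \<oplus> s')),
      smult = (\<lambda>c (p, q, r, s). (c \<otimes> p, c \<otimes> q, c \<otimes> r, c \<otimes> s))\<rparr>"

definition algebra_isomorphic :: "('k, 'a) module \<Rightarrow> ('k, 'b) module \<Rightarrow> bool" where
  "algebra_isomorphic A B \<longleftrightarrow>
     (\<exists>h \<in> ring_iso A B. \<forall>c \<in> carrier K. \<forall>x \<in> carrier A. h (c \<odot>\<^bsub>A\<^esub> x) = c \<odot>\<^bsub>B\<^esub> h x)"

definition hilbert_symbol :: "'k \<Rightarrow> 'k \<Rightarrow> int" where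
  "hilbert_symbol a b =
     (if algebra_isomorphic (quaternion_algebra a b) matrix_algebra_2 then 1 else - 1)"

end


section \<open>Deterministic multitape Turing machines\<close>

text \<open>Tape symbols are natural numbers below the alphabet size, and \<open>0\<close> is the blank.  Tapes are
  infinite in both directions and are indexed relative to the head, which is at position \<open>0\<close>;
  moving the head by \<open>d\<close> shifts the tape contents by \<open>d\<close>.  The states are \<open>0, \<dots>, num_states\<close>, where
  \<open>0\<close> is the initial state and \<open>num_states\<close> is the halting state.  The transition function maps the
  state and the symbols scanned on the tapes to the new state and, for each tape, the symbol
  written and the head movement.\<close>

type_synonym tape = "int \<Rightarrow> nat"

record turing_machine =
  num_tapes :: nat
  num_symbols :: nat
  num_states :: nat
  transition :: "nat \<Rightarrow> nat list \<Rightarrow> nat \<times> (nat \<times> int) list"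

definition wf_turing_machine :: "turing_machine \<Rightarrow> bool" where
  "wf_turing_machine M \<longleftrightarrow>
     num_tapes M > 0 \<and> num_symbols M > 0 \<and>
     (\<forall>q < num_states M. \<forall>rs. length rs = num_tapes M \<and> set rs \<subseteq> {..<num_symbols M} \<longrightarrow>
        (case transition M q rs of (q', acts) \<Rightarrow>
           q' \<le> num_states M \<and> length acts = num_tapes M \<and>
           set acts \<subseteq> {..<num_symbols M} \<times> {-1, 0, 1}))"

definition act_on_tape :: "nat \<times> int \<Rightarrow> tape \<Rightarrow> tape" where
  "act_on_tape a t = (\<lambda>i. (t(0 := fst a)) (i + snd a))"

definition tm_step :: "turing_machine \<Rightarrow> nat \<times> tape list \<Rightarrow> nat \<times> tape list" where
  "tm_step M c =
     (case c of (q, ts) \<Rightarrow>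
        if q = num_states M then c
        else case transition M q (map (\<lambda>t. t 0) ts) of
          (q', acts) \<Rightarrow> (q', map2 act_on_tape acts ts))"

definition word_tape :: "nat list \<Rightarrow> tape" where
  "word_tape w = (\<lambda>i. if 0 \<le> i \<and> i < int (length w) then w ! nat i else 0)"

definition tm_init :: "turing_machine \<Rightarrow> nat list \<Rightarrow> nat \<times> tape list" where
  "tm_init M w = (0, word_tape w # replicate (num_tapes M - 1) (\<lambda>_. 0))"

text \<open>The output is the word on the first tape from the head up to the first blank.\<close>

definition tm_halts_with :: "turing_machine \<Rightarrow> nat list \<Rightarrow> nat \<Rightarrow> nat list \<Rightarrow> bool" where
  "tm_halts_with M w t u \<longleftrightarrow>
     (case (tm_step M ^^ t) (tm_init M w) of (q, ts) \<Rightarrow>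
        q = num_states M \<and> 0 \<notin> set u \<and>
        (\<forall>i \<le> length u. hd ts (int i) = word_tape u (int i)))"

definition poly_time_computable ::
    "'a set \<Rightarrow> ('a \<Rightarrow> nat list) \<Rightarrow> ('b \<Rightarrow> nat list) \<Rightarrow> ('a \<Rightarrow> 'b) \<Rightarrow> bool" where
  "poly_time_computable D enc_in enc_out f \<longleftrightarrow>
     (\<exists>M (p :: nat poly). wf_turing_machine M \<and>
        (\<forall>x\<in>D. set (enc_in x) \<subseteq> {1..<num_symbols M} \<and>
           (\<exists>t \<le> poly p (length (enc_in x)). tm_halts_with M (enc_in x) t (enc_out (f x)))))"


section \<open>Input and output encoding\<close>

text \<open>Symbols: \<open>1\<close> and \<open>2\<close> are the binary digits zero and one, \<open>3\<close> is the minus sign, \<open>4\<close> the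
  fraction bar and \<open>5\<close> ends a fraction.  Binary numerals are written least significant digit
  first, without leading zeros; the numeral of \<open>0\<close> is empty.  As the alphabet is fixed, the length
  of an encoding is the bit size up to a constant factor.\<close>

fun encode_nat :: "nat \<Rightarrow> nat list" where
  "encode_nat n = (if n = 0 then [] else (if even n then 1 else 2) # encode_nat (n div 2))"

declare encode_nat.simps [simp del]

definition encode_int :: "int \<Rightarrow> nat list" where
  "encode_int z = (if z < 0 then [3] else []) @ encode_nat (nat \<bar>z\<bar>)"

text \<open>\<^const>\<open>quotient_of\<close> yields the fraction in lowest terms with positive denominator.\<close>

definition encode_rat :: "rat \<Rightarrow> nat list" where
  "encode_rat r = (case quotient_of r of (n, d) \<Rightarrow> encode_int n @ [4] @ encode_int d @ [5])"

definition encode_element :: "rat poly \<Rightarrow> 'f::field_char_0 \<Rightarrow> 'f \<Rightarrow> nat list" where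
  "encode_element m \<theta> x = concat (map encode_rat (coordinates m \<theta> x))"

definition encode_pair :: "rat poly \<Rightarrow> 'f::field_char_0 \<Rightarrow> 'f \<times> 'f \<Rightarrow> nat list" where
  "encode_pair m \<theta> = (\<lambda>(a, b). encode_element m \<theta> a @ encode_element m \<theta> b)"

end

theory Submission
  imports Defs
begin

text \<open>
  The field and the place are fixed, and the Hilbert symbol only depends on the classes of \<open>a\<close> and
  \<open>b\<close> modulo squares of the completion.  Newton's iteration shows that \<open>a\<close> and \<open>a'\<close> have the
  same class if \<open>a' s\<^sup>2 / a\<close> is close to \<open>1\<close> for some \<open>s\<close>.  So it suffices to compute some invariant
  with finitely many values that determines \<open>a\<close> up to such a relation; the symbol is then looked up in
  a finite table.

  The invariant consists of the leading digits (at \<open>v\<close>) of the rational coordinates of \<open>\<beta>\<^sup>L a\<close>, where \<open>L\<close>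
  is the length of the input and \<open>\<beta>\<close> is a fixed element that is large at \<open>v\<close> in comparison with
  the other places over the same place of \<open>\<rat>\<close>.  Multiplication by \<open>\<beta>\<close> improves the ratio between the norm of
  the coordinate vector and \<open>v\<close> by a constant factor until it is bounded, and Siegel's lemma bounds the
  initial ratio exponentially in \<open>L\<close>; hence, for \<open>\<beta>\<^sup>L a\<close>, a small relative error of the coordinates is a small
  relative error at \<open>v\<close>.  By Ostrowski's theorem, digits to a base that is a square suit every place,
  with the leading ones at opposite ends in the archimedean and the \<open>p\<close>-adic case.

  The computation itself only ever applies fixed integer matrices to a vector of integers, one
  for each input symbol.  With the vector written in digits, this is a pass of a sequential transducer
  over a work tape, and the leading digits are found by a finite automaton.
\<close>


section \<open>Completions and square classes\<close>

text \<open>The obstacle is that a finite automaton sees only boundedly many digits, whereas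
  \<open>v\<close> may be one of several places over the same place of the rationals. The
  coordinates of \<open>a\<close> can be large because of the other places, and \<open>v a\<close>
  is then the result of a cancellation whose depth grows with the input. Powers of a fixed
  \<open>\<beta>\<close> undo this because both rates are exponential in the same length: the
  contraction factor of \<open>\<beta>\<close> is chosen after the constant in the Siegel bound, and
  one factor is spent on each input symbol. So \<open>\<beta>\<close> neither has to be an exact
  idempotent nor depends on the input. Multiplying by \<open>\<beta>^L\<close> and clearing
  denominators changes square classes by unknown factors. The input is therefore kept as two
  fractions with one denominator, \<open>a = P / D\<close> and \<open>b = A / D\<close>, in which
  these factors cancel; the leading digits of \<open>P\<close>, \<open>A\<close> and
  \<open>D\<close> together determine both classes. The other places and the local extension fields
  never appear as objects: all estimates compare \<open>v\<close> with the norm of the coordinate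
  vector, by means of rational polynomials.\<close>

locale abs_val =
  fixes v :: "'f::field_char_0 \<Rightarrow> real"
  assumes absolute_value: "absolute_value v"
begin

lemma nonneg [simp]: "v x \<ge> 0"
  and zero_iff [simp]: "v x = 0 \<longleftrightarrow> x = 0"
  and mult: "v (x * y) = v x * v y"
  and triangle: "v (x + y) \<le> v x + v y"
  using absolute_value by (auto simp: absolute_value_def)

lemma pos_iff [simp]: "v x > 0 \<longleftrightarrow> x \<noteq> 0"
  using nonneg[of x] zero_iff[of x] by linarith

lemma zero [simp]: "v 0 = 0" by simp

lemma one [simp]: "v 1 = 1"
proof -
  have "v 1 * v 1 = v 1" by (simp flip: mult)
  then show ?thesis by simp
qed

lemma minus [simp]: "v (- x) = v x"
proof -
  have "v (-1) * v (-1) = 1" by (simp flip: mult)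
  then have "v (-1) = 1"
    using nonneg[of "-1"] by (metis abs_of_nonneg power2_eq_square real_sqrt_abs real_sqrt_one)
  then show ?thesis using mult[of "-1" x] by simp
qed

lemma diff: "v (x - y) \<le> v x + v y"
  using triangle[of x "- y"] by simp

lemma diff_commute: "v (x - y) = v (y - x)"
  using minus[of "x - y"] by simp

lemma triangle_lower: "v x - v y \<le> v (x + y)"
  using diff[of "x + y" y] by simp

lemma divide: "v (x / y) = v x / v y"
  by (cases "y = 0") (simp_all add: eq_divide_eq flip: mult)

lemma power: "v (x ^ n) = v x ^ n"
  by (induction n) (simp_all add: mult)

lemma sum_le: "v (sum f A) \<le> (\<Sum>x\<in>A. v (f x))"
proof (induction A rule: infinite_finite_induct)
  case (insert x F)
  then show ?case using triangle[of "f x" "sum f F"] by simp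
qed auto

lemma of_nat_le: "v (of_nat n) \<le> real n"
proof (induction n)
  case (Suc n)
  then show ?case using triangle[of 1 "of_nat n"] by simp
qed simp

lemma of_int_le: "v (of_int z) \<le> \<bar>real_of_int z\<bar>"
proof (cases z)
  case (nonneg n)
  then show ?thesis using of_nat_le[of n] by simp
next
  case (neg n)
  then show ?thesis using of_nat_le[of "Suc n"] minus[of "of_nat (Suc n)"]
    by (simp del: minus)
qed

definition cau :: "(nat \<Rightarrow> 'f) \<Rightarrow> bool" where
  "cau X \<longleftrightarrow> (\<forall>e>0. \<exists>N. \<forall>m\<ge>N. \<forall>n\<ge>N. v (X m - X n) < e)"

lemma cau_const: "cau (\<lambda>n. a)"
  by (auto simp: cau_def)

lemma cau_add: assumes "cau X" "cau Y" shows "cau (\<lambda>n. X n + Y n)"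
  unfolding cau_def
proof (intro allI impI)
  fix e :: real assume "e > 0"
  then obtain N M where N: "\<forall>m\<ge>N. \<forall>n\<ge>N. v (X m - X n) < e / 2"
    and M: "\<forall>m\<ge>M. \<forall>n\<ge>M. v (Y m - Y n) < e / 2"
    using assms unfolding cau_def by (meson half_gt_zero)
  have "v (X m + Y m - (X n + Y n)) < e" if "m \<ge> max N M" "n \<ge> max N M" for m n
  proof -
    have "v (X m - X n) < e / 2" "v (Y m - Y n) < e / 2" using N M that by auto
    moreover have "v (X m + Y m - (X n + Y n)) \<le> v (X m - X n) + v (Y m - Y n)"
      using triangle[of "X m - X n" "Y m - Y n"] by (simp add: algebra_simps)
    ultimately show ?thesis by linarith
  qed
  then show "\<exists>N. \<forall>m\<ge>N. \<forall>n\<ge>N. v (X m + Y m - (X n + Y n)) < e" by blast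
qed

lemma cau_minus: "cau X \<Longrightarrow> cau (\<lambda>n. - X n)"
proof -
  have "v (- X m - - X n) = v (X m - X n)" for m n
    using minus[of "X m - X n"] by (simp add: algebra_simps)
  then show "cau X \<Longrightarrow> cau (\<lambda>n. - X n)" by (simp add: cau_def)
qed

lemma cau_bounded: assumes "cau X" obtains C where "C > 0" "\<And>n. v (X n) \<le> C"
proof -
  obtain N where N: "\<forall>m\<ge>N. \<forall>n\<ge>N. v (X m - X n) < 1"
    using assms unfolding cau_def by (meson zero_less_one)
  have le: "v (X n) \<le> 1 + (\<Sum>k\<le>N. v (X k))" for n
  proof (cases "n \<ge> N")
    case True
    then have "v (X n - X N) < 1" using N by blast
    moreover have "v (X n) \<le> v (X n - X N) + v (X N)" using triangle[of "X n - X N" "X N"] by simp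
    moreover have "v (X N) \<le> (\<Sum>k\<le>N. v (X k))" by (rule member_le_sum) auto
    ultimately show ?thesis by linarith
  next
    case False
    then have "v (X n) \<le> (\<Sum>k\<le>N. v (X k))" by (intro member_le_sum) auto
    then show ?thesis by linarith
  qed
  have "1 + (\<Sum>k\<le>N. v (X k)) > 0"
    by (rule add_pos_nonneg) (auto intro: sum_nonneg)
  then show ?thesis using le that by blast
qed

lemma cau_mult: assumes "cau X" "cau Y" shows "cau (\<lambda>n. X n * Y n)"
  unfolding cau_def
proof (intro allI impI)
  obtain C where C: "C > 0" "\<And>n. v (X n) \<le> C" using cau_bounded[OF assms(1)] by blast
  obtain D where D: "D > 0" "\<And>n. v (Y n) \<le> D" using cau_bounded[OF assms(2)] by blast
  fix e :: real assume e: "e > 0"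
  have "e / (2 * D) > 0" "e / (2 * C) > 0" using e C D by auto
  then obtain N M where N: "\<forall>m\<ge>N. \<forall>n\<ge>N. v (X m - X n) < e / (2 * D)"
    and M: "\<forall>m\<ge>M. \<forall>n\<ge>M. v (Y m - Y n) < e / (2 * C)"
    using assms unfolding cau_def by metis
  have "v (X m * Y m - X n * Y n) < e" if "m \<ge> max N M" "n \<ge> max N M" for m n
  proof -
    have a: "v (X m - X n) < e / (2 * D)" "v (Y m - Y n) < e / (2 * C)" using N M that by auto
    have "v (X m - X n) * v (Y m) \<le> v (X m - X n) * D" by (intro mult_left_mono D) auto
    also have "\<dots> < e / 2" using a(1) D by (simp add: field_simps)
    finally have 1: "v (X m - X n) * v (Y m) < e / 2" .
    have "v (X n) * v (Y m - Y n) \<le> C * v (Y m - Y n)" by (intro mult_right_mono C) auto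
    also have "\<dots> < e / 2" using a(2) C by (simp add: field_simps)
    finally have 2: "v (X n) * v (Y m - Y n) < e / 2" .
    have "X m * Y m - X n * Y n = (X m - X n) * Y m + X n * (Y m - Y n)" by (simp add: algebra_simps)
    then have "v (X m * Y m - X n * Y n) \<le> v (X m - X n) * v (Y m) + v (X n) * v (Y m - Y n)"
      using triangle mult by metis
    then show ?thesis using 1 2 by linarith
  qed
  then show "\<exists>N. \<forall>m\<ge>N. \<forall>n\<ge>N. v (X m * Y m - X n * Y n) < e" by blast
qed

definition null :: "(nat \<Rightarrow> 'f) \<Rightarrow> bool" where
  "null X \<longleftrightarrow> (\<lambda>n. v (X n)) \<longlonglongrightarrow> 0"

lemma null_imp_cau: assumes "null X" shows "cau X"
  unfolding cau_def
proof (intro allI impI)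
  fix e :: real assume "e > 0"
  then obtain N where N: "\<forall>n\<ge>N. v (X n) < e / 2"
    using assms unfolding null_def LIMSEQ_def dist_real_def
    by (metis abs_of_nonneg diff_0_right half_gt_zero nonneg)
  have "v (X m - X n) < e" if "m \<ge> N" "n \<ge> N" for m n
    using N[rule_format, OF that(1)] N[rule_format, OF that(2)] diff[of "X m" "X n"] by linarith
  then show "\<exists>N. \<forall>m\<ge>N. \<forall>n\<ge>N. v (X m - X n) < e" by blast
qed

lemma null_le: assumes "\<And>n. v (X n) \<le> f n" "f \<longlonglongrightarrow> 0" shows "null X"
  unfolding null_def
  by (rule tendsto_sandwich[OF _ _ tendsto_const assms(2)]) (auto simp: assms(1))

lemma null_add: "null X \<Longrightarrow> null Y \<Longrightarrow> null (\<lambda>n. X n + Y n)"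
  by (rule null_le[OF triangle]) (auto simp: null_def intro!: tendsto_add_zero)

lemma null_mult: assumes "cau X" "null Y" shows "null (\<lambda>n. X n * Y n)"
proof -
  obtain C where C: "C > 0" "\<And>n. v (X n) \<le> C" using cau_bounded[OF assms(1)] by blast
  show ?thesis
  proof (rule null_le)
    show "v (X n * Y n) \<le> C * v (Y n)" for n
      by (simp add: mult mult_right_mono C)
    show "(\<lambda>n. C * v (Y n)) \<longlonglongrightarrow> 0"
      using assms(2) by (auto simp: null_def intro: tendsto_mult_right_zero)
  qed
qed

end

section \<open>The completion as a quotient of the ring of Cauchy sequences\<close>

locale place = abs_val v for v :: "'f::field_char_0 \<Rightarrow> real" +
  fixes V :: "('f \<Rightarrow> real) set"
  assumes V_eq: "V = {w. absolute_value w \<and> equivalent_av v w}"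
    and nontrivial: "\<exists>x. x \<noteq> 0 \<and> v x \<noteq> 1"
begin

lemma v_in_V: "v \<in> V"
  using absolute_value by (auto simp: V_eq equivalent_av_def intro!: exI[of _ 1])

lemma V_E: assumes "w \<in> V" obtains s where "s > 0" "\<And>x. w x = v x powr s"
  using assms by (auto simp: V_eq equivalent_av_def)

text \<open>Every member of the class is \<open>v\<close> raised to a positive power, so the two
  notions of smallness differ only by rescaling \<open>e\<close>. From here on \<open>v\<close> can
  stand for the whole place.\<close>

lemma cauchy_iff: "(\<forall>w\<in>V. \<forall>e>0. \<exists>N. \<forall>m\<ge>N. \<forall>n\<ge>N. w (X m - X n) < e) \<longleftrightarrow> cau X"
proof
  assume X: "cau X"
  show "\<forall>w\<in>V. \<forall>e>0. \<exists>N. \<forall>m\<ge>N. \<forall>n\<ge>N. w (X m - X n) < e"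
  proof (intro ballI allI impI)
    fix w and e :: real assume "w \<in> V" "e > 0"
    then obtain s where s: "s > 0" "\<And>x. w x = v x powr s" using V_E by metis
    have "e powr (1 / s) > 0" using \<open>e > 0\<close> by simp
    then obtain N where N: "\<forall>m\<ge>N. \<forall>n\<ge>N. v (X m - X n) < e powr (1 / s)"
      using X unfolding cau_def by metis
    have "w (X m - X n) < e" if "m \<ge> N" "n \<ge> N" for m n
    proof -
      have "v (X m - X n) powr s < (e powr (1 / s)) powr s"
        using N that s by (intro powr_less_mono2) auto
      then show ?thesis using s \<open>e > 0\<close> by (simp add: powr_powr)
    qed
    then show "\<exists>N. \<forall>m\<ge>N. \<forall>n\<ge>N. w (X m - X n) < e" by blast
  qed
qed (use v_in_V in \<open>auto simp: cau_def\<close>)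

lemma null_iff: "(\<forall>w\<in>V. (\<lambda>n. w (X n)) \<longlonglongrightarrow> 0) \<longleftrightarrow> null X"
proof
  assume X: "null X"
  show "\<forall>w\<in>V. (\<lambda>n. w (X n)) \<longlonglongrightarrow> 0"
  proof
    fix w assume "w \<in> V"
    then obtain s where s: "s > 0" "\<And>x. w x = v x powr s" using V_E by metis
    have "(\<lambda>n. v (X n) powr s) \<longlonglongrightarrow> 0"
      using X s by (intro tendsto_zero_powrI[where b = s]) (auto simp: null_def)
    then show "(\<lambda>n. w (X n)) \<longlonglongrightarrow> 0" by (simp add: s)
  qed
qed (use v_in_V in \<open>auto simp: null_def\<close>)

lemma carrier_cauchy_ring: "carrier (cauchy_ring V) = Collect cau"
  by (simp add: cauchy_ring_def cauchy_iff)

lemma null_sequences_eq: "null_sequences V = Collect null"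
  by (simp add: null_sequences_def null_iff)

lemma cauchy_ring_ops [simp]:
  "X \<otimes>\<^bsub>cauchy_ring V\<^esub> Y = (\<lambda>n. X n * Y n)" "X \<oplus>\<^bsub>cauchy_ring V\<^esub> Y = (\<lambda>n. X n + Y n)"
  "\<one>\<^bsub>cauchy_ring V\<^esub> = (\<lambda>n. 1)" "\<zero>\<^bsub>cauchy_ring V\<^esub> = (\<lambda>n. 0)"
  by (simp_all add: cauchy_ring_def)

lemma cring_cauchy: "cring (cauchy_ring V)"
proof (rule cringI)
  show "abelian_group (cauchy_ring V)"
  proof (rule abelian_groupI)
    fix X assume "X \<in> carrier (cauchy_ring V)"
    then show "\<exists>Y\<in>carrier (cauchy_ring V). Y \<oplus>\<^bsub>cauchy_ring V\<^esub> X = \<zero>\<^bsub>cauchy_ring V\<^esub>"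
      by (intro bexI[of _ "\<lambda>n. - X n"]) (auto simp: carrier_cauchy_ring cau_minus)
  qed (auto simp: carrier_cauchy_ring cau_add cau_const algebra_simps)
  show "comm_monoid (cauchy_ring V)"
    by (rule comm_monoidI) (auto simp: carrier_cauchy_ring cau_mult cau_const algebra_simps)
qed (auto simp: algebra_simps)

lemma a_inv_cauchy: assumes "cau X" shows "\<ominus>\<^bsub>cauchy_ring V\<^esub> X = (\<lambda>n. - X n)"
proof -
  interpret cring "cauchy_ring V" by (rule cring_cauchy)
  show ?thesis using assms cau_minus[OF assms]
    by (intro minus_equality) (auto simp: carrier_cauchy_ring)
qed

lemma ideal_null: "ideal (null_sequences V) (cauchy_ring V)"
proof -
  interpret cring "cauchy_ring V" by (rule cring_cauchy)
  show ?thesis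
  proof (rule idealI)
    show "ring (cauchy_ring V)" by (rule ring_axioms)
    show "subgroup (null_sequences V) (add_monoid (cauchy_ring V))"
    proof
      show "null_sequences V \<subseteq> carrier (add_monoid (cauchy_ring V))"
        by (auto simp: null_sequences_eq carrier_cauchy_ring null_imp_cau)
      show "\<one>\<^bsub>add_monoid (cauchy_ring V)\<^esub> \<in> null_sequences V"
        by (simp add: null_sequences_eq null_def)
      fix X Y assume X: "X \<in> null_sequences V" "Y \<in> null_sequences V"
      then show "X \<otimes>\<^bsub>add_monoid (cauchy_ring V)\<^esub> Y \<in> null_sequences V"
        by (simp add: null_sequences_eq null_add)
      have "inv\<^bsub>add_monoid (cauchy_ring V)\<^esub> X = (\<lambda>n. - X n)"
        using a_inv_cauchy[of X] X by (simp add: a_inv_def null_sequences_eq null_imp_cau)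
      then show "inv\<^bsub>add_monoid (cauchy_ring V)\<^esub> X \<in> null_sequences V"
        using X by (simp add: null_sequences_eq null_def)
    qed
  next
    fix X Y assume *: "X \<in> null_sequences V" "Y \<in> carrier (cauchy_ring V)"
    then have "null (\<lambda>n. Y n * X n)"
      by (auto simp: null_sequences_eq carrier_cauchy_ring intro: null_mult)
    then show "Y \<otimes>\<^bsub>cauchy_ring V\<^esub> X \<in> null_sequences V"
      and "X \<otimes>\<^bsub>cauchy_ring V\<^esub> Y \<in> null_sequences V"
      by (simp_all add: null_sequences_eq mult.commute)
  qed
qed

lemma cring_completion: "cring (completion V)"
  unfolding completion_def by (rule ideal.quotient_is_cring[OF ideal_null cring_cauchy])

lemma hom: "(+>\<^bsub>cauchy_ring V\<^esub>) (null_sequences V) \<in> ring_hom (cauchy_ring V) (completion V)"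
  unfolding completion_def by (rule ideal.rcos_ring_hom[OF ideal_null])

lemma to_completion_closed: "to_completion V a \<in> carrier (completion V)"
  unfolding to_completion_def by (rule ring_hom_closed[OF hom]) (simp add: carrier_cauchy_ring cau_const)

lemma to_completion_mult:
  "to_completion V (a * b) = to_completion V a \<otimes>\<^bsub>completion V\<^esub> to_completion V b"
  unfolding to_completion_def
  using ring_hom_mult[OF hom, of "\<lambda>n. a" "\<lambda>n. b"] by (simp add: carrier_cauchy_ring cau_const)

lemma to_completion_one: "to_completion V 1 = \<one>\<^bsub>completion V\<^esub>"
  unfolding to_completion_def using ring_hom_one[OF hom] by simp

lemma to_completion_unit: "a \<noteq> 0 \<Longrightarrow> to_completion V a \<in> Units (completion V)"
  unfolding Units_def
  using to_completion_closed to_completion_mult[of a "inverse a"] to_completion_mult[of "inverse a" a]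
    to_completion_one by auto

text \<open>The root is the class of \<open>X\<close> itself: its square and the constant sequence
  \<open>u\<close> differ by a null sequence. Approximate square roots inside the field are thus
  enough.\<close>

lemma to_completion_square:
  assumes "cau X" "null (\<lambda>n. X n * X n - u)"
  shows "\<exists>c\<in>carrier (completion V). to_completion V u = c \<otimes>\<^bsub>completion V\<^esub> c"
proof -
  interpret I: ideal "null_sequences V" "cauchy_ring V" by (rule ideal_null)
  interpret cring "cauchy_ring V" by (rule cring_cauchy)
  let ?c = "null_sequences V +>\<^bsub>cauchy_ring V\<^esub> X"
  have X: "X \<in> carrier (cauchy_ring V)" using assms by (simp add: carrier_cauchy_ring)
  have XX: "(\<lambda>n. X n * X n) \<in> carrier (cauchy_ring V)"
    using assms by (simp add: carrier_cauchy_ring cau_mult)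
  have u: "(\<lambda>n. u) \<in> carrier (cauchy_ring V)" by (simp add: carrier_cauchy_ring cau_const)
  have "(\<lambda>n. X n * X n) \<ominus>\<^bsub>cauchy_ring V\<^esub> (\<lambda>n. u) \<in> null_sequences V"
    using assms by (simp add: a_minus_def a_inv_cauchy cau_const null_sequences_eq)
  then have "null_sequences V +>\<^bsub>cauchy_ring V\<^esub> (\<lambda>n. X n * X n) = to_completion V u"
    unfolding to_completion_def using I.quotient_eq_iff_same_a_r_cos[OF ideal_null XX u] by simp
  moreover have "null_sequences V +>\<^bsub>cauchy_ring V\<^esub> (\<lambda>n. X n * X n) = ?c \<otimes>\<^bsub>completion V\<^esub> ?c"
    using ring_hom_mult[OF hom X X] by simp
  moreover have "?c \<in> carrier (completion V)" by (rule ring_hom_closed[OF hom X])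
  ultimately show ?thesis by metis
qed

end

section \<open>Square roots by Newton's iteration\<close>

context abs_val
begin

lemma cau_geometric: assumes "\<And>n. v (X (Suc n) - X n) \<le> C / 2 ^ n" shows "cau X"
  unfolding cau_def
proof (intro allI impI)
  have le: "v (X (n + k) - X n) \<le> 2 * C / 2 ^ n - 2 * C / 2 ^ (n + k)" for n k
  proof (induction k)
    case (Suc k)
    have "v (X (n + Suc k) - X n) \<le> v (X (Suc (n + k)) - X (n + k)) + v (X (n + k) - X n)"
      using triangle[of "X (Suc (n + k)) - X (n + k)" "X (n + k) - X n"] by simp
    also have "\<dots> \<le> C / 2 ^ (n + k) + (2 * C / 2 ^ n - 2 * C / 2 ^ (n + k))"
      using Suc assms[of "n + k"] by linarith
    also have "\<dots> = 2 * C / 2 ^ n - 2 * C / 2 ^ (n + Suc k)" by (simp add: field_simps)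
    finally show ?case .
  qed simp
  have C: "C \<ge> 0" using order_trans[OF nonneg assms[of 0]] by simp
  fix e :: real assume e: "e > 0"
  have "(\<lambda>n. 2 * C / 2 ^ n) \<longlonglongrightarrow> 0" by (intro LIMSEQ_divide_realpow_zero) simp
  then obtain N where N: "2 * C / 2 ^ N < e"
    using e C unfolding LIMSEQ_def by (metis abs_of_nonneg diff_0_right dist_real_def order_refl divide_nonneg_pos mult_nonneg_nonneg zero_le_numeral zero_less_numeral zero_less_power)
  have *: "v (X m - X n) < e" if "m \<ge> n" "n \<ge> N" for m n
  proof -
    have "v (X m - X n) \<le> 2 * C / 2 ^ n - 2 * C / 2 ^ m" using le[of n "m - n"] that by simp
    also have "\<dots> \<le> 2 * C / 2 ^ n" using C by simp
    also have "\<dots> \<le> 2 * C / 2 ^ N" using that C by (intro divide_left_mono) (auto intro: power_increasing)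
    finally show ?thesis using N by simp
  qed
  have "v (X m - X n) < e" if "m \<ge> N" "n \<ge> N" for m n
    using *[of m n] *[of n m] that diff_commute[of "X m" "X n"] by (cases "m \<ge> n") auto
  then show "\<exists>N. \<forall>m\<ge>N. \<forall>n\<ge>N. v (X m - X n) < e" by blast
qed

text \<open>Newton's iteration \<open>x \<mapsto> (x + u/x)/2\<close> never leaves the field, and its relative error
  \<open>y = x\<^sup>2/u - 1\<close> obeys \<open>y \<mapsto> y\<^sup>2/(4(1 + y))\<close>, whether or not the absolute value is archimedean.\<close>

lemma square_root_approximation:
  obtains \<epsilon> where "\<epsilon> > 0"
    "\<And>u. v (u - 1) \<le> \<epsilon> \<Longrightarrow> \<exists>X. cau X \<and> null (\<lambda>n. X n * X n - u)"
proof
  \<comment> \<open>The bound \<open>1 / 2\<close> keeps \<open>v (1 + y)\<close> at least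
    \<open>1 / 2\<close>. The bound \<open>v 4 / 4\<close> makes each iteration halve the error; it
    matters above 2, where \<open>v 4\<close> is small.\<close>
  define e where "e = min (1 / 2) (v 4 / 4)"
  have e: "0 < e" "e \<le> 1 / 2" "e \<le> v 4 / 4" by (auto simp: e_def)
  show "e / 2 > 0" using e by simp
  fix u assume u: "v (u - 1) \<le> e / 2"
  have u1: "v u \<ge> 1 / 2" using triangle_lower[of 1 "u - 1"] u e by simp
  have u2: "v u \<le> 2" using triangle[of 1 "u - 1"] u e by simp
  have u0: "u \<noteq> 0" using u1 by auto
  define X where "X = rec_nat 1 (\<lambda>_ x. (x + u / x) / 2)"
  have X_0: "X 0 = 1" and X_Suc: "X (Suc n) = (X n + u / X n) / 2" for n
    by (simp_all add: X_def)
  define y where "y n = X n * X n / u - 1" for n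
  have Xsq: "X n * X n = u * (1 + y n)" for n using u0 by (simp add: y_def)
  have y1: "v (1 + y n) \<ge> 1 / 2" if "v (y n) \<le> e / 2 ^ n" for n
  proof -
    have "e / 2 ^ n \<le> e / 1" using e by (intro divide_left_mono) auto
    then show ?thesis using triangle_lower[of 1 "y n"] that e by simp
  qed
  have y: "v (y n) \<le> e / 2 ^ n" for n
  proof (induction n)
    case 0
    have "y 0 = - (u - 1) / u" using u0 by (simp add: y_def X_0 field_simps)
    then have "v (y 0) = v (u - 1) / v u" by (simp only: divide minus)
    also have "\<dots> \<le> (e / 2) / (1 / 2)" using u u1 e by (intro frac_le) auto
    finally show ?case by simp
  next
    case (Suc n)
    have n0: "1 + y n \<noteq> 0" using y1[OF Suc] by auto
    then have X0: "X n \<noteq> 0" using Xsq[of n] u0 by auto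
    have "y (Suc n) = (X n * X n - u) ^ 2 / (4 * (X n * X n) * u)"
      unfolding y_def X_Suc using X0 u0 by (simp add: field_simps power2_eq_square)
    also have "\<dots> = y n ^ 2 / (4 * (1 + y n))"
    proof -
      have "X n * X n - u = u * y n" by (simp add: Xsq algebra_simps)
      then show ?thesis using u0 n0 by (simp only: Xsq) (simp add: power2_eq_square)
    qed
    finally have "v (y (Suc n)) = v (y n) * v (y n) / (v 4 * v (1 + y n))"
      by (simp only: divide mult power2_eq_square)
    also have "\<dots> \<le> v (y n) * v (y n) / (v 4 * (1 / 2))"
      using y1[OF Suc] n0 by (intro divide_left_mono mult_left_mono) auto
    also have "\<dots> = v (y n) * (2 * v (y n) / v 4)" by simp
    also have "\<dots> \<le> v (y n) * (1 / 2)"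
    proof (intro mult_left_mono)
      have "e / 2 ^ n \<le> e / 1" using e by (intro divide_left_mono) auto
      then have "4 * v (y n) \<le> v 4" using Suc e by linarith
      then show "2 * v (y n) / v 4 \<le> 1 / 2" by (simp add: divide_le_eq)
    qed simp
    also have "\<dots> \<le> e / 2 ^ Suc n" using Suc by simp
    finally show ?case .
  qed
  have Xlow: "v (X n) \<ge> 1 / 2" for n
  proof -
    have "v (X n) * v (X n) = v u * v (1 + y n)" by (simp only: mult[symmetric] Xsq)
    also have "\<dots> \<ge> (1 / 2) * (1 / 2)" using u1 y1[OF y] by (intro mult_mono) auto
    finally have "(1 / 2)\<^sup>2 \<le> (v (X n))\<^sup>2" by (simp add: power2_eq_square)
    then show ?thesis by (rule power2_le_imp_le) simp
  qed
  have uy: "v (u * y n) \<le> 2 * e / 2 ^ n" for n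
    using mult_mono[OF u2 y[of n]] by (simp add: mult)
  have "cau X"
  proof (rule cau_geometric)
    fix n
    have X0: "X n \<noteq> 0" using Xlow[of n] by auto
    have "X (Suc n) - X n = - (X n * X n - u) / (2 * X n)"
      unfolding X_Suc using X0 by (simp add: field_simps)
    also have "\<dots> = - (u * y n) / (2 * X n)" by (simp add: Xsq algebra_simps)
    finally have "v (X (Suc n) - X n) = v (u * y n) / (v 2 * v (X n))"
      by (simp only: divide minus mult)
    also have "\<dots> \<le> (2 * e / 2 ^ n) / (v 2 * (1 / 2))"
      using uy[of n] Xlow[of n] e by (intro frac_le mult_left_mono) auto
    finally show "v (X (Suc n) - X n) \<le> (4 * e / v 2) / 2 ^ n" by (simp add: field_simps)
  qed
  moreover have "null (\<lambda>n. X n * X n - u)"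
  proof (rule null_le)
    show "v (X n * X n - u) \<le> 2 * e / 2 ^ n" for n
      using uy[of n] by (simp add: Xsq algebra_simps)
    show "(\<lambda>n. 2 * e / 2 ^ n) \<longlonglongrightarrow> 0" by (intro LIMSEQ_divide_realpow_zero) simp
  qed
  ultimately show "\<exists>X. cau X \<and> null (\<lambda>n. X n * X n - u)" by blast
qed

end

text \<open>In the algebra for \<open>a\<close>, \<open>b\<close> the elements \<open>c i\<close>
  and \<open>d j\<close> still anticommute and have squares \<open>a c^2\<close> and
  \<open>b d^2\<close>. The map \<open>h\<close> sends the new generators to these, and it is
  bijective because \<open>c\<close> and \<open>d\<close> are units.\<close>

lemma (in cring) hilbert_symbol_mult_square_aux:
  assumes car: "a \<in> carrier R" "b \<in> carrier R" and c: "c \<in> Units R" and d: "d \<in> Units R"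
    and iso: "algebra_isomorphic R (quaternion_algebra R a b) (matrix_algebra_2 R)"
  shows "algebra_isomorphic R (quaternion_algebra R (a \<otimes> c \<otimes> c) (b \<otimes> d \<otimes> d)) (matrix_algebra_2 R)"
proof -
  let ?A = "quaternion_algebra R (a \<otimes> c \<otimes> c) (b \<otimes> d \<otimes> d)"
  let ?B = "quaternion_algebra R a b"
  let ?M = "matrix_algebra_2 R"
  define h where "h = (\<lambda>(x0 :: 'a, x1, x2, x3). (x0, c \<otimes> x1, d \<otimes> x2, c \<otimes> d \<otimes> x3))"
  define h' where "h' = (\<lambda>(x0 :: 'a, x1, x2, x3). (x0, inv c \<otimes> x1, inv d \<otimes> x2, inv c \<otimes> inv d \<otimes> x3))"
  have cc: "c \<in> carrier R" "d \<in> carrier R" "inv c \<in> carrier R" "inv d \<in> carrier R"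
    using c d by auto
  have hom: "h \<in> ring_hom ?A ?B"
    by (rule ring_hom_memI)
      (auto simp: h_def quaternion_algebra_def car cc a_minus_def r_distr r_minus m_ac)
  have inv_l: "c \<otimes> (inv c \<otimes> x) = x" "inv c \<otimes> (c \<otimes> x) = x"
    "d \<otimes> (inv d \<otimes> x) = x" "inv d \<otimes> (d \<otimes> x) = x"
    if "x \<in> carrier R" for x
    using c d cc that by (simp_all add: m_assoc[symmetric])
  have perm: "inv c \<otimes> inv d \<otimes> (c \<otimes> d \<otimes> x) = inv c \<otimes> (c \<otimes> (inv d \<otimes> (d \<otimes> x)))"
    "c \<otimes> d \<otimes> (inv c \<otimes> inv d \<otimes> x) = c \<otimes> (inv c \<otimes> (d \<otimes> (inv d \<otimes> x)))"
    if "x \<in> carrier R" for x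
    using cc that by (simp_all add: m_ac)
  have bij: "bij_betw h (carrier ?A) (carrier ?B)"
    by (rule bij_betwI[where g = h'])
      (auto simp: h_def h'_def quaternion_algebra_def cc inv_l perm)
  obtain g where g: "g \<in> ring_iso ?B ?M"
    "\<And>k x. k \<in> carrier R \<Longrightarrow> x \<in> carrier ?B \<Longrightarrow> g (k \<odot>\<^bsub>?B\<^esub> x) = k \<odot>\<^bsub>?M\<^esub> g x"
    using iso unfolding algebra_isomorphic_def by blast
  have "g \<circ> h \<in> ring_iso ?A ?M"
    using g(1) hom bij by (auto simp: ring_iso_def intro: ring_hom_trans bij_betw_trans)
  moreover have "h x \<in> carrier ?B" "h (k \<odot>\<^bsub>?A\<^esub> x) = k \<odot>\<^bsub>?B\<^esub> h x"
    if "k \<in> carrier R" "x \<in> carrier ?A" for k x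
    using that cc by (auto simp: h_def quaternion_algebra_def m_ac)
  ultimately show ?thesis
    unfolding algebra_isomorphic_def using g(2) by (intro bexI[of _ "g \<circ> h"]) auto
qed

lemma (in cring) hilbert_symbol_mult_square:
  assumes "a \<in> carrier R" "b \<in> carrier R" "c \<in> Units R" "d \<in> Units R"
  shows "hilbert_symbol R (a \<otimes> c \<otimes> c) (b \<otimes> d \<otimes> d) = hilbert_symbol R a b"
proof -
  have cancel: "x \<otimes> y \<otimes> y \<otimes> inv y \<otimes> inv y = x" if "x \<in> carrier R" "y \<in> Units R" for x y
  proof -
    have "x \<otimes> y \<otimes> y \<otimes> inv y \<otimes> inv y = x \<otimes> (y \<otimes> inv y) \<otimes> (y \<otimes> inv y)"
      using that Units_closed[OF that(2)] Units_inv_closed[OF that(2)] by (simp only: m_ac m_closed)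
    then show ?thesis using that by simp
  qed
  note aux = hilbert_symbol_mult_square_aux
  have "algebra_isomorphic R (quaternion_algebra R (a \<otimes> c \<otimes> c) (b \<otimes> d \<otimes> d)) (matrix_algebra_2 R)
     \<longleftrightarrow> algebra_isomorphic R (quaternion_algebra R a b) (matrix_algebra_2 R)"
    using aux[of a b c d] aux[of "a \<otimes> c \<otimes> c" "b \<otimes> d \<otimes> d" "inv c" "inv d"] assms
    by (auto simp: cancel Units_closed)
  then show ?thesis by (simp add: hilbert_symbol_def)
qed

text \<open>A number close to \<open>1\<close> is a square in the completion, so \<open>a'\<close>
  and \<open>a\<close> differ there by the square of a unit. The free parameters \<open>s\<close>
  and \<open>t\<close> will absorb digit shifts and denominators.\<close>

lemma (in place) hilbert_symbol_locally_constant: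
  obtains \<epsilon> where "\<epsilon> > 0"
    "\<And>a b a' b' s t. \<lbrakk>a \<noteq> 0; b \<noteq> 0; s \<noteq> 0; t \<noteq> 0; v (a' * s\<^sup>2 / a - 1) \<le> \<epsilon>; v (b' * t\<^sup>2 / b - 1) \<le> \<epsilon>;
        a' \<noteq> 0; b' \<noteq> 0\<rbrakk> \<Longrightarrow>
       hilbert_symbol (completion V) (to_completion V a') (to_completion V b') =
       hilbert_symbol (completion V) (to_completion V a) (to_completion V b)"
proof -
  interpret K: cring "completion V" by (rule cring_completion)
  obtain \<epsilon> where \<epsilon>: "\<epsilon> > 0"
    "\<And>u. v (u - 1) \<le> \<epsilon> \<Longrightarrow> \<exists>X. cau X \<and> null (\<lambda>n. X n * X n - u)"
    using square_root_approximation by blast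
  have sq: "\<exists>c\<in>Units (completion V). to_completion V a' =
      to_completion V a \<otimes>\<^bsub>completion V\<^esub> c \<otimes>\<^bsub>completion V\<^esub> c"
    if asms: "a \<noteq> 0" "s \<noteq> 0" "v (a' * s\<^sup>2 / a - 1) \<le> \<epsilon>" "a' \<noteq> 0" for a a' s
  proof -
    let ?u = "a' * s\<^sup>2 / a"
    obtain X where "cau X" "null (\<lambda>n. X n * X n - ?u)" using \<epsilon>(2)[OF asms(3)] by blast
    then obtain c where c: "c \<in> carrier (completion V)" "to_completion V ?u = c \<otimes>\<^bsub>completion V\<^esub> c"
      using to_completion_square by blast
    let ?c = "c \<otimes>\<^bsub>completion V\<^esub> to_completion V (inverse s)"
    have cc: "c \<otimes>\<^bsub>completion V\<^esub> c \<in> Units (completion V)"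
      using to_completion_unit[of ?u] asms c(2) by simp
    \<comment> \<open>Only the structure of a commutative ring is at hand, so \<open>c\<close> is
      inverted through \<open>c * c\<close>, which is a unit as the image of a nonzero field
      element.\<close>
    define d where "d = c \<otimes>\<^bsub>completion V\<^esub> inv\<^bsub>completion V\<^esub> (c \<otimes>\<^bsub>completion V\<^esub> c)"
    have d: "d \<in> carrier (completion V)" "c \<otimes>\<^bsub>completion V\<^esub> d = \<one>\<^bsub>completion V\<^esub>"
      using c(1) K.Units_r_inv[OF cc] K.Units_inv_closed[OF cc]
      unfolding d_def by (simp_all add: K.m_assoc[symmetric])
    then have "c \<in> Units (completion V)"
      unfolding Units_def using c(1) K.m_comm[OF c(1) d(1)] by auto
    then have 1: "?c \<in> Units (completion V)"
      using asms by (intro K.Units_m_closed to_completion_unit) auto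
    have "a' = a * ?u * inverse s * inverse s"
      using asms by (simp add: field_simps power2_eq_square)
    then have "to_completion V a' = to_completion V (a * ?u * inverse s * inverse s)" by simp
    also have "\<dots> = to_completion V a \<otimes>\<^bsub>completion V\<^esub> (c \<otimes>\<^bsub>completion V\<^esub> c) \<otimes>\<^bsub>completion V\<^esub>
        to_completion V (inverse s) \<otimes>\<^bsub>completion V\<^esub> to_completion V (inverse s)"
      by (simp only: to_completion_mult c(2))
    also have "\<dots> = to_completion V a \<otimes>\<^bsub>completion V\<^esub> ?c \<otimes>\<^bsub>completion V\<^esub> ?c"
      using c(1) to_completion_closed by (simp add: K.m_ac)
    finally show ?thesis using 1 by blast
  qed
  show ?thesis
  proof (rule that[OF \<epsilon>(1)])
    fix a b a' b' s t
    assume "a \<noteq> 0" "b \<noteq> 0" "s \<noteq> 0" "t \<noteq> 0" "v (a' * s\<^sup>2 / a - 1) \<le> \<epsilon>" "v (b' * t\<^sup>2 / b - 1) \<le> \<epsilon>"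
      "a' \<noteq> 0" "b' \<noteq> 0"
    then show "hilbert_symbol (completion V) (to_completion V a') (to_completion V b') =
       hilbert_symbol (completion V) (to_completion V a) (to_completion V b)"
      using sq[of a s a'] sq[of b t b'] K.hilbert_symbol_mult_square to_completion_closed by metis
  qed
qed

section \<open>Singling out one place\<close>

locale number_field_val = abs_val v for v :: "'f::field_char_0 \<Rightarrow> real" +
  fixes m :: "rat poly" and \<theta> :: 'f
  assumes number_field: "number_field m \<theta>"
begin

definition Vq :: "rat \<Rightarrow> real" where "Vq r = v (of_rat r)"
definition ev :: "rat poly \<Rightarrow> 'f" where "ev q = poly (map_poly of_rat q) \<theta>"
text \<open>The sum norm is submultiplicative for every absolute value, which spares a distinction
  between archimedean and other places.\<close>

definition pn :: "rat poly \<Rightarrow> real" where "pn q = (\<Sum>k\<le>degree q. Vq (coeff q k))"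

abbreviation n :: nat where "n \<equiv> degree m"

lemma Vq_nonneg [simp]: "Vq r \<ge> 0" and Vq_zero_iff [simp]: "Vq r = 0 \<longleftrightarrow> r = 0"
  and Vq_mult: "Vq (r * s) = Vq r * Vq s" and Vq_add: "Vq (r + s) \<le> Vq r + Vq s"
  and Vq_minus [simp]: "Vq (- r) = Vq r" and Vq_1 [simp]: "Vq 1 = 1"
  by (simp_all add: Vq_def of_rat_mult of_rat_add of_rat_minus mult triangle)

lemma Vq_0 [simp]: "Vq 0 = 0" by simp

lemma Vq_of_nat_le: "Vq (of_nat k) \<le> real k"
  by (simp add: Vq_def of_nat_le)

lemma ev_0 [simp]: "ev 0 = 0" and ev_1 [simp]: "ev 1 = 1"
  and ev_pCons: "ev (pCons a q) = of_rat a + \<theta> * ev q"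
  by (simp_all add: ev_def map_poly_pCons)

lemma ev_add: "ev (p + q) = ev p + ev q"
  by (induction p q rule: poly_induct2) (simp_all add: ev_pCons of_rat_add algebra_simps)

lemma ev_smult: "ev (Polynomial.smult c p) = of_rat c * ev p"
  by (induction p) (simp_all add: ev_pCons of_rat_mult algebra_simps)

lemma ev_mult: "ev (p * q) = ev p * ev q"
  by (induction p) (simp_all add: ev_pCons ev_add ev_smult algebra_simps)

lemma ev_minus: "ev (- p) = - ev p"
  using ev_smult[of "-1" p] by simp

lemma ev_diff: "ev (p - q) = ev p - ev q"
  using ev_add[of p "- q"] by (simp add: ev_minus)

lemma ev_monom: "ev (monom c k) = of_rat c * \<theta> ^ k"
  by (simp add: ev_def map_poly_monom poly_monom)

lemma ev_altdef: "degree q < N \<Longrightarrow> ev q = (\<Sum>k<N. of_rat (coeff q k) * \<theta> ^ k)"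
proof -
  assume "degree q < N"
  then have "q = (\<Sum>k<N. monom (coeff q k) k)"
    by (intro poly_eqI) (auto simp: coeff_sum coeff_eq_0 if_distrib cong: if_cong)
  moreover have "ev (\<Sum>k\<in>A. f k) = (\<Sum>k\<in>A. ev (f k))" for f and A :: "nat set"
    by (induction A rule: infinite_finite_induct) (auto simp: ev_add)
  ultimately show ?thesis by (metis (no_types, lifting) ev_monom sum.cong)
qed

lemma pn_altdef: "degree q < N \<Longrightarrow> pn q = (\<Sum>k<N. Vq (coeff q k))"
  unfolding pn_def by (rule sum.mono_neutral_left) (auto simp: coeff_eq_0)

lemma pn_nonneg [simp]: "pn q \<ge> 0"
  by (simp add: pn_def sum_nonneg)

lemma pn_0 [simp]: "pn 0 = 0" and pn_1 [simp]: "pn 1 = 1"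
  by (simp_all add: pn_def)

lemma Vq_coeff_le: "Vq (coeff q k) \<le> pn q"
proof (cases "k \<le> degree q")
  case True
  then show ?thesis unfolding pn_def by (intro member_le_sum) auto
qed (simp add: coeff_eq_0)

lemma pn_zero_iff [simp]: "pn q = 0 \<longleftrightarrow> q = 0"
proof
  assume "pn q = 0"
  then have "Vq (coeff q k) \<le> 0" for k using Vq_coeff_le[of q k] by simp
  then show "q = 0" by (intro poly_eqI) (simp add: order_antisym_conv)
qed simp

lemma pn_pos_iff: "pn q > 0 \<longleftrightarrow> q \<noteq> 0"
  using pn_nonneg[of q] pn_zero_iff[of q] by linarith

lemma pn_add: "pn (p + q) \<le> pn p + pn q"
proof -
  define N where "N = Suc (max (degree p) (degree q))"
  have N: "degree p < N" "degree q < N" "degree (p + q) < N"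
    using degree_add_le_max[of p q] by (auto simp: N_def)
  show ?thesis
    unfolding pn_altdef[OF N(1)] pn_altdef[OF N(2)] pn_altdef[OF N(3)]
    by (simp flip: sum.distrib) (intro sum_mono Vq_add)
qed

lemma pn_smult: "pn (Polynomial.smult c q) = Vq c * pn q"
proof -
  have "degree (Polynomial.smult c q) < Suc (degree q)" by (simp add: le_imp_less_Suc degree_smult_le)
  then show ?thesis
    by (simp add: pn_altdef[of _ "Suc (degree q)"] Vq_mult sum_distrib_left distrib_left)
qed

lemma pn_minus [simp]: "pn (- q) = pn q"
  using pn_smult[of "-1" q] by simp

lemma pn_diff: "pn (p - q) \<le> pn p + pn q"
  using pn_add[of p "- q"] by simp

lemma pn_pCons: "pn (pCons a q) = Vq a + pn q"
proof -
  have "degree (pCons a q) < Suc (Suc (degree q))" by (simp add: le_imp_less_Suc degree_pCons_le)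
  then have "pn (pCons a q) = (\<Sum>k<Suc (Suc (degree q)). Vq (coeff (pCons a q) k))"
    by (rule pn_altdef)
  also have "\<dots> = Vq a + (\<Sum>k<Suc (degree q). Vq (coeff q k))"
    by (subst sum.lessThan_Suc_shift) simp
  finally show ?thesis by (simp add: pn_altdef[of q "Suc (degree q)"])
qed

lemma pn_mult: "pn (p * q) \<le> pn p * pn q"
proof (induction p)
  case (pCons a p)
  have "pn (pCons a p * q) \<le> pn (Polynomial.smult a q) + pn (pCons 0 (p * q))"
    by (simp add: pn_add)
  also have "\<dots> \<le> Vq a * pn q + pn p * pn q" using pCons by (simp add: pn_smult pn_pCons)
  finally show ?case by (simp add: pn_pCons algebra_simps)
qed simp

lemma pn_monom: "pn (monom c k) = Vq c"
  by (induction k) (simp_all add: monom_0 monom_Suc pn_pCons)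

lemma pn_pderiv: assumes "degree q \<le> N" shows "pn (pderiv q) \<le> real N * pn q"
proof -
  have "degree (pderiv q) < Suc (degree q)" by (simp add: degree_pderiv)
  then have "pn (pderiv q) = (\<Sum>k<Suc (degree q). Vq (coeff (pderiv q) k))" by (rule pn_altdef)
  also have "\<dots> \<le> (\<Sum>k<Suc (degree q). real N * Vq (coeff q (Suc k)))"
  proof (intro sum_mono)
    fix k
    show "Vq (coeff (pderiv q) k) \<le> real N * Vq (coeff q (Suc k))"
    proof (cases "Suc k \<le> degree q")
      case True
      have "Vq (coeff (pderiv q) k) = Vq (of_nat (Suc k)) * Vq (coeff q (Suc k))"
        by (simp add: coeff_pderiv flip: Vq_mult)
      also have "\<dots> \<le> real N * Vq (coeff q (Suc k))"
        using True assms Vq_of_nat_le[of "Suc k"] by (intro mult_right_mono) auto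
      finally show ?thesis .
    qed (simp add: coeff_pderiv coeff_eq_0)
  qed
  also have "\<dots> = real N * (\<Sum>k\<in>Suc ` {..<Suc (degree q)}. Vq (coeff q k))"
    by (simp add: sum.reindex sum_distrib_left del: image_Suc_lessThan sum.lessThan_Suc)
  also have "\<dots> \<le> real N * (\<Sum>k<Suc (Suc (degree q)). Vq (coeff q k))"
    by (intro mult_left_mono sum_mono2) auto
  also have "\<dots> = real N * pn q" by (subst pn_altdef[of q "Suc (Suc (degree q))"]) auto
  finally show ?thesis .
qed

definition \<Theta> :: real where "\<Theta> = max 1 (v \<theta>)"

lemma v_ev_le: assumes "degree q \<le> N" shows "v (ev q) \<le> \<Theta> ^ N * pn q"
proof -
  have "v (ev q) \<le> (\<Sum>k\<le>degree q. v (of_rat (coeff q k) * \<theta> ^ k))"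
    by (subst ev_altdef[OF lessI]) (simp add: lessThan_Suc_atMost sum_le)
  also have "\<dots> \<le> (\<Sum>k\<le>degree q. \<Theta> ^ N * Vq (coeff q k))"
  proof (intro sum_mono)
    fix k assume "k \<in> {..degree q}"
    then have k: "k \<le> N" using assms by simp
    have "v \<theta> ^ k \<le> \<Theta> ^ k" by (intro power_mono) (auto simp: \<Theta>_def)
    also have "\<dots> \<le> \<Theta> ^ N" using k by (intro power_increasing) (auto simp: \<Theta>_def)
    finally show "v (of_rat (coeff q k) * \<theta> ^ k) \<le> \<Theta> ^ N * Vq (coeff q k)"
      by (simp add: mult power Vq_def mult_right_mono mult.commute)
  qed
  finally show ?thesis by (simp add: pn_def sum_distrib_left)
qed

lemma lead_coeff_m [simp]: "lead_coeff m = 1" and ev_m [simp]: "ev m = 0"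
  using number_field by (auto simp: number_field_def minimal_polynomial_def ev_def)

lemma m_nonzero [simp]: "m \<noteq> 0"
  using lead_coeff_m by fastforce

lemma ev_eq_0: assumes "ev q = 0" "degree q < n" shows "q = 0"
  using assms number_field by (fastforce simp: number_field_def minimal_polynomial_def ev_def)

lemma n_pos: "n > 0"
proof (rule ccontr)
  assume "\<not> n > 0"
  then obtain c where "m = [:c:]" by (metis degree_eq_zeroE gr0I)
  then show False using lead_coeff_m ev_m by (simp add: ev_pCons)
qed

definition crd :: "'f \<Rightarrow> rat poly" where
  "crd x = (THE q. ev q = x \<and> degree q < n)"

lemma crd_unique: assumes "ev q = x" "degree q < n" shows "crd x = q"
  unfolding crd_def
proof (rule the_equality)
  fix p assume "ev p = x \<and> degree p < n"
  then have "ev (p - q) = 0" "degree (p - q) < n"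
    using assms by (auto simp: ev_diff intro: degree_diff_less)
  then show "p = q" using ev_eq_0 by fastforce
qed (use assms in auto)

lemma ev_crd [simp]: "ev (crd x) = x" and degree_crd: "degree (crd x) < n"
proof -
  obtain p where p: "x = ev p" using number_field by (auto simp: number_field_def ev_def)
  have "ev (p mod m) = x"
    using ev_add[of "p div m * m" "p mod m"] by (simp add: ev_mult p)
  moreover have "degree (p mod m) < n"
    using degree_mod_less[of m p] n_pos by auto
  ultimately have "ev (crd x) = x \<and> degree (crd x) < n" using crd_unique[of "p mod m" x] by simp
  then show "ev (crd x) = x" "degree (crd x) < n" by auto
qed

lemma crd_add: "crd (x + y) = crd x + crd y"
  by (rule crd_unique) (auto simp: ev_add degree_crd intro: degree_add_less)

lemma crd_smult: "crd (of_rat c * x) = Polynomial.smult c (crd x)"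
  by (rule crd_unique) (auto simp: ev_smult degree_crd n_pos)

lemma crd_0 [simp]: "crd 0 = 0"
  by (rule crd_unique) (auto simp: n_pos)

text \<open>Up to constant factors this is the maximum of the absolute values at all places that
  restrict to the same place of the rationals as \<open>v\<close>.\<close>

definition nrm :: "'f \<Rightarrow> real" where "nrm x = pn (crd x)"

lemma nrm_nonneg [simp]: "nrm x \<ge> 0" and nrm_smult: "nrm (of_rat c * x) = Vq c * nrm x"
  by (simp_all add: nrm_def crd_smult pn_smult)

lemma nrm_of_int_mult: "nrm (of_int c * x) = v (of_int c) * nrm x"
  using nrm_smult[of "of_int c" x] by (simp add: Vq_def)

lemma v_le_nrm: "v x \<le> \<Theta> ^ n * nrm x"
  using v_ev_le[of "crd x" n] degree_crd[of x] by (simp add: nrm_def)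

text \<open>Each step of the long division multiplies the norm by at most \<open>1 + G\<close>. The
  constant depends on \<open>G\<close> and \<open>N\<close> but not on \<open>g\<close>, because the
  divisor will vary with the required precision.\<close>

lemma monic_division_bound:
  assumes g: "lead_coeff g = 1" "degree g = d" "d > 0" "pn g \<le> G" and q: "degree q \<le> N"
  shows "\<exists>t r. q = g * t + r \<and> degree r < d \<and> degree t \<le> N \<and>
    pn t \<le> (2 + G) ^ Suc N * pn q \<and> pn r \<le> (2 + G) ^ Suc N * pn q"
  using q
proof (induction N arbitrary: q)
  have G: "G \<ge> 0" using g(4) pn_nonneg[of g] by linarith
  case 0
  then show ?case
    using g G mult_right_mono[of 1 "2 + G" "pn q"]
    by (intro exI[of _ 0] exI[of _ q]) auto
next
  case (Suc N)
  have G: "G \<ge> 0" using g(4) pn_nonneg[of g] by linarith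
  show ?case
  proof (cases "Suc N < d")
    case True
    have "(2 + G) ^ Suc (Suc N) \<ge> 1" using G by (intro one_le_power) simp
    then have "pn q \<le> (2 + G) ^ Suc (Suc N) * pn q"
      using mult_right_mono[of 1 "(2 + G) ^ Suc (Suc N)" "pn q"] by simp
    moreover from this have "(2 + G) ^ Suc (Suc N) * pn q \<ge> 0" using pn_nonneg[of q] by linarith
    ultimately show ?thesis using True Suc.prems
      by (intro exI[of _ 0] exI[of _ q]) (simp del: power_Suc)
  next
    case False
    \<comment> \<open>The leading term of the quotient; it is \<open>0\<close> if the degree of
      \<open>q\<close> is below \<open>Suc N\<close>, so this case needs no separate
      treatment.\<close>
    define s where "s = monom (coeff q (Suc N)) (Suc N - d)"
    have s: "pn s \<le> pn q" "degree s \<le> Suc N"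
      using Vq_coeff_le[of q "Suc N"] degree_monom_le[of "coeff q (Suc N)" "Suc N - d"]
      by (auto simp: s_def pn_monom)
    define q' where "q' = q - g * s"
    have "coeff (g * s) (Suc N) = coeff q (Suc N)"
      using False g by (simp add: s_def mult.commute[of g] coeff_monom_mult)
    moreover have "degree (g * s) \<le> Suc N"
      using degree_mult_le[of g s] degree_monom_le[of "coeff q (Suc N)" "Suc N - d"] False g
      by (simp add: s_def)
    ultimately have "degree q' \<le> N"
      using Suc.prems unfolding q'_def
      by (intro degree_le) (metis Suc_lessI coeff_diff coeff_eq_0 diff_self le_less_trans)
    from Suc.IH[OF this] obtain t r where tr: "q' = g * t + r" "degree r < d" "degree t \<le> N"
      "pn t \<le> (2 + G) ^ Suc N * pn q'" "pn r \<le> (2 + G) ^ Suc N * pn q'" by blast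
    have "pn (g * s) \<le> G * pn q"
      by (rule order_trans[OF pn_mult mult_mono]) (use g s G in auto)
    then have q': "pn q' \<le> (1 + G) * pn q"
      using pn_diff[of q "g * s"] by (simp add: q'_def algebra_simps)
    have K: "(2 + G) ^ Suc N \<ge> 1" using G by (intro one_le_power) simp
    have K': "(2 + G) ^ Suc N * pn q' \<le> (2 + G) ^ Suc N * ((1 + G) * pn q)"
      using q' G by (intro mult_left_mono) auto
    have r: "pn r \<le> (2 + G) ^ Suc (Suc N) * pn q"
    proof -
      have "(2 + G) ^ Suc N * ((1 + G) * pn q) \<le> (2 + G) ^ Suc N * ((2 + G) * pn q)"
        using G by (intro mult_left_mono mult_right_mono) auto
      then show ?thesis using tr(5) K' by (simp add: mult_ac)
    qed
    have t: "pn (t + s) \<le> (2 + G) ^ Suc (Suc N) * pn q"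
    proof -
      have "pn q \<le> (2 + G) ^ Suc N * pn q"
        using mult_right_mono[OF K pn_nonneg[of q]] by (simp del: power_Suc)
      then have "pn (t + s) \<le> (2 + G) ^ Suc N * ((1 + G) * pn q) + (2 + G) ^ Suc N * pn q"
        using pn_add[of t s] tr(4) K' s by linarith
      also have "\<dots> = (2 + G) ^ Suc (Suc N) * pn q" by (simp add: algebra_simps)
      finally show ?thesis .
    qed
    have "q = g * (t + s) + r" using tr(1) by (simp add: q'_def algebra_simps)
    moreover have "degree (t + s) \<le> Suc N" using tr(3) s(2) by (intro degree_add_le) auto
    ultimately show ?thesis using r t tr(2) by blast
  qed
qed

text \<open>Reduction modulo \<open>m\<close> is division by a monic polynomial. The degree
  \<open>2 * n\<close> leaves room for a product of two polynomials of degree at most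
  \<open>n\<close>.\<close>

lemma nrm_ev_le: obtains C where "C > 0" "\<And>p. degree p \<le> 2 * n \<Longrightarrow> nrm (ev p) \<le> C * pn p"
proof
  show "(2 + pn m) ^ Suc (2 * n) > 0" using pn_nonneg[of m] by (intro zero_less_power) linarith
  fix p :: "rat poly" assume "degree p \<le> 2 * n"
  then obtain t r where "p = m * t + r" "degree r < n" "pn r \<le> (2 + pn m) ^ Suc (2 * n) * pn p"
    using monic_division_bound[OF lead_coeff_m refl n_pos order_refl] by blast
  moreover from this have "crd (ev p) = r"
    by (intro crd_unique) (auto simp: ev_add ev_mult)
  ultimately show "nrm (ev p) \<le> (2 + pn m) ^ Suc (2 * n) * pn p" by (simp add: nrm_def)
qed

text \<open>This amounts to linear independence of
  \<open>1, \<theta>, ..., \<theta> ^ (d - 1)\<close> over the completion of the rationals, so the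
  largest such \<open>d\<close> is the local degree at \<open>v\<close>.\<close>

definition dominated :: "nat \<Rightarrow> bool" where
  "dominated d \<longleftrightarrow> (\<exists>c>0. \<forall>q. degree q < d \<longrightarrow> c * pn q \<le> v (ev q))"

lemma dominated_1: "dominated 1"
proof -
  have "1 * pn q \<le> v (ev q)" if deg: "degree q < 1" for q
  proof -
    obtain c where "q = [:c:]" using deg by (metis degree_eq_zeroE less_one)
    then show ?thesis by (simp add: ev_pCons pn_pCons Vq_def)
  qed
  then show ?thesis unfolding dominated_def by (intro exI[of _ 1]) simp
qed

text \<open>Morally, the monic polynomials found here approximate the minimal polynomial of \<open>\<theta>\<close> over the
  completion of the rationals.\<close>

lemma approximate_minimal_polynomial:
  assumes c: "c > 0" "\<And>q. degree q < d \<Longrightarrow> c * pn q \<le> v (ev q)" and nd: "\<not> dominated (Suc d)"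
    and d: "d > 0"
  obtains G where "G \<ge> 1"
    "\<And>\<delta>. \<delta> > 0 \<Longrightarrow> \<exists>g. lead_coeff g = 1 \<and> degree g = d \<and> pn g \<le> G \<and> v (ev g) \<le> \<delta>"
proof
  \<comment> \<open>\<open>G\<close> must not depend on \<open>\<delta>\<close>. It comes from
    \<open>c * pn g0 \<le> v (ev g) + v \<theta> ^ d\<close> for the part \<open>g0\<close> of
    \<open>g\<close> below degree \<open>d\<close>, where \<open>v (ev g)\<close> is absorbed into
    the left side.\<close>
  define G where "G = 1 + 2 * (c / 2 + v \<theta> ^ d) / c"
  show G1: "G \<ge> 1" using c by (simp add: G_def)
  fix \<delta> :: real assume \<delta>: "\<delta> > 0"
  \<comment> \<open>A constant of at most \<open>c / 2\<close> allows that absorption and excludes a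
    counterexample of degree below \<open>d\<close>; \<open>\<delta> / G\<close> yields the required
    smallness.\<close>
  define c' where "c' = min (c / 2) (\<delta> / G)"
  have c': "c' > 0" "c' \<le> c / 2" "c' * G \<le> \<delta>"
    using c \<delta> G1 by (auto simp: c'_def min_def field_simps)
  obtain q where q: "degree q < Suc d" "v (ev q) < c' * pn q"
    using nd c'(1) unfolding dominated_def by (meson not_le)
  have "\<not> degree q < d"
  proof
    assume "degree q < d"
    then have "c * pn q \<le> v (ev q)" by (rule c)
    moreover have "c' * pn q \<le> c * pn q" using c c' by (intro mult_right_mono) auto
    ultimately show False using q by linarith
  qed
  then have dq: "degree q = d" using q by simp
  then have lq: "lead_coeff q \<noteq> 0" using d by auto
  define g where "g = Polynomial.smult (1 / lead_coeff q) q"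
  have g: "lead_coeff g = 1" "degree g = d" using lq dq by (auto simp: g_def)
  have vg: "v (ev g) < c' * pn g"
  proof -
    have "Vq (1 / lead_coeff q) > 0" using lq Vq_nonneg[of "1 / lead_coeff q"] Vq_zero_iff[of "1 / lead_coeff q"]
      by (metis divide_eq_0_iff less_eq_real_def zero_neq_one)
    then have "Vq (1 / lead_coeff q) * v (ev q) < Vq (1 / lead_coeff q) * (c' * pn q)"
      using q(2) by (intro mult_strict_left_mono)
    then show ?thesis by (simp add: g_def ev_smult pn_smult mult Vq_def mult_ac)
  qed
  define g0 where "g0 = g - monom 1 d"
  have "degree g0 < d"
  proof -
    have "degree g0 \<le> d - 1"
    proof (rule degree_le, intro allI impI)
      fix i assume "d - 1 < i"
      then show "coeff g0 i = 0" using g by (cases "i = d") (auto simp: g0_def coeff_eq_0)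
    qed
    then show ?thesis using d by simp
  qed
  then have "c * pn g0 \<le> v (ev g0)" by (rule c)
  also have "\<dots> \<le> v (ev g) + v \<theta> ^ d"
    using diff[of "ev g" "\<theta> ^ d"] by (simp add: g0_def ev_diff ev_monom power)
  finally have 1: "c * pn g0 \<le> v (ev g) + v \<theta> ^ d" .
  have pg: "pn g \<le> 1 + pn g0" using pn_add[of "monom 1 d" g0] by (simp add: g0_def pn_monom)
  have "c' * pn g \<le> (c / 2) * (1 + pn g0)" using pg c' c by (intro mult_mono) auto
  then have "(c / 2) * pn g0 \<le> c / 2 + v \<theta> ^ d" using 1 vg by (simp add: algebra_simps)
  then have "pn g0 \<le> 2 * (c / 2 + v \<theta> ^ d) / c" using c by (simp add: field_simps)
  then have pG: "pn g \<le> G" using pg by (simp add: G_def)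
  have "v (ev g) \<le> c' * G" using vg pG c'(1) by (smt (verit) mult_left_mono)
  then show "\<exists>g. lead_coeff g = 1 \<and> degree g = d \<and> pn g \<le> G \<and> v (ev g) \<le> \<delta>"
    using g pG c' by (intro exI[of _ g]) auto
qed

text \<open>In terms of the decomposition of \<open>F \<otimes> \<rat>\<^sub>v\<close> into fields, \<open>\<beta>\<close> is close to a
  vector supported on the factor that belongs to \<open>v\<close>.  With \<open>g\<close> as in the previous lemma and
  \<open>m = g h + r\<close> it is \<open>h(\<theta>)\<close>, which stays away from \<open>0\<close> because \<open>m\<close> is separable.\<close>

lemma contraction:
  assumes \<epsilon>: "\<epsilon> > 0"
  obtains \<beta> C where "\<beta> \<noteq> 0" "C > 0" "\<And>x. nrm (\<beta> * x) / v \<beta> \<le> C * v x + \<epsilon> * nrm x"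
proof (cases "dominated n")
  case True
  \<comment> \<open>Here \<open>v\<close> alone controls all coordinates, morally because no other
    place lies over the same rational one, and \<open>\<beta> = 1\<close> will do.\<close>
  then obtain c where c: "c > 0" "\<And>q. degree q < n \<Longrightarrow> c * pn q \<le> v (ev q)"
    unfolding dominated_def by blast
  have "nrm x \<le> 1 / c * v x" for x
    using c(2)[OF degree_crd[of x]] c(1) by (simp add: nrm_def field_simps)
  then have "nrm (1 * x) / v 1 \<le> 1 / c * v x + \<epsilon> * nrm x" for x
    using \<epsilon> mult_nonneg_nonneg[of \<epsilon> "nrm x"] by (smt (verit) div_by_1 mult_1 nrm_nonneg one)
  then show ?thesis using c by (intro that[of 1 "1 / c"]) auto
next
  case False
  have "\<exists>d. 1 \<le> d \<and> d < n \<and> dominated d \<and> \<not> dominated (Suc d)"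
  proof (rule ccontr)
    assume *: "\<not> ?thesis"
    have "1 \<le> n" using n_pos by simp
    then have "dominated n"
      by (induction rule: dec_induct) (use dominated_1 * in auto)
    then show False using False by simp
  qed
  then obtain d where d: "1 \<le> d" "d < n" "dominated d" "\<not> dominated (Suc d)" by blast
  then have d0: "d > 0" by simp
  obtain c where c: "c > 0" "\<And>q. degree q < d \<Longrightarrow> c * pn q \<le> v (ev q)"
    using d(3) unfolding dominated_def by blast
  obtain G where G: "G \<ge> 1"
    "\<And>\<delta>. \<delta> > 0 \<Longrightarrow> \<exists>g. lead_coeff g = 1 \<and> degree g = d \<and> pn g \<le> G \<and> v (ev g) \<le> \<delta>"
    using approximate_minimal_polynomial[OF c d(4) d0] by blast
  obtain D where D: "D > 0" "\<And>p. degree p \<le> 2 * n \<Longrightarrow> nrm (ev p) \<le> D * pn p"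
    using nrm_ev_le by blast
  define H where "H = (2 + G) ^ Suc n"
  define E where "E = \<Theta> ^ n"
  define M where "M = pn m"
  define c1 where "c1 = v (ev (pderiv m))"
  \<comment> \<open>\<open>\<delta> * A1\<close> will bound \<open>pn r\<close>,
    \<open>\<delta> * A2\<close> the part of \<open>ev (pderiv m)\<close> without
    \<open>ev h\<close>, and \<open>A3\<close> the value of \<open>ev (pderiv g)\<close>.
    \<open>A4\<close> and \<open>\<delta> * A5\<close> become the coefficients of \<open>v x\<close>
    and \<open>nrm x\<close> in the bound for \<open>nrm (\<beta> * x)\<close>.\<close>
  define A1 where "A1 = E * (H * M) / c"
  define A2 where "A2 = E * (real n * (H * M)) + E * (real n * A1)"
  define A3 where "A3 = E * (real n * G)"
  define c2 where "c2 = c1 / (2 * A3)"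
  define A4 where "A4 = D * (H * M / c)"
  define A5 where "A5 = D * (H * M * (E * H) / c + A1 * H)"
  have E1: "E \<ge> 1" by (simp add: E_def \<Theta>_def)
  have M0: "M > 0" by (simp add: M_def pn_pos_iff)
  have H0: "H > 0" using G(1) unfolding H_def by (intro zero_less_power) linarith
  have A1: "A1 > 0" using E1 H0 M0 c by (simp add: A1_def)
  have A2: "A2 > 0" using E1 H0 M0 A1 n_pos by (simp add: A2_def add_pos_pos)
  have A3: "A3 > 0" using E1 G n_pos by (simp add: A3_def)
  have A4: "A4 > 0" using D H0 M0 c by (simp add: A4_def)
  have A5: "A5 > 0" using D H0 M0 c E1 A1 by (simp add: A5_def add_pos_pos)
  have "degree (pderiv m) < n" "pderiv m \<noteq> 0"
    using n_pos by (auto simp: degree_pderiv pderiv_eq_0_iff)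
  then have c1: "c1 > 0" using ev_eq_0 by (auto simp: c1_def)
  then have c2: "c2 > 0" using A3 by (simp add: c2_def)
  \<comment> \<open>The first bound keeps \<open>v (ev h)\<close> above \<open>c2\<close>; the
    second makes the coefficient of \<open>nrm x\<close> at most \<open>\<epsilon>\<close> after
    division by \<open>v \<beta>\<close>.\<close>
  define \<delta> where "\<delta> = min (c1 / (2 * A2)) (\<epsilon> * c2 / A5)"
  have \<delta>: "\<delta> > 0" "\<delta> * A2 \<le> c1 / 2" "\<delta> * A5 \<le> \<epsilon> * c2"
    using c1 A2 \<epsilon> c2 A5 by (auto simp: \<delta>_def min_def field_simps)
  obtain g where g: "lead_coeff g = 1" "degree g = d" "pn g \<le> G" "v (ev g) \<le> \<delta>"
    using G(2)[OF \<delta>(1)] by blast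
  obtain h r where hr: "m = g * h + r" "degree r < d" "degree h \<le> n" "pn h \<le> H * M"
    using monic_division_bound[OF g(1,2) d0 g(3) order_refl, of m] by (auto simp: H_def M_def)
  have vh: "v (ev h) \<le> E * (H * M)"
    by (rule order_trans[OF v_ev_le[OF hr(3)]]) (use hr(4) E1 in \<open>simp add: E_def\<close>)
  have evr: "ev r = - (ev g * ev h)"
    using ev_m unfolding hr(1) by (simp add: ev_add ev_mult eq_neg_iff_add_eq_0 add.commute)
  have pr: "pn r \<le> \<delta> * A1"
  proof -
    have "c * pn r \<le> v (ev g) * v (ev h)" using c(2)[OF hr(2)] by (simp add: evr mult)
    also have "\<dots> \<le> \<delta> * (E * (H * M))" using g(4) vh \<delta>(1) by (intro mult_mono) auto
    finally show ?thesis using c(1) by (simp add: A1_def field_simps)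
  qed
  have der: "v (ev (pderiv q)) \<le> E * (real n * B)" if "degree q \<le> n" "pn q \<le> B" for q B
  proof -
    have "degree (pderiv q) \<le> n" using that by (simp add: degree_pderiv)
    then have "v (ev (pderiv q)) \<le> E * pn (pderiv q)" unfolding E_def by (rule v_ev_le)
    also have "\<dots> \<le> E * (real n * B)"
      by (intro mult_left_mono order_trans[OF pn_pderiv[OF that(1)]]) (use that E1 in auto)
    finally show ?thesis .
  qed
  have h_low: "v (ev h) \<ge> c2"
  proof -
    \<comment> \<open>Differentiate \<open>m = g * h + r\<close> and evaluate at \<theta>. The value
      of \<open>pderiv m\<close> is nonzero by minimality of \<open>m\<close>, and
      \<open>ev g\<close> and \<open>r\<close> are small, so \<open>ev h\<close> cannot be
      small.\<close>
    have "pderiv m = g * pderiv h + h * pderiv g + pderiv r"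
      by (simp add: hr(1) pderiv_add pderiv_mult)
    then have "ev (pderiv m) = ev g * ev (pderiv h) + ev h * ev (pderiv g) + ev (pderiv r)"
      by (simp add: ev_add ev_mult)
    then have "c1 \<le> v (ev g) * v (ev (pderiv h)) + v (ev h) * v (ev (pderiv g)) + v (ev (pderiv r))"
      unfolding c1_def using triangle[of "ev g * ev (pderiv h) + ev h * ev (pderiv g)" "ev (pderiv r)"]
        triangle[of "ev g * ev (pderiv h)" "ev h * ev (pderiv g)"] by (simp add: mult)
    also have "v (ev g) * v (ev (pderiv h)) \<le> \<delta> * (E * (real n * (H * M)))"
      using g(4) der[OF hr(3,4)] \<delta>(1) by (intro mult_mono) auto
    also have "v (ev (pderiv r)) \<le> E * (real n * (\<delta> * A1))"
      using der[OF _ pr] hr(2) d by simp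
    also have "v (ev h) * v (ev (pderiv g)) \<le> v (ev h) * A3"
      using der[OF _ g(3)] g(2) d by (intro mult_left_mono) (auto simp: A3_def)
    finally have "c1 \<le> \<delta> * A2 + v (ev h) * A3" by (simp add: A2_def algebra_simps)
    then have "c1 / 2 \<le> v (ev h) * A3" using \<delta>(2) by linarith
    then show ?thesis using A3 by (simp add: c2_def field_simps)
  qed
  define \<beta> where "\<beta> = ev h"
  have \<beta>0: "\<beta> \<noteq> 0" using h_low c2 by (auto simp: \<beta>_def)
  have bound: "nrm (\<beta> * x) / v \<beta> \<le> A4 / c2 * v x + \<epsilon> * nrm x" for x
  proof -
    obtain t q1 where q: "crd x = g * t + q1" "degree q1 < d" "degree t \<le> n" "pn t \<le> H * nrm x"
      using monic_division_bound[OF g(1,2) d0 g(3), of "crd x" n] degree_crd[of x]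
      by (auto simp: H_def nrm_def)
    have "ev q1 = x - ev g * ev t" using ev_crd[of x] unfolding q(1) by (simp add: ev_add ev_mult eq_diff_eq add.commute)
    then have "v (ev q1) \<le> v x + v (ev g) * v (ev t)" using diff[of x "ev g * ev t"] by (simp add: mult)
    also have "v (ev g) * v (ev t) \<le> \<delta> * (E * (H * nrm x))"
    proof (intro mult_mono)
      show "v (ev t) \<le> E * (H * nrm x)"
        by (rule order_trans[OF v_ev_le[OF q(3)]]) (use q(4) E1 in \<open>simp add: E_def\<close>)
    qed (use g \<delta> in auto)
    finally have "c * pn q1 \<le> v x + \<delta> * (E * (H * nrm x))" using c(2)[OF q(2)] by linarith
    then have q1: "pn q1 \<le> (v x + \<delta> * (E * (H * nrm x))) / c"
      using c(1) by (simp add: field_simps)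
    \<comment> \<open>Since \<open>h * g\<close> is \<open>- r\<close> modulo \<open>m\<close>,
      multiplication by \<beta> turns the quotient part of \<open>x\<close> into a small term. What
      is left is the remainder \<open>q1\<close>, which \<open>v\<close> controls by the choice of
      \<open>d\<close>.\<close>
    have "\<beta> * x = ev (h * q1 - r * t)"
    proof -
      have "\<beta> * x = ev (h * (g * t + q1))" unfolding \<beta>_def ev_mult[of h] q(1)[symmetric] by simp
      also have "h * (g * t + q1) = m * t + (h * q1 - r * t)"
        unfolding hr(1) by (simp add: algebra_simps)
      finally show ?thesis by (simp add: ev_add ev_mult)
    qed
    moreover have "degree (h * q1 - r * t) \<le> 2 * n"
      using degree_mult_le[of h q1] degree_mult_le[of r t] hr(2,3) q(2,3) d
      by (intro degree_diff_le) auto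
    ultimately have "nrm (\<beta> * x) \<le> D * pn (h * q1 - r * t)" using D(2) by simp
    also have "\<dots> \<le> D * (H * M * ((v x + \<delta> * (E * (H * nrm x))) / c) + \<delta> * A1 * (H * nrm x))"
    proof (intro mult_left_mono)
      have "pn (h * q1) \<le> H * M * ((v x + \<delta> * (E * (H * nrm x))) / c)"
        by (rule order_trans[OF pn_mult mult_mono]) (use hr(4) q1 H0 M0 in auto)
      moreover have "pn (r * t) \<le> \<delta> * A1 * (H * nrm x)"
        by (rule order_trans[OF pn_mult mult_mono]) (use pr q(4) \<delta> A1 in auto)
      ultimately show "pn (h * q1 - r * t) \<le>
          H * M * ((v x + \<delta> * (E * (H * nrm x))) / c) + \<delta> * A1 * (H * nrm x)"
        using pn_diff[of "h * q1" "r * t"] by linarith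
    qed (use D in simp)
    also have "\<dots> = A4 * v x + (\<delta> * A5) * nrm x"
      using c(1) by (simp add: A4_def A5_def field_simps)
    also have "\<dots> \<le> A4 * v x + (\<epsilon> * c2) * nrm x"
      using \<delta>(3) by (intro add_left_mono mult_right_mono) auto
    finally have "nrm (\<beta> * x) \<le> A4 * v x + (\<epsilon> * c2) * nrm x" .
    moreover have "nrm (\<beta> * x) / v \<beta> \<le> nrm (\<beta> * x) / c2"
      using h_low c2 \<beta>0 by (intro divide_left_mono mult_pos_pos) (simp_all add: \<beta>_def)
    moreover have "nrm (\<beta> * x) / c2 \<le> (A4 * v x + (\<epsilon> * c2) * nrm x) / c2"
      using calculation(1) c2 by (intro divide_right_mono) auto
    moreover have "(A4 * v x + (\<epsilon> * c2) * nrm x) / c2 = A4 / c2 * v x + \<epsilon> * nrm x"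
      using c2 by (simp add: field_simps)
    ultimately show ?thesis by linarith
  qed
  show ?thesis using that[of \<beta> "A4 / c2"] \<beta>0 bound A4 c2 by auto
qed

text \<open>Each factor \<beta> replaces the ratio \<open>\<rho> = nrm / v\<close> by at most
  \<open>C + \<epsilon> * \<rho>\<close>, so \<open>L\<close> factors leave
  \<open>\<epsilon> ^ L * \<rho> + 2 * C\<close>, the geometric series being summed by
  \<open>\<epsilon> \<le> 1 / 2\<close>. With \<open>\<epsilon> \<le> exp (- C1)\<close> the initial
  ratio shrinks to \<open>exp C1\<close>.\<close>

lemma domination:
  obtains \<beta> R where "\<beta> \<noteq> 0" "R > 0"
    "\<And>L x. x \<noteq> 0 \<Longrightarrow> nrm x \<le> exp (C1 * (real L + 1)) * v x \<Longrightarrow> nrm (\<beta> ^ L * x) \<le> R * v (\<beta> ^ L * x)"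
proof -
  define \<epsilon> where "\<epsilon> = min (1 / 2) (exp (- C1))"
  have \<epsilon>: "\<epsilon> > 0" "\<epsilon> \<le> 1 / 2" "\<epsilon> \<le> exp (- C1)" by (auto simp: \<epsilon>_def)
  obtain \<beta> C where \<beta>: "\<beta> \<noteq> 0" "C > 0" "\<And>x. nrm (\<beta> * x) / v \<beta> \<le> C * v x + \<epsilon> * nrm x"
    using contraction[OF \<epsilon>(1)] by blast
  have iter: "nrm (\<beta> ^ L * x) \<le> (\<epsilon> ^ L * (nrm x / v x) + 2 * C) * v (\<beta> ^ L * x)" if "x \<noteq> 0" for L x
  proof (induction L)
    case 0
    then show ?case using that \<beta> by (simp add: distrib_right)
  next
    case (Suc L)
    let ?y = "\<beta> ^ L * x" and ?r = "\<epsilon> ^ L * (nrm x / v x)"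
    have vb: "v \<beta> > 0" using \<beta> by simp
    have "nrm (\<beta> * ?y) \<le> v \<beta> * (C * v ?y + \<epsilon> * nrm ?y)"
      using \<beta>(3)[of ?y] vb by (simp add: pos_divide_le_eq mult.commute)
    also have "\<dots> \<le> v \<beta> * (C * v ?y + \<epsilon> * ((?r + 2 * C) * v ?y))"
      using Suc \<epsilon> by (intro mult_left_mono add_left_mono) auto
    also have "\<dots> = v \<beta> * v ?y * (C + \<epsilon> * ?r + 2 * \<epsilon> * C)" by (simp add: algebra_simps)
    also have "\<dots> \<le> v \<beta> * v ?y * (\<epsilon> * ?r + 2 * C)"
      using \<epsilon> \<beta>(2) by (intro mult_left_mono) auto
    finally show ?case by (simp add: mult mult_ac)
  qed
  show ?thesis
  proof (rule that[of \<beta> "exp C1 + 2 * C"])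
    fix L x assume x: "x \<noteq> 0" "nrm x \<le> exp (C1 * (real L + 1)) * v x"
    have "\<epsilon> ^ L * (nrm x / v x) \<le> exp (- C1) ^ L * exp (C1 * (real L + 1))"
      using x \<epsilon> by (intro mult_mono power_mono) (auto simp: pos_divide_le_eq)
    also have "\<dots> = exp C1" by (simp add: exp_of_nat_mult[symmetric] exp_add[symmetric] algebra_simps)
    finally show "nrm (\<beta> ^ L * x) \<le> (exp C1 + 2 * C) * v (\<beta> ^ L * x)"
      using iter[OF x(1), of L] by (smt (verit) mult_right_mono nonneg)
  qed (use \<beta> in \<open>auto intro: add_pos_pos\<close>)
qed

end

text \<open>Bernoulli's inequality gives linear growth only; used for the exponent
  \<open>N * 2\<close> it gives quadratic growth, which beats the bound. The lemma discards
  constants and linear factors after passing to high powers.\<close>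

lemma power_le_linear_imp_le_1:
  fixes c :: real
  assumes "\<And>N. c ^ N \<le> A * real N + B"
  shows "c \<le> 1"
proof (rule ccontr)
  assume "\<not> c \<le> 1"
  define h where "h = c - 1"
  have h: "h > 0" "c = 1 + h" using \<open>\<not> c \<le> 1\<close> by (auto simp: h_def)
  have *: "(real N * h)\<^sup>2 \<le> 2 * A * real N + B" for N
  proof -
    have "real N * h \<le> c ^ N" using Bernoulli_inequality[of h N] h by simp
    then have "(real N * h)\<^sup>2 \<le> (c ^ N)\<^sup>2" using h by (intro power_mono) auto
    also have "\<dots> \<le> 2 * A * real N + B" using assms[of "N * 2"] by (simp add: power_mult mult_ac)
    finally show ?thesis .
  qed
  obtain N where N: "real N > max 1 ((2 * \<bar>A\<bar> + \<bar>B\<bar>) / h\<^sup>2)" using reals_Archimedean2 by blast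
  then have "(2 * \<bar>A\<bar> + \<bar>B\<bar>) < real N * h\<^sup>2" using h by (simp add: field_simps)
  then have "(2 * \<bar>A\<bar> + \<bar>B\<bar>) * real N < (real N * h)\<^sup>2"
    using mult_strict_right_mono[of "2 * \<bar>A\<bar> + \<bar>B\<bar>" "real N * h\<^sup>2" "real N"] N
    by (simp add: power2_eq_square mult_ac)
  moreover have "2 * A * real N + B \<le> (2 * \<bar>A\<bar> + \<bar>B\<bar>) * real N"
  proof -
    have "A * real N \<le> \<bar>A\<bar> * real N" by (intro mult_right_mono) auto
    moreover have "\<bar>B\<bar> * 1 \<le> \<bar>B\<bar> * real N" using N by (intro mult_left_mono) auto
    ultimately show ?thesis using abs_ge_self[of B] by (simp add: algebra_simps)
  qed
  ultimately show False using *[of N] by linarith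
qed

section \<open>Ostrowski's theorem for the rational numbers\<close>

context abs_val
begin

text \<open>Expand \<open>x\<close> in base \<open>a\<close>: each of the \<open>K\<close> digits
  has value at most \<open>a\<close>, and its place contributes at most a \<open>K\<close>-th
  power.\<close>

lemma of_nat_less_power_le:
  assumes "a \<ge> 2" "x < a ^ K"
  shows "v (of_nat x) \<le> real a * real K * max 1 (v (of_nat a)) ^ K"
  using assms(2)
proof (induction K arbitrary: x)
  case (Suc K)
  let ?M = "max 1 (v (of_nat a))"
  have "x div a < a ^ K" using Suc.prems assms(1) by (simp add: less_mult_imp_div_less mult.commute)
  note IH = Suc.IH[OF this]
  have "of_nat x = (of_nat (x mod a) + of_nat a * of_nat (x div a) :: 'f)"
    by (simp flip: of_nat_add of_nat_mult)
  then have "v (of_nat x) \<le> v (of_nat (x mod a)) + v (of_nat a) * v (of_nat (x div a))"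
    using triangle mult by metis
  also have "v (of_nat (x mod a)) \<le> real a * 1"
    using of_nat_le[of "x mod a"] mod_less_divisor[of a x] assms(1)
    by (simp add: less_imp_le order_trans[OF of_nat_le])
  also have "v (of_nat a) * v (of_nat (x div a)) \<le> ?M * (real a * real K * ?M ^ K)"
    using IH by (intro mult_mono) auto
  also have "real a * 1 \<le> real a * ?M ^ Suc K"
    by (intro mult_left_mono one_le_power) auto
  finally show ?case by (simp add: algebra_simps)
qed simp

text \<open>Ostrowski's comparison of two integers: \<open>b ^ N\<close> has about
  \<open>N * ln b / ln a\<close> digits in base \<open>a\<close>, and the factor linear in
  \<open>N\<close> disappears when \<open>N\<close>-th roots are taken.\<close>

lemma ln_of_nat_le:
  assumes a: "a \<ge> 2" and b: "b \<ge> 2"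
  shows "ln (v (of_nat b)) \<le> ln (max 1 (v (of_nat a))) * (ln b / ln a)"
proof -
  let ?M = "max 1 (v (of_nat a))"
  define l where "l = ln b / ln a"
  have l: "l > 0" using a b by (simp add: l_def)
  have b0: "v (of_nat b) > 0" using b by simp
  have M: "?M > 0" by simp
  have "(v (of_nat b) / ?M powr l) ^ N \<le> (real a * l * ?M) * real N + real a * ?M" for N
  proof -
    define K where "K = nat \<lfloor>real N * l\<rfloor> + 1"
    have K: "real N * l < real K" "real K \<le> real N * l + 1"
    proof -
      have "real N * l \<ge> 0" using l by simp
      then show "real N * l < real K" "real K \<le> real N * l + 1" unfolding K_def by linarith+
    qed
    have "real (b ^ N) = exp (real N * ln b)" using b by (simp add: exp_of_nat_mult)
    also have "\<dots> = exp (real N * l * ln a)" using a by (simp add: l_def)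
    also have "\<dots> < exp (real K * ln a)" using K a by simp
    also have "\<dots> = real (a ^ K)" using a by (simp add: exp_of_nat_mult)
    finally have "b ^ N < a ^ K" by (simp only: of_nat_less_iff)
    then have "v (of_nat (b ^ N)) \<le> real a * real K * ?M ^ K" by (rule of_nat_less_power_le[OF a])
    also have "\<dots> \<le> (real a * (real N * l + 1)) * ((?M powr l) ^ N * ?M)"
    proof (rule mult_mono)
      show "real a * real K \<le> real a * (real N * l + 1)" using K by (intro mult_left_mono) auto
      have "?M ^ K = ?M powr real K" by (simp add: powr_realpow)
      also have "\<dots> \<le> ?M powr (real N * l + 1)" using K by (intro powr_mono) auto
      also have "\<dots> = (?M powr l) ^ N * ?M"
        by (simp add: powr_add powr_powr mult.commute flip: powr_realpow[of "?M powr l"])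
      finally show "?M ^ K \<le> (?M powr l) ^ N * ?M" .
    qed (use l in auto)
    finally have "v (of_nat b) ^ N \<le> real a * (real N * l + 1) * ((?M powr l) ^ N * ?M)"
      by (simp add: power)
    moreover have "(?M powr l) ^ N > 0" by simp
    ultimately show ?thesis by (simp add: power_divide pos_divide_le_eq algebra_simps)
  qed
  then have "v (of_nat b) / ?M powr l \<le> 1" by (rule power_le_linear_imp_le_1)
  then have "v (of_nat b) \<le> ?M powr l" by (subst (asm) pos_divide_le_eq) auto
  then have "ln (v (of_nat b)) \<le> ln (?M powr l)" using b0 by (subst ln_le_cancel_iff) auto
  then show ?thesis by (simp add: l_def ln_powr mult.commute)
qed

text \<open>By the comparison, one integer of value above \<open>1\<close> forces this for all
  integers from \<open>2\<close> on. Applied in both directions it then shows that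
  \<open>ln (v b) / ln b\<close> is constant, and this constant is \<open>s\<close>.\<close>

lemma archimedean_power:
  assumes k: "v (of_nat k) > 1"
  obtains s where "s > 0" "\<And>z. z \<noteq> 0 \<Longrightarrow> v (of_int z) = \<bar>real_of_int z\<bar> powr s"
proof -
  have k2: "k \<ge> 2"
  proof (rule ccontr)
    assume "\<not> k \<ge> 2"
    then have "k = 0 \<or> k = 1" by auto
    then show False using k by auto
  qed
  have gt: "v (of_nat a) > 1" if "a \<ge> 2" for a
  proof (rule ccontr)
    assume "\<not> v (of_nat a) > 1"
    then have "max 1 (v (of_nat a)) = 1" by simp
    then have "ln (v (of_nat k)) \<le> 0" using ln_of_nat_le[OF that k2] by simp
    then show False using ln_gt_zero[OF k] by linarith
  qed
  have le: "ln (v (of_nat b)) / ln b \<le> ln (v (of_nat a)) / ln a" if "a \<ge> 2" "b \<ge> 2" for a b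
    using ln_of_nat_le[OF that] gt[of a] that by (simp add: field_simps)
  define s where "s = ln (v (of_nat 2)) / ln 2"
  have s: "s > 0" using gt[of 2] by (simp add: s_def)
  have nat: "v (of_nat b) = real b powr s" if "b > 0" for b
  proof (cases "b = 1")
    case False
    then have b: "b \<ge> 2" using that by simp
    have "ln (v (of_nat b)) / ln b = s" using le[of b 2] le[of 2 b] b by (simp add: s_def)
    then have "ln (v (of_nat b)) = s * ln b" using b by (simp add: field_simps)
    then have "v (of_nat b) = exp (s * ln b)" using b by (metis exp_ln of_nat_eq_0_iff pos_iff that not_gr_zero)
    then show ?thesis using b by (simp add: powr_def)
  qed simp
  have "v (of_int z) = \<bar>real_of_int z\<bar> powr s" if z: "z \<noteq> 0" for z
  proof -
    have "v (of_int z) = v (of_int \<bar>z\<bar>)" by (cases "z \<ge> 0") auto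
    also have "(of_int \<bar>z\<bar> :: 'f) = of_nat (nat \<bar>z\<bar>)" by simp
    finally show ?thesis using nat[of "nat \<bar>z\<bar>"] z by simp
  qed
  then show ?thesis using that s by blast
qed

text \<open>\<open>p\<close> is the least positive integer of value below \<open>1\<close>. If an
  integer prime to \<open>p\<close> also had value below \<open>1\<close>, a Bezout identity between
  high powers of the two would give \<open>1\<close> a value below \<open>1\<close>.\<close>

lemma nonarchimedean_prime:
  assumes le: "\<And>k. v (of_nat k) \<le> 1" and k: "k > 0" "v (of_nat k) \<noteq> 1"
  obtains p where "prime p" "v (of_nat p) < 1" "\<And>z. v (of_int z) \<le> 1"
    "\<And>z. \<not> int p dvd z \<Longrightarrow> v (of_int z) = 1"
proof -
  define p where "p = (LEAST k. k > 0 \<and> v (of_nat k) < 1)"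
  have "k > 0 \<and> v (of_nat k) < 1" using k le[of k] by simp
  then have p: "p > 0 \<and> v (of_nat p) < 1" unfolding p_def by (rule LeastI)
  have min: "v (of_nat a) = 1" if "0 < a" "a < p" for a
    using not_less_Least[of a "\<lambda>k. k > 0 \<and> v (of_nat k) < 1"] that le[of a] by (simp add: p_def)
  have lez: "v (of_int z) \<le> 1" for z
    using le[of "nat \<bar>z\<bar>"] minus[of "of_int z"] by (cases "z \<ge> 0") auto
  have prime: "prime p"
    unfolding prime_nat_iff
  proof (intro conjI allI impI)
    show "1 < p" using p by (cases "p = 1") auto
    fix a assume "a dvd p"
    then obtain b where ab: "p = a * b" by auto
    then have "a > 0" "b > 0" using p by auto
    show "a = 1 \<or> a = p"
    proof (rule ccontr)
      assume "\<not> (a = 1 \<or> a = p)"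
      then have "a < p" "b < p" using ab \<open>a > 0\<close> \<open>b > 0\<close> by (auto simp: nat_neq_iff)
      then have "v (of_nat p) = 1" using min \<open>a > 0\<close> \<open>b > 0\<close> by (simp add: ab mult)
      then show False using p by simp
    qed
  qed
  have "v (of_int z) = 1" if z: "\<not> int p dvd z" for z
  proof (rule ccontr)
    assume "v (of_int z) \<noteq> 1"
    then have lt: "v (of_int z) < 1" using lez[of z] by simp
    have lim: "(\<lambda>N. v (of_int z) ^ N + v (of_nat p) ^ N) \<longlonglongrightarrow> 0 + 0"
      using lt p by (intro tendsto_add LIMSEQ_realpow_zero) auto
    then have "\<forall>\<^sub>F N in sequentially. v (of_int z) ^ N + v (of_nat p) ^ N < 1"
      by (intro order_tendstoD(2)[OF lim]) simp
    then obtain N where N: "v (of_int z) ^ N + v (of_nat p) ^ N < 1"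
      by (auto simp: eventually_sequentially)
    have "coprime z (int p)"
      using z prime by (metis coprime_commute prime_imp_coprime prime_int_nat_transfer of_nat_eq_iff int_int_eq prime_nat_int_transfer)
    then have "coprime (z ^ N) (int p ^ N)" by simp
    then obtain x y where "x * z ^ N + y * int p ^ N = 1"
      using bezout_int[of "z ^ N" "int p ^ N"] by (metis coprime_iff_gcd_eq_1)
    then have "(1 :: 'f) = of_int (x * z ^ N + y * int p ^ N)" by simp
    also have "\<dots> = of_int x * of_int z ^ N + of_int y * of_nat p ^ N" by simp
    finally have "1 \<le> v (of_int x) * v (of_int z) ^ N + v (of_int y) * v (of_nat p) ^ N"
      using triangle one by (metis mult power)
    also have "\<dots> \<le> 1 * v (of_int z) ^ N + 1 * v (of_nat p) ^ N"
      using lez by (intro add_mono mult_right_mono) auto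
    finally show False using N by simp
  qed
  then show ?thesis using that prime p lez by blast
qed

end

section \<open>Nontriviality on the integers, lattice vectors and Siegel's lemma\<close>

context number_field_val
begin

text \<open>If all positive integers had value \<open>1\<close>, then \<open>v\<close> would be at
  most \<open>1\<close> on the rationals and, through coordinates, bounded on the field. Powers turn
  boundedness into \<open>v \<le> 1\<close>, and \<open>1 / x\<close> gives the opposite
  inequality.\<close>

lemma nontrivial_on_nat:
  assumes x: "x \<noteq> 0" "v x \<noteq> 1"
  obtains k where "k > 0" "v (of_nat k) \<noteq> 1"
proof (rule ccontr)
  assume "\<not> thesis"
  then have nat: "k > 0 \<longrightarrow> v (of_nat k) = 1" for k using that by blast
  have "v (of_int z) \<le> 1" for z
    using nat[of "nat \<bar>z\<bar>"] minus[of "of_int z"] by (cases "z = 0"; cases "z \<ge> 0") auto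
  moreover have "v (of_int z) = 1" if "z > 0" for z
    using nat[of "nat z"] that by simp
  ultimately have q: "Vq r \<le> 1" for r
    unfolding Vq_def by (cases r) (simp add: Fract_of_int_quotient of_rat_divide divide)
  have bd: "v y \<le> \<Theta> ^ n * real n" for y
  proof -
    have "pn (crd y) \<le> (\<Sum>k<n. 1)"
      unfolding pn_altdef[OF degree_crd] by (intro sum_mono q)
    then have "\<Theta> ^ n * nrm y \<le> \<Theta> ^ n * real n"
      unfolding nrm_def by (intro mult_left_mono) (auto simp: \<Theta>_def)
    then show ?thesis using v_le_nrm[of y] by linarith
  qed
  have "v y \<le> 1" for y
    using bd[of "y ^ _"] by (intro power_le_linear_imp_le_1[of _ 0 "\<Theta> ^ n * real n"]) (simp add: power)
  from this[of x] this[of "1 / x"] x show False by (simp add: divide divide_le_eq)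
qed

definition iv :: "(nat \<Rightarrow> int) \<Rightarrow> 'f" where "iv y = (\<Sum>k<n. of_int (y k) * \<theta> ^ k)"

lemma coeff_crd_iv: "coeff (crd (iv y)) k = (if k < n then of_int (y k) else 0)"
proof -
  let ?q = "\<Sum>k<n. monom (of_int (y k) :: rat) k"
  have c: "coeff ?q k = (if k < n then of_int (y k) else 0)" for k
    by (simp add: coeff_sum if_distrib cong: if_cong)
  have "degree ?q < n" using n_pos by (intro degree_lessI) (auto simp: c)
  moreover from this have "ev ?q = iv y"
    by (simp add: ev_altdef[OF \<open>degree ?q < n\<close>] iv_def c)
  ultimately show ?thesis using crd_unique c by metis
qed

lemma nrm_iv: "nrm (iv y) = (\<Sum>k<n. v (of_int (y k)))"
  unfolding nrm_def pn_altdef[OF degree_crd] by (simp add: coeff_crd_iv Vq_def)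

lemma iv_eq_0_iff: "iv y = 0 \<longleftrightarrow> (\<forall>k<n. y k = 0)"
proof
  assume "iv y = 0"
  then show "\<forall>k<n. y k = 0" using coeff_crd_iv[of y] by (metis coeff_0 crd_0 of_int_eq_0_iff)
qed (simp add: iv_def)

lemma iv_diff: "iv (\<lambda>k. y k - z k) = iv y - iv z"
  and iv_cmult: "iv (\<lambda>k. c * y k) = of_int c * iv y"
  by (simp_all add: iv_def algebra_simps sum_subtractf sum_distrib_left)

lemma iv_sum: "iv (\<lambda>k. \<Sum>i\<in>I. f i k) = (\<Sum>i\<in>I. iv (f i))"
  unfolding iv_def of_int_sum sum_distrib_right by (rule sum.swap)

lemma nrm_add: "nrm (x + y) \<le> nrm x + nrm y"
  by (simp add: nrm_def crd_add pn_add)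

lemma nrm_minus [simp]: "nrm (- x) = nrm x"
  using nrm_smult[of "-1" x] by simp

lemma nrm_diff: "nrm (x - y) \<le> nrm x + nrm y"
  using nrm_add[of x "- y"] by simp

lemma nrm_divide_int: "nrm (x / of_int c) = nrm x / v (of_int c)"
  using nrm_smult[of "1 / of_int c" x] by (simp add: Vq_def of_rat_divide divide)

text \<open>Membership in the lattice spanned by the powers of \<theta> below \<open>n\<close>, not
  integrality over the integers; the lattice need not be a ring.\<close>

definition integral :: "'f \<Rightarrow> bool" where
  "integral x \<longleftrightarrow> (\<exists>y. x = iv y)"

lemma integral_iff: "integral x \<longleftrightarrow> (\<forall>k. coeff (crd x) k \<in> \<int>)"
proof
  assume int: "\<forall>k. coeff (crd x) k \<in> \<int>"
  have "x = (\<Sum>k<n. of_rat (coeff (crd x) k) * \<theta> ^ k)"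
    using ev_altdef[OF degree_crd[of x]] by simp
  also have "\<dots> = iv (\<lambda>k. \<lfloor>coeff (crd x) k\<rfloor>)"
    unfolding iv_def
  proof (intro sum.cong refl)
    fix k
    obtain z where "coeff (crd x) k = of_int z" using int by (metis Ints_cases)
    then show "of_rat (coeff (crd x) k) * \<theta> ^ k = of_int \<lfloor>coeff (crd x) k\<rfloor> * \<theta> ^ k" by simp
  qed
  finally show "integral x" by (auto simp: integral_def)
qed (auto simp: integral_def coeff_crd_iv)

lemma integral_of_int_mult: "integral x \<Longrightarrow> integral (of_int c * x)"
  unfolding integral_def by (metis iv_cmult)

lemma common_denominator:
  assumes "finite S"
  obtains E :: int where "E > 0" "\<And>x. x \<in> S \<Longrightarrow> integral (of_int E * x)"
proof -
  have single: "\<exists>E::int>0. \<forall>k. coeff (Polynomial.smult (of_int E) q) k \<in> \<int>" for q :: "rat poly"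
  proof (induction q)
    case 0
    then show ?case by (intro exI[of _ 1]) simp
  next
    case (pCons a q)
    then obtain E :: int where E: "E > 0" "\<And>k. of_int E * coeff q k \<in> \<int>" by auto
    obtain i d where q: "quotient_of a = (i, d)" by (cases "quotient_of a")
    then have d: "d > 0" "a = of_int i / of_int d"
      using quotient_of_denom_pos quotient_of_div by blast+
    have "of_int (d * E) * coeff (pCons a q) k \<in> \<int>" for k
    proof (cases k)
      case 0
      have "of_int (d * E) * a = of_int (E * i)" using d by simp
      then show ?thesis using 0 by (metis Ints_of_int coeff_pCons_0)
    next
      case (Suc k')
      have "of_int d * (of_int E * coeff q k') \<in> \<int>" by (rule Ints_mult[OF Ints_of_int E(2)])
      then show ?thesis using Suc by (simp add: mult.assoc)
    qed
    then have "\<forall>k. coeff (Polynomial.smult (of_int (d * E)) (pCons a q)) k \<in> \<int>"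
      by (simp only: coeff_smult) simp
    then show ?case using d(1) E(1) by (intro exI[of _ "d * E"]) (simp del: smult_pCons of_int_mult)
  qed
  have "\<exists>E::int>0. \<forall>x\<in>S. integral (of_int E * x)"
    using assms
  proof induction
    case empty
    then show ?case by (intro exI[of _ 1]) simp
  next
    case (insert x S)
    then obtain E where E: "E > 0" "\<And>x. x \<in> S \<Longrightarrow> integral (of_int E * x)" by blast
    obtain E' :: int where E': "E' > 0" "\<forall>k. coeff (Polynomial.smult (of_int E') (crd x)) k \<in> \<int>"
      using single by blast
    then have "integral (of_int E' * x)"
      using crd_smult[of "of_int E'" x] by (simp add: integral_iff)
    then have "integral (of_int (E * E') * y)" if "y \<in> insert x S" for y
      using that integral_of_int_mult[of "of_int E' * x" E] integral_of_int_mult[of "of_int E * y" E'] E(2)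
      by (auto simp: mult_ac)
    then show ?case using E E' by (intro exI[of _ "E * E'"]) auto
  qed
  then show ?thesis using that by blast
qed

text \<open>The pigeonhole argument of Siegel's lemma: \<open>w\<close> and \<open>N\<close> solve a homogeneous linear system with one
  more unknown than equations.\<close>

lemma small_integer_multiple:
  obtains A :: nat where "\<And>y H. \<lbrakk>H > 0; \<And>k. k < n \<Longrightarrow> \<bar>y k\<bar> \<le> int H; iv y \<noteq> 0\<rbrakk> \<Longrightarrow>
    \<exists>w N. N \<noteq> 0 \<and> \<bar>N\<bar> \<le> int ((A * H) ^ n) \<and> (\<forall>k<n. \<bar>w k\<bar> \<le> int ((A * H) ^ n)) \<and> iv y * iv w = of_int N"
proof -
  \<comment> \<open>Products of two lattice vectors involve higher powers of \<theta>; after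
    multiplication by \<open>E\<close> these are fixed integer vectors \<open>c l\<close>.\<close>
  obtain E :: int where E: "E > 0" "\<And>x. x \<in> (\<lambda>l. \<theta> ^ l) ` {..2 * n} \<Longrightarrow> integral (of_int E * x)"
    using common_denominator[of "(\<lambda>l. \<theta> ^ l) ` {..2 * n}"] by auto
  then have "\<forall>l\<in>{..2 * n}. \<exists>c. of_int E * \<theta> ^ l = iv c" by (auto simp: integral_def)
  then obtain c where c: "\<And>l. l \<le> 2 * n \<Longrightarrow> of_int E * \<theta> ^ l = iv (c l)"
    using bchoice[of "{..2 * n}"] by (metis atMost_iff)
  define C0 where "C0 = (\<Sum>l\<le>2 * n. \<Sum>k<n. \<bar>c l k\<bar>)"
  have C0: "\<bar>c l k\<bar> \<le> C0" if "l \<le> 2 * n" "k < n" for l k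
  proof -
    have "\<bar>c l k\<bar> \<le> (\<Sum>k<n. \<bar>c l k\<bar>)" using that by (intro member_le_sum) auto
    also have "\<dots> \<le> C0" unfolding C0_def
      using that by (intro member_le_sum[of l _ "\<lambda>l. \<Sum>k<n. \<bar>c l k\<bar>"]) (auto intro: sum_nonneg)
    finally show ?thesis .
  qed
  have C00: "C0 \<ge> 0" by (auto simp: C0_def intro!: sum_nonneg)
  \<comment> \<open>It adds up the two parts of an equation: \<open>n * n\<close> products, each at
    most \<open>H * X * C0\<close>, and the term \<open>E * w n\<close>.\<close>
  define A0 where "A0 = nat (int n * int n * C0 + E)"
  have A0: "int A0 = int n * int n * C0 + E" using E C00 by (simp add: A0_def)
  show ?thesis
  proof (rule that[of "2 * A0 + 1"])
    fix y :: "nat \<Rightarrow> int" and H :: nat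
    assume H: "H > 0" and y: "\<And>k. k < n \<Longrightarrow> \<bar>y k\<bar> \<le> int H" and y0: "iv y \<noteq> 0"
    \<comment> \<open>Chosen so that \<open>2 * B + 1 \<le> (2 * A0 * H + 1) * (X + 1)\<close>
      leaves at most \<open>X * (X + 1) ^ n\<close> values of \<open>F\<close> for
      \<open>(X + 1) ^ (n + 1)\<close> vectors.\<close>
    define X where "X = (2 * A0 * H + 1) ^ n"
    define B where "B = A0 * H * X"
    define P where "P w k = (\<Sum>i<n. \<Sum>j<n. y i * w j * c (i + j) k)" for w :: "nat \<Rightarrow> int" and k
    have P: "of_int E * (iv y * iv w) = iv (P w)" for w
    proof -
      have "of_int E * (iv y * iv w) =
          (\<Sum>i<n. \<Sum>j<n. of_int (y i) * of_int (w j) * (of_int E * \<theta> ^ (i + j)))"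
        unfolding iv_def by (simp add: sum_product sum_distrib_left power_add mult_ac)
      also have "\<dots> = (\<Sum>i<n. \<Sum>j<n. of_int (y i) * of_int (w j) * iv (c (i + j)))"
        by (intro sum.cong refl) (simp add: c)
      also have "\<dots> = iv (P w)"
        unfolding P_def iv_sum by (simp only: iv_cmult of_int_mult)
      finally show ?thesis .
    qed
    \<comment> \<open>The coordinates of \<open>E * (iv y * iv w - w n)\<close>: these are
      \<open>n\<close> equations in the \<open>n + 1\<close> unknowns \<open>w 0, ..., w n\<close>,
      the last of which becomes \<open>N\<close>.\<close>
    define F where "F w = (\<lambda>k\<in>{..<n}. P w k - (if k = 0 then E * w n else 0))" for w
    let ?D = "{..n} \<rightarrow>\<^sub>E {0..int X}" and ?R = "{..<n} \<rightarrow>\<^sub>E {- int B..int B}"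
    have FR: "F ` ?D \<subseteq> ?R"
    proof (rule image_subsetI)
      fix w assume w: "w \<in> ?D"
      then have w: "0 \<le> w j" "w j \<le> int X" if "j \<le> n" for j using that by (auto simp: PiE_def Pi_def)
      show "F w \<in> ?R"
      proof (rule PiE_I)
        fix k assume k: "k \<in> {..<n}"
        have "\<bar>P w k\<bar> \<le> (\<Sum>i<n. \<Sum>j<n. \<bar>y i * w j * c (i + j) k\<bar>)"
          unfolding P_def by (rule order_trans[OF sum_abs sum_mono[OF sum_abs]])
        also have "\<dots> \<le> (\<Sum>i<n. \<Sum>j<n. int H * int X * C0)"
        proof (intro sum_mono)
          fix i j assume ij: "i \<in> {..<n}" "j \<in> {..<n}"
          show "\<bar>y i * w j * c (i + j) k\<bar> \<le> int H * int X * C0"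
            unfolding abs_mult using y[of i] w[of j] C0[of "i + j" k] ij k
            by (intro mult_mono) auto
        qed
        finally have 1: "\<bar>P w k\<bar> \<le> int n * int n * C0 * (int H * int X)" by (simp add: mult_ac)
        have "E * w n \<le> E * (int H * int X)"
          using w[of n] E H mult_right_mono[of 1 "int H" "int X"]
          by (intro mult_left_mono) auto
        moreover have "E * w n \<ge> 0" using w[of n] E by simp
        moreover have "int B = int n * int n * C0 * (int H * int X) + E * (int H * int X)"
          by (simp add: B_def A0 algebra_simps)
        ultimately show "F w k \<in> {- int B..int B}"
          using 1 k by (cases "k = 0") (auto simp: F_def)
      qed (auto simp: F_def)
    qed
    have "card ?R < card ?D"
    proof -
      have "2 * B + 1 \<le> (2 * A0 * H + 1) * (X + 1)" by (simp add: B_def algebra_simps)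
      then have "(2 * B + 1) ^ n \<le> X * (X + 1) ^ n"
        unfolding X_def by (metis power_mono power_mult_distrib zero_le)
      also have "\<dots> < (X + 1) * (X + 1) ^ n" by simp
      finally have "(2 * B + 1) ^ n < (X + 1) * (X + 1) ^ n" .
      moreover have "card {- int B..int B} = 2 * B + 1" unfolding card_atLeastAtMost_int by linarith
      moreover have "card {0..int X} = X + 1" unfolding card_atLeastAtMost_int by linarith
      ultimately show ?thesis by (simp only: card_PiE finite_lessThan finite_atMost prod_constant card_lessThan card_atMost power_Suc)
    qed
    then have "\<not> inj_on F ?D"
      using FR by (meson card_inj_on_le finite_PiE finite_atLeastAtMost_int finite_lessThan not_le)
    then obtain w w' where w: "w \<in> ?D" "w' \<in> ?D" "F w = F w'" "w \<noteq> w'" unfolding inj_on_def by blast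
    define u where "u j = w j - w' j" for j
    have u: "\<bar>u j\<bar> \<le> int X" if "j \<le> n" for j
    proof -
      have "w j \<in> {0..int X}" "w' j \<in> {0..int X}" using w that by auto
      then show ?thesis by (auto simp: u_def)
    qed
    have "P u k = (if k = 0 then E * u n else 0)" if "k < n" for k
    proof -
      have "P u k = P w k - P w' k"
        by (simp add: P_def u_def sum_subtractf algebra_simps)
      moreover have "F w k = F w' k" using w by simp
      ultimately show ?thesis using that by (auto simp: F_def u_def algebra_simps split: if_splits)
    qed
    then have "iv (P u) = iv (\<lambda>k. if k = 0 then E * u n else 0)" by (simp add: iv_def)
    also have "\<dots> = of_int E * of_int (u n)"
      using n_pos by (simp add: iv_def if_distrib[of of_int] if_distrib[of "\<lambda>x. x * _"] cong: if_cong)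
    finally have eq: "iv y * iv u = of_int (u n)" using P[of u] E by simp
    \<comment> \<open>Pigeonhole gives only a nonzero \<open>u\<close>. If \<open>u n\<close> were
      \<open>0\<close>, then \<open>iv y \<noteq> 0\<close> would force \<open>iv u = 0\<close> and
      hence \<open>u = 0\<close>.\<close>
    have u_n: "u n \<noteq> 0"
    proof
      assume "u n = 0"
      then have "iv u = 0" using eq y0 by simp
      then have "\<forall>k\<le>n. u k = 0" using \<open>u n = 0\<close> by (auto simp: iv_eq_0_iff le_less)
      then have "w = w'" using w by (intro PiE_ext) (auto simp: u_def)
      then show False using w by simp
    qed
    have "X \<le> ((2 * A0 + 1) * H) ^ n"
      unfolding X_def using H by (intro power_mono) auto
    then have b: "\<bar>u k\<bar> \<le> int (((2 * A0 + 1) * H) ^ n)" if "k \<le> n" for k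
      using u[OF that] by (meson of_nat_mono order_trans)
    show "\<exists>w N. N \<noteq> 0 \<and> \<bar>N\<bar> \<le> int (((2 * A0 + 1) * H) ^ n) \<and>
        (\<forall>k<n. \<bar>w k\<bar> \<le> int (((2 * A0 + 1) * H) ^ n)) \<and> iv y * iv w = of_int N"
      using eq b u_n less_imp_le by blast
  qed
qed

end

section \<open>Leading digits\<close>

primrec digits_value :: "int \<Rightarrow> ('i \<Rightarrow> int) list \<Rightarrow> 'i \<Rightarrow> int" where
  "digits_value B [] = (\<lambda>i. 0)"
| "digits_value B (x # xs) = (\<lambda>i. x i + B * digits_value B xs i)"

lemma digits_value_append:
  "digits_value B (xs @ ys) i = digits_value B xs i + B ^ length xs * digits_value B ys i"
  by (induction xs) (auto simp: algebra_simps)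

lemma digits_value_replicate_zero: "digits_value B (replicate j (\<lambda>i. 0)) i = 0"
  by (induction j) auto

text \<open>Digits are signed, so a vector has many expansions, and whatever is read off has to be
  valid for all of them. Vanishing from \<open>n\<close> on keeps the set of digits finite.\<close>

definition digit :: "nat \<Rightarrow> int \<Rightarrow> (nat \<Rightarrow> int) \<Rightarrow> bool" where
  "digit n B x \<longleftrightarrow> (\<forall>k<n. \<bar>x k\<bar> < B) \<and> (\<forall>k\<ge>n. x k = 0)"

definition bounded_vectors :: "'i set \<Rightarrow> int \<Rightarrow> ('i \<Rightarrow> int) set" where
  "bounded_vectors I K = {x. (\<forall>i\<in>I. \<bar>x i\<bar> \<le> K) \<and> (\<forall>i. i \<notin> I \<longrightarrow> x i = 0)}"

lemma finite_bounded_vectors: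
  assumes "finite I"
  shows "finite (bounded_vectors I K)"
proof (rule finite_subset)
  show "finite {f. \<forall>x. (x \<in> I \<longrightarrow> f x \<in> {- K..K}) \<and> (x \<notin> I \<longrightarrow> f x = (0 :: int))}"
    using assms by (rule finite_set_of_finite_funs) simp
qed (auto simp: bounded_vectors_def)

lemma zero_bounded_vectors: "K \<ge> 0 \<Longrightarrow> (\<lambda>_. 0) \<in> bounded_vectors I K"
  by (simp add: bounded_vectors_def)

lemma finite_digits: "finite (Collect (digit n B))"
  by (rule finite_subset[OF _ finite_bounded_vectors[of "{..<n}" B]])
    (auto simp: digit_def bounded_vectors_def intro: less_imp_le)

type_synonym window = "(nat \<Rightarrow> int) list \<times> (nat \<Rightarrow> int) list"

text \<open>\<open>foldr\<close> delivers the most significant digit first. The vector read so far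
  is kept exactly until a coordinate reaches \<open>T\<close> and is frozen afterwards, so leading
  zeros do no harm and the stored vectors remain bounded.\<close>

definition top_digits :: "nat \<Rightarrow> int \<Rightarrow> int \<Rightarrow> (nat \<Rightarrow> int) \<Rightarrow> window \<Rightarrow> window" where
  "top_digits n B T x d =
     ([], [if \<exists>k<n. \<bar>hd (snd d) k\<bar> \<ge> T then hd (snd d) else (\<lambda>k. B * hd (snd d) k + x k)])"

text \<open>The first component holds the lowest \<open>N\<close> digits seen so far, the second a
  copy of it made at the latest nonzero digit. As the fold ends at the low end, the final copy
  begins at the lowest nonzero digit.\<close>

definition low_digits :: "nat \<Rightarrow> (nat \<Rightarrow> int) \<Rightarrow> window \<Rightarrow> window" where
  "low_digits N x d = (take N (x # fst d), if x = (\<lambda>_. 0) then snd d else take N (x # fst d))"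

text \<open>The strict error bound survives a frozen step because
  \<open>B * (B ^ j - 1) + (B - 1) = B ^ Suc j - 1\<close>. The last clause says that vectors below
  the threshold are stored exactly.\<close>

lemma top_digits_value:
  assumes B: "B \<ge> 2" and xs: "\<And>x. x \<in> set xs \<Longrightarrow> digit n B x"
  shows "\<exists>t j. foldr (top_digits n B T) xs ([], [\<lambda>_. 0]) = ([], [t]) \<and>
    (\<forall>k<n. \<bar>digits_value B xs k - B ^ j * t k\<bar> < B ^ j) \<and> ((\<forall>k<n. \<bar>t k\<bar> < T) \<longrightarrow> j = 0)"
  using xs
proof (induction xs)
  case Nil
  then show ?case by (intro exI[of _ "\<lambda>_. 0"] exI[of _ 0]) simp
next
  case (Cons x xs)
  then obtain t j where t: "foldr (top_digits n B T) xs ([], [\<lambda>_. 0]) = ([], [t])"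
    "\<And>k. k < n \<Longrightarrow> \<bar>digits_value B xs k - B ^ j * t k\<bar> < B ^ j" "(\<forall>k<n. \<bar>t k\<bar> < T) \<longrightarrow> j = 0"
    by auto
  have step: "foldr (top_digits n B T) (x # xs) ([], [\<lambda>_. 0]) = top_digits n B T x ([], [t])"
    by (simp add: t(1))
  show ?case
  proof (cases "\<exists>k<n. \<bar>t k\<bar> \<ge> T")
    case True
    have "\<bar>x k + B * digits_value B xs k - B ^ Suc j * t k\<bar> < B ^ Suc j" if "k < n" for k
    proof -
      have "\<bar>x k\<bar> \<le> B - 1" using Cons.prems[of x] that by (auto simp: digit_def)
      moreover have "\<bar>B * (digits_value B xs k - B ^ j * t k)\<bar> \<le> B * (B ^ j - 1)"
        unfolding abs_mult using t(2)[OF that] B by (intro mult_mono) auto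
      moreover have "x k + B * digits_value B xs k - B ^ Suc j * t k = x k + B * (digits_value B xs k - B ^ j * t k)"
        by (simp add: algebra_simps)
      moreover have "B * (B ^ j - 1) = B ^ Suc j - B" by (simp add: algebra_simps)
      ultimately show ?thesis by linarith
    qed
    then show ?thesis unfolding step using True
      by (intro exI[of _ t] exI[of _ "Suc j"]) (auto simp: top_digits_def)
  next
    case False
    then have "j = 0" using t(3) by (auto simp: not_le)
    then have "digits_value B xs k = t k" if "k < n" for k using t(2)[OF that] by simp
    then show ?thesis unfolding step using False
      by (intro exI[of _ "\<lambda>k. B * t k + x k"] exI[of _ 0]) (auto simp: top_digits_def)
  qed
qed

lemma low_digits_value:
  fixes xs :: "(nat \<Rightarrow> int) list"
  assumes N: "N > 0"
  shows "\<exists>t. foldr (low_digits N) xs ([], []) = (take N xs, t) \<and>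
    ((\<forall>k. digits_value B xs k = 0) \<or> (\<exists>j x ys. xs = replicate j (\<lambda>_. 0) @ x # ys \<and> x \<noteq> (\<lambda>_. 0) \<and> t = take N (x # ys)))"
proof (induction xs)
  case (Cons x xs)
  then obtain t where t: "foldr (low_digits N) xs ([], []) = (take N xs, t)"
    and t': "(\<forall>k. digits_value B xs k = 0) \<or>
      (\<exists>j y ys. xs = replicate j (\<lambda>_. 0) @ y # ys \<and> y \<noteq> (\<lambda>_. 0) \<and> t = take N (y # ys))" by blast
  have take: "take N (x # take N xs) = take N (x # xs)" by (cases N) auto
  have step: "foldr (low_digits N) (x # xs) ([], []) =
      (take N (x # xs), if x = (\<lambda>_. 0) then t else take N (x # xs))"
    by (simp add: t low_digits_def take del: take_Cons)
  show ?case
  proof (cases "x = (\<lambda>_. 0)")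
    case True
    from t' show ?thesis
    proof
      assume "\<forall>k. digits_value B xs k = 0"
      then show ?thesis unfolding step using True by auto
    next
      assume "\<exists>j y ys. xs = replicate j (\<lambda>_. 0) @ y # ys \<and> y \<noteq> (\<lambda>_. 0) \<and> t = take N (y # ys)"
      then obtain j y ys where
        "xs = replicate j (\<lambda>_. 0) @ y # ys" "y \<noteq> (\<lambda>_. 0)" "t = take N (y # ys)" by blast
      then have "x # xs = replicate (Suc j) (\<lambda>_. 0) @ y # ys \<and> y \<noteq> (\<lambda>_. 0) \<and> t = take N (y # ys)"
        using True by simp
      then show ?thesis unfolding step using True
        by - (rule exI[of _ t], rule conjI, simp, rule disjI2, rule exI[of _ "Suc j"], rule exI[of _ y], rule exI[of _ ys])
    qed
  next
    case False
    then have "x # xs = replicate 0 (\<lambda>_. 0) @ x # xs \<and> x \<noteq> (\<lambda>_. 0) \<and> take N (x # xs) = take N (x # xs)"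
      by simp
    then show ?thesis unfolding step using False
      by - (rule exI[of _ "take N (x # xs)"], rule conjI, simp, rule disjI2, rule exI[of _ 0], rule exI[of _ x], rule exI[of _ xs], simp)
  qed
qed simp

section \<open>Lower bounds at the place, and finitely many leading digits\<close>

context number_field_val
begin

text \<open>Since \<open>nrm (iv y)\<close> is at most \<open>n * 2 ^ L\<close>, the point is a
  lower bound for \<open>v (iv y)\<close>. Siegel's lemma multiplies \<open>iv y\<close> by some
  \<open>iv w\<close> into a nonzero integer; \<kappa> keeps this integer away from
  \<open>0\<close>, while \<open>v (iv w)\<close> is at most exponential in
  \<open>L\<close>.\<close>

lemma nrm_iv_le_exp:
  assumes "\<exists>\<kappa>::nat. \<forall>z::int. z \<noteq> 0 \<longrightarrow> 1 \<le> \<bar>real_of_int z\<bar> ^ \<kappa> * v (of_int z)"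
  obtains C1 where "\<And>y L. iv y \<noteq> 0 \<Longrightarrow> (\<And>k. k < n \<Longrightarrow> \<bar>y k\<bar> \<le> 2 ^ L) \<Longrightarrow>
    nrm (iv y) \<le> exp (C1 * (real L + 1)) * v (iv y)"
proof -
  obtain \<kappa> :: nat where \<kappa>: "\<And>z::int. z \<noteq> 0 \<Longrightarrow> 1 \<le> \<bar>real_of_int z\<bar> ^ \<kappa> * v (of_int z)"
    using assms by blast
  obtain A :: nat where A: "\<And>y H. \<lbrakk>H > 0; \<And>k. k < n \<Longrightarrow> \<bar>y k\<bar> \<le> int H; iv y \<noteq> 0\<rbrakk> \<Longrightarrow>
    \<exists>w N. N \<noteq> 0 \<and> \<bar>N\<bar> \<le> int ((A * H) ^ n) \<and> (\<forall>k<n. \<bar>w k\<bar> \<le> int ((A * H) ^ n)) \<and> iv y * iv w = of_int N"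
    using small_integer_multiple by blast
  define S where "S = (\<Sum>k<n. \<Theta> ^ k)"
  have th: "v \<theta> ^ k \<le> \<Theta> ^ k" for k by (intro power_mono) (auto simp: \<Theta>_def)
  have S: "S > 0" using n_pos by (auto simp: S_def \<Theta>_def intro!: sum_pos)
  define K1 where "K1 = real n * (real A ^ (n * (\<kappa> + 1)) * S)"
  define K2 where "K2 = 2 * (2 :: real) ^ (n * (\<kappa> + 1))"
  define K0 where "K0 = max 1 K1 * K2"
  show ?thesis
  proof (rule that[of "ln K0"])
    fix y :: "nat \<Rightarrow> int" and L :: nat
    assume y0: "iv y \<noteq> 0" and y: "\<And>k. k < n \<Longrightarrow> \<bar>y k\<bar> \<le> 2 ^ L"
    obtain w N where w: "N \<noteq> 0" "\<bar>N\<bar> \<le> int ((A * 2 ^ L) ^ n)" "\<And>k. k < n \<Longrightarrow> \<bar>w k\<bar> \<le> int ((A * 2 ^ L) ^ n)"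
      "iv y * iv w = of_int N"
      using A[of "2 ^ L" y] y y0 by auto
    let ?X = "(real A * 2 ^ L) ^ n"
    have X: "\<bar>real_of_int z\<bar> \<le> ?X" if "\<bar>z\<bar> \<le> int ((A * 2 ^ L) ^ n)" for z
    proof -
      have "real_of_int \<bar>z\<bar> \<le> real_of_int (int ((A * 2 ^ L) ^ n))" using that by (simp only: of_int_le_iff)
      then show ?thesis by simp
    qed
    have "v (iv w) \<le> (\<Sum>k<n. v (of_int (w k) * \<theta> ^ k))" unfolding iv_def by (rule sum_le)
    also have "\<dots> \<le> (\<Sum>k<n. ?X * \<Theta> ^ k)"
      unfolding mult power
      by (intro sum_mono mult_mono th order_trans[OF of_int_le X]) (auto simp: w(3) simp del: of_nat_power)
    finally have vw: "v (iv w) \<le> ?X * S" by (simp add: S_def sum_distrib_left)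
    have "1 \<le> \<bar>real_of_int N\<bar> ^ \<kappa> * v (of_int N)" using \<kappa> w(1) .
    also have "\<dots> \<le> ?X ^ \<kappa> * v (of_int N)"
      by (intro mult_right_mono power_mono X w(2)) auto
    also have "v (of_int N) = v (iv y) * v (iv w)" by (simp flip: w(4) mult)
    also have "?X ^ \<kappa> * (v (iv y) * v (iv w)) \<le> ?X ^ \<kappa> * (v (iv y) * (?X * S))"
      by (intro mult_left_mono vw) auto
    finally have low: "1 \<le> ?X ^ (\<kappa> + 1) * S * v (iv y)" by (simp add: mult_ac)
    have "nrm (iv y) \<le> (\<Sum>k<n. 2 ^ L)"
      unfolding nrm_iv
    proof (intro sum_mono)
      fix k assume "k \<in> {..<n}"
      then have "real_of_int \<bar>y k\<bar> \<le> real_of_int (2 ^ L)" using y by (simp only: of_int_le_iff lessThan_iff)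
      then show "v (of_int (y k)) \<le> 2 ^ L" using of_int_le[of "y k"] by simp
    qed
    then have "nrm (iv y) \<le> real n * 2 ^ L * 1" by simp
    also have "\<dots> \<le> real n * 2 ^ L * (?X ^ (\<kappa> + 1) * S * v (iv y))"
      by (intro mult_left_mono low) auto
    also have "\<dots> = K1 * K2 ^ L * v (iv y)"
      by (simp add: K1_def K2_def power_mult_distrib power_add mult_ac flip: power_mult)
    also have "\<dots> \<le> K0 ^ (L + 1) * v (iv y)"
    proof (intro mult_right_mono)
      have K2: "K2 \<ge> 1" using mult_mono[of 1 2 1 "(2::real) ^ (n * (\<kappa> + 1))"] by (simp add: K2_def)
      have "K1 * K2 ^ L \<le> max 1 K1 ^ (L + 1) * K2 ^ (L + 1)"
      proof (intro mult_mono)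
        have "max 1 K1 ^ 1 \<le> max 1 K1 ^ (L + 1)" by (intro power_increasing) auto
        then show "K1 \<le> max 1 K1 ^ (L + 1)" by simp
        show "K2 ^ L \<le> K2 ^ (L + 1)" using K2 by (intro power_increasing) auto
      qed (use K2 in auto)
      then show "K1 * K2 ^ L \<le> K0 ^ (L + 1)" by (simp only: K0_def power_mult_distrib)
    qed simp
    also have "K0 ^ (L + 1) = exp (ln K0 * (real L + 1))"
    proof -
      have "K0 > 0" by (simp add: K0_def K2_def)
      then show ?thesis using exp_of_nat_mult[of "L + 1" "ln K0"] by (simp add: algebra_simps)
    qed
    finally show "nrm (iv y) \<le> exp (ln K0 * (real L + 1)) * v (iv y)" .
  qed
qed

text \<open>The error is relative to the coordinate norm and not to \<open>v\<close>; only for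
  dominated elements does it become a relative error at \<open>v\<close>.\<close>

definition leading_digits_determine :: "nat \<Rightarrow> real \<Rightarrow> ((nat \<Rightarrow> int) \<Rightarrow> window \<Rightarrow> window) \<Rightarrow> window \<Rightarrow> bool" where
  "leading_digits_determine l \<epsilon> f d0 \<longleftrightarrow>
     (\<forall>xs ys. (\<forall>x\<in>set xs. digit n (int l ^ 2) x) \<and> (\<forall>y\<in>set ys. digit n (int l ^ 2) y) \<and>
        iv (digits_value (int l ^ 2) xs) \<noteq> 0 \<and> iv (digits_value (int l ^ 2) ys) \<noteq> 0 \<and>
        foldr f xs d0 = foldr f ys d0 \<longrightarrow>
        (\<exists>i j. nrm (iv (digits_value (int l ^ 2) xs) / of_nat l ^ (2 * i) -
                 iv (digits_value (int l ^ 2) ys) / of_nat l ^ (2 * j)) \<le>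
               \<epsilon> * nrm (iv (digits_value (int l ^ 2) xs) / of_nat l ^ (2 * i))))"

text \<open>\<open>W\<close> is the state set of a finite automaton that reads the digits.\<close>

definition finitely_determined :: "nat \<Rightarrow> real \<Rightarrow> bool" where
  "finitely_determined l \<epsilon> \<longleftrightarrow> (\<exists>W f d0. finite W \<and> d0 \<in> W \<and>
     (\<forall>x d. digit n (int l ^ 2) x \<longrightarrow> d \<in> W \<longrightarrow> f x d \<in> W) \<and> leading_digits_determine l \<epsilon> f d0)"

lemma leading_digits_archimedean:
  assumes s: "s > 0" "\<And>z. z \<noteq> 0 \<Longrightarrow> v (of_int z) = \<bar>real_of_int z\<bar> powr s" and \<epsilon>: "\<epsilon> > 0"
  shows "finitely_determined 2 \<epsilon>"
proof -
  \<comment> \<open>Both vectors differ from \<open>iv t\<close> by at most \<open>n\<close> after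
    scaling, and \<open>nrm ?u \<ge> K - n = 2 * n / \<epsilon>\<close> turns the sum of these
    errors into a relative error \<epsilon>.\<close>
  define K where "K = real n + 2 * real n / \<epsilon>"
  have K: "K > 0" using n_pos \<epsilon> by (simp add: K_def add_pos_pos)
  obtain T :: nat where T: "real T > K powr (1 / s)" using reals_Archimedean2 by blast
  have vs: "v (of_int z) \<le> r powr s" if "\<bar>real_of_int z\<bar> \<le> r" for z r
    using s that by (cases "z = 0") (auto intro!: powr_mono2)
  \<comment> \<open>A digit is appended only while all entries are below \<open>T\<close>, so no
    entry exceeds \<open>4 * T + 4\<close>.\<close>
  define W :: "window set" where "W = (\<lambda>t. ([], [t])) ` bounded_vectors {..<n} (4 * int T + 4)"
  have "finite W" unfolding W_def by (intro finite_imageI finite_bounded_vectors) simp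
  moreover have "([], [\<lambda>_. 0]) \<in> W" by (simp add: W_def zero_bounded_vectors)
  moreover have "top_digits n 4 (int T) x d \<in> W" if "digit n (int 2 ^ 2) x" and d: "d \<in> W" for x d
  proof -
    have x: "digit n 4 x" using that(1) by simp
    obtain t where t: "d = ([], [t])" "\<And>k. k < n \<Longrightarrow> \<bar>t k\<bar> \<le> 4 * int T + 4" "\<And>k. \<not> k < n \<Longrightarrow> t k = 0"
      using d by (auto simp: W_def bounded_vectors_def)
    show ?thesis
    proof (cases "\<exists>k<n. \<bar>t k\<bar> \<ge> int T")
      case True
      then show ?thesis using t d by (auto simp: top_digits_def)
    next
      case False
      have "\<bar>4 * t k + x k\<bar> \<le> 4 * int T + 4" if "k < n" for k
      proof -
        have "\<bar>t k\<bar> < int T" using False that by (auto simp: not_le)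
        moreover have "\<bar>x k\<bar> < 4" using x that by (auto simp: digit_def)
        ultimately show ?thesis by linarith
      qed
      then have "(\<lambda>k. 4 * t k + x k) \<in> bounded_vectors {..<n} (4 * int T + 4)"
        using t x by (auto simp: digit_def bounded_vectors_def)
      then show ?thesis using False by (auto simp: W_def top_digits_def t(1))
    qed
  qed
  moreover have "leading_digits_determine 2 \<epsilon> (top_digits n 4 (int T)) ([], [\<lambda>_. 0])"
    unfolding leading_digits_determine_def
  proof (intro allI impI, elim conjE)
    fix xs ys :: "(nat \<Rightarrow> int) list"
    let ?x = "digits_value (int 2 ^ 2) xs" and ?y = "digits_value (int 2 ^ 2) ys"
    assume xs: "\<forall>x\<in>set xs. digit n (int 2 ^ 2) x" and ys: "\<forall>x\<in>set ys. digit n (int 2 ^ 2) x"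
      and eq: "foldr (top_digits n 4 (int T)) xs ([], [\<lambda>_. 0]) = foldr (top_digits n 4 (int T)) ys ([], [\<lambda>_. 0])"
    have val: "\<exists>t j. foldr (top_digits n 4 (int T)) zs ([], [\<lambda>_. 0]) = ([], [t]) \<and>
        (\<forall>k<n. \<bar>digits_value (int 2 ^ 2) zs k - 4 ^ j * t k\<bar> < 4 ^ j) \<and> ((\<forall>k<n. \<bar>t k\<bar> < int T) \<longrightarrow> j = 0)"
      if "\<forall>x\<in>set zs. digit n (int 2 ^ 2) x" for zs
      using top_digits_value[of 4 zs n "int T"] that by simp
    obtain t i where t: "foldr (top_digits n 4 (int T)) xs ([], [\<lambda>_. 0]) = ([], [t])"
      "\<And>k. k < n \<Longrightarrow> \<bar>?x k - 4 ^ i * t k\<bar> < 4 ^ i" "(\<forall>k<n. \<bar>t k\<bar> < int T) \<longrightarrow> i = 0"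
      using val[OF xs] by blast
    obtain t' j where t': "foldr (top_digits n 4 (int T)) ys ([], [\<lambda>_. 0]) = ([], [t'])"
      "\<And>k. k < n \<Longrightarrow> \<bar>?y k - 4 ^ j * t' k\<bar> < 4 ^ j" "(\<forall>k<n. \<bar>t' k\<bar> < int T) \<longrightarrow> j = 0"
      using val[OF ys] by blast
    have "t' = t" using t(1) t'(1) eq by simp
    note j = t'(2,3)[unfolded this]
    have approx: "nrm (iv z / of_nat 2 ^ (2 * i) - iv t) \<le> real n"
      if "\<And>k. k < n \<Longrightarrow> \<bar>z k - 4 ^ i * t k\<bar> < 4 ^ i" for z i
    proof -
      have "iv (\<lambda>k. z k - 4 ^ i * t k) = iv z - of_int (4 ^ i) * iv t" by (simp only: iv_diff iv_cmult)
      moreover have "(of_nat 2 :: 'f) ^ (2 * i) = of_int (4 ^ i)" by (simp add: power_mult)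
      ultimately have "iv z / of_nat 2 ^ (2 * i) - iv t = iv (\<lambda>k. z k - 4 ^ i * t k) / of_int (4 ^ i)"
        by (simp add: diff_divide_distrib)
      then have "nrm (iv z / of_nat 2 ^ (2 * i) - iv t) = (\<Sum>k<n. v (of_int (z k - 4 ^ i * t k))) / v (of_int (4 ^ i))"
        by (simp only: nrm_divide_int nrm_iv)
      also have "(\<Sum>k<n. v (of_int (z k - 4 ^ i * t k))) \<le> (\<Sum>k<n. v (of_int (4 ^ i)))"
      proof (intro sum_mono)
        fix k assume "k \<in> {..<n}"
        then have "\<bar>z k - 4 ^ i * t k\<bar> \<le> 4 ^ i" using that[of k] by simp
        then have "real_of_int \<bar>z k - 4 ^ i * t k\<bar> \<le> real_of_int (4 ^ i)" by (simp only: of_int_le_iff)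
        then show "v (of_int (z k - 4 ^ i * t k)) \<le> v (of_int (4 ^ i))"
          using vs[of "z k - 4 ^ i * t k" "4 ^ i"] s(2)[of "4 ^ i"] by simp
      qed
      then have "(\<Sum>k<n. v (of_int (z k - 4 ^ i * t k))) / v (of_int (4 ^ i)) \<le> (\<Sum>k<n. v (of_int (4 ^ i))) / v (of_int (4 ^ i))"
        by (intro divide_right_mono) auto
      also have "\<dots> = real n" by simp
      finally show ?thesis .
    qed
    let ?u = "iv ?x / of_nat 2 ^ (2 * i)" and ?w = "iv ?y / of_nat 2 ^ (2 * j)"
    have "nrm (?u - ?w) \<le> \<epsilon> * nrm ?u"
    proof (cases "\<forall>k<n. \<bar>t k\<bar> < int T")
      case True
      then have "i = 0" "j = 0" using t j by auto
      then have "iv ?x = iv t" "iv ?y = iv t" using t(2) j(1) by (auto simp: iv_def)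
      then show ?thesis using \<open>i = 0\<close> \<open>j = 0\<close> \<epsilon> by (simp add: nrm_def)
    next
      case False
      then obtain k where k: "k < n" "\<bar>t k\<bar> \<ge> int T" by (auto simp: not_less)
      have T0: "real T > 0" using T by (smt (verit) powr_ge_zero)
      then have "t k \<noteq> 0" using k by auto
      have "K = (K powr (1 / s)) powr s" using K s by (simp add: powr_powr)
      also have "\<dots> \<le> real T powr s" using T s by (intro powr_mono2) auto
      also have "\<dots> \<le> v (of_int (t k))"
        unfolding s(2)[OF \<open>t k \<noteq> 0\<close>] using k s by (intro powr_mono2) linarith+
      also have "\<dots> \<le> nrm (iv t)" unfolding nrm_iv using k by (intro member_le_sum) auto
      finally have "K \<le> nrm (iv t)" .
      moreover have "nrm (iv t) \<le> nrm ?u + nrm (?u - iv t)" using nrm_diff[of ?u "?u - iv t"] by simp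
      ultimately have "K - real n \<le> nrm ?u" using approx[OF t(2)] by linarith
      then have "2 * real n / \<epsilon> \<le> nrm ?u" by (simp add: K_def)
      then have "2 * real n \<le> \<epsilon> * nrm ?u" using \<epsilon> by (simp add: field_simps)
      moreover have "nrm (?u - ?w) \<le> nrm (?u - iv t) + nrm (?w - iv t)"
        using nrm_diff[of "?u - iv t" "?w - iv t"] by simp
      ultimately show ?thesis using approx[OF t(2)] approx[OF j(1)] by linarith
    qed
    then show "\<exists>i j. nrm (iv ?x / of_nat 2 ^ (2 * i) - iv ?y / of_nat 2 ^ (2 * j)) \<le> \<epsilon> * nrm (iv ?x / of_nat 2 ^ (2 * i))"
      by blast
  qed
  ultimately show ?thesis unfolding finitely_determined_def by blast
qed

text \<open>Once low zeros are removed, the lowest digit has a nonzero entry of size below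
  \<open>p^2\<close>, hence not divisible by \<open>p^2\<close>, so the coordinate norm is at least
  \<open>v p\<close>. Agreement in \<open>N\<close> digits makes the difference at most
  \<open>n * (v p)^(2 * N)\<close>, which is relatively small for a fixed large
  \<open>N\<close>.\<close>

lemma leading_digits_nonarchimedean:
  assumes p: "prime p" "v (of_nat p) < 1" "\<And>z. v (of_int z) \<le> 1" "\<And>z. \<not> int p dvd z \<Longrightarrow> v (of_int z) = 1"
    and \<epsilon>: "\<epsilon> > 0"
  shows "finitely_determined p \<epsilon>"
proof -
  have p0: "p > 0" using p(1) by (simp add: prime_gt_0_nat)
  let ?B = "int p ^ 2" and ?\<pi> = "v (of_nat p)"
  have \<pi>: "?\<pi> > 0" using p0 by simp
  have "(\<lambda>N. real n * ?\<pi> ^ N) \<longlonglongrightarrow> real n * 0"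
    using p(2) by (intro tendsto_mult_left LIMSEQ_realpow_zero) auto
  then have "\<forall>\<^sub>F N in sequentially. real n * ?\<pi> ^ N < \<epsilon> * ?\<pi>"
    using \<epsilon> \<pi> by (intro order_tendstoD(2)[where y = "real n * 0"]) auto
  then obtain N0 where N0: "real n * ?\<pi> ^ N < \<epsilon> * ?\<pi>" if "N \<ge> N0" for N by (auto simp: eventually_sequentially)
  define N where "N = Suc N0"
  have N: "N > 0" "real n * ?\<pi> ^ (2 * N) \<le> \<epsilon> * ?\<pi>" using N0[of "2 * N"] by (auto simp: N_def)
  define W1 where "W1 = {xs. set xs \<subseteq> Collect (digit n ?B) \<and> length xs \<le> N}"
  have take: "take N (x # xs) \<in> W1" if "digit n ?B x" "xs \<in> W1" for x xs
    using that set_take_subset[of N "x # xs"] by (auto simp: W1_def)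
  have "finite (W1 \<times> W1)" unfolding W1_def by (intro finite_cartesian_product finite_lists_length_le finite_digits)
  moreover have "([], []) \<in> W1 \<times> W1" by (simp add: W1_def)
  moreover have "low_digits N x d \<in> W1 \<times> W1" if "digit n ?B x" "d \<in> W1 \<times> W1" for x d
    using that take by (auto simp: low_digits_def)
  moreover have "leading_digits_determine p \<epsilon> (low_digits N) ([], [])"
    unfolding leading_digits_determine_def
  proof (intro allI impI, elim conjE)
    fix xs ys :: "(nat \<Rightarrow> int) list"
    assume xs: "\<forall>x\<in>set xs. digit n ?B x" and ys: "\<forall>y\<in>set ys. digit n ?B y"
      and nz: "iv (digits_value ?B xs) \<noteq> 0" "iv (digits_value ?B ys) \<noteq> 0"
      and eq: "foldr (low_digits N) xs ([], []) = foldr (low_digits N) ys ([], [])"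
    obtain i x xs' where x: "xs = replicate i (\<lambda>_. 0) @ x # xs'" "x \<noteq> (\<lambda>_. 0)"
      "snd (foldr (low_digits N) xs ([], [])) = take N (x # xs')"
      using low_digits_value[OF N(1), of xs ?B] nz(1) by (auto simp: iv_def)
    obtain j y ys' where y: "ys = replicate j (\<lambda>_. 0) @ y # ys'" "y \<noteq> (\<lambda>_. 0)"
      "snd (foldr (low_digits N) ys ([], [])) = take N (y # ys')"
      using low_digits_value[OF N(1), of ys ?B] nz(2) by (auto simp: iv_def)
    have same: "take N (x # xs') = take N (y # ys')" using x(3) y(3) eq by simp
    have val: "digits_value ?B (replicate i (\<lambda>_. 0) @ zs) = (\<lambda>k. int p ^ (2 * i) * digits_value ?B zs k)" for i zs
      by (rule ext) (simp add: digits_value_append digits_value_replicate_zero power_mult)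
    have scale: "iv (digits_value ?B (replicate i (\<lambda>_. 0) @ zs)) / of_nat p ^ (2 * i) = iv (digits_value ?B zs)" for i zs
      unfolding val iv_cmult using p0 by simp
    have "digits_value ?B (x # xs') k - digits_value ?B (y # ys') k =
        int p ^ (2 * N) * (digits_value ?B (drop N (x # xs')) k - digits_value ?B (drop N (y # ys')) k)" for k
    proof -
      \<comment> \<open>This also covers words shorter than \<open>N\<close>, whose window contains
        all their digits and which behave as if continued by zeros.\<close>
      have *: "digits_value ?B zs k = digits_value ?B (take N zs) k + ?B ^ N * digits_value ?B (drop N zs) k" for zs
      proof (cases "length zs \<ge> N")
        case True
        then show ?thesis using digits_value_append[of ?B "take N zs" "drop N zs" k] by simp
      qed simp
      have pow: "?B ^ N = int p ^ (2 * N)" by (simp only: power_mult)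
      show ?thesis unfolding *[of "x # xs'"] *[of "y # ys'"] same pow by (simp only: right_diff_distrib add_diff_cancel_left)
    qed
    then have "iv (digits_value ?B (x # xs')) - iv (digits_value ?B (y # ys')) =
        iv (\<lambda>k. int p ^ (2 * N) * (digits_value ?B (drop N (x # xs')) k - digits_value ?B (drop N (y # ys')) k))"
      by (simp flip: iv_diff)
    then have "nrm (iv (digits_value ?B (x # xs')) - iv (digits_value ?B (y # ys'))) \<le> (\<Sum>k<n. ?\<pi> ^ (2 * N) * 1)"
      unfolding nrm_iv of_int_mult mult
      by (simp only: nrm_iv of_int_mult mult) (intro sum_mono mult_mono p(3); simp add: power)
    also have "\<dots> \<le> \<epsilon> * ?\<pi>" using N(2) by simp
    also have "?\<pi> \<le> nrm (iv (digits_value ?B (x # xs')))"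
    proof -
      obtain k where k: "x k \<noteq> 0" using x(2) by auto
      have dx: "digit n ?B x" using xs x(1) by simp
      then have kn: "k < n" using k by (metis digit_def not_le)
      have "\<not> ?B dvd x k"
        using dx kn k zdvd_not_zless[of "\<bar>x k\<bar>" ?B] by (simp add: digit_def)
      then have nd: "\<not> ?B dvd digits_value ?B (x # xs') k"
        by (simp add: dvd_add_left_iff)
      let ?z = "digits_value ?B (x # xs') k"
      have "?\<pi> \<le> v (of_int ?z)"
      proof (cases "int p dvd ?z")
        case True
        then obtain u where u: "?z = int p * u" by (elim dvdE)
        then have "\<not> int p dvd u" using nd by (auto simp: power2_eq_square)
        then have "v (of_int u) = 1" by (rule p(4))
        moreover have "v (of_int ?z) = ?\<pi> * v (of_int u)" by (simp only: u of_int_mult mult of_int_of_nat_eq)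
        ultimately show ?thesis by (simp only: mult_1_right order_refl)
      qed (use p in \<open>simp add: p(4) del: digits_value.simps\<close>)
      also have "\<dots> \<le> nrm (iv (digits_value ?B (x # xs')))"
        unfolding nrm_iv using kn by (intro member_le_sum) auto
      finally show ?thesis .
    qed
    finally have "nrm (iv (digits_value ?B (x # xs')) - iv (digits_value ?B (y # ys'))) \<le>
        \<epsilon> * nrm (iv (digits_value ?B (x # xs')))" using \<epsilon> by simp
    then show "\<exists>i j. nrm (iv (digits_value ?B xs) / of_nat p ^ (2 * i) - iv (digits_value ?B ys) / of_nat p ^ (2 * j)) \<le>
        \<epsilon> * nrm (iv (digits_value ?B xs) / of_nat p ^ (2 * i))"
      by (intro exI[of _ i] exI[of _ j]) (simp only: x(1) y(1) scale)
  qed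
  ultimately show ?thesis unfolding finitely_determined_def by blast
qed

text \<open>The base \<open>l\<^sup>2\<close> is a square, so that shifting digits does not change square classes.\<close>

lemma leading_digits:
  assumes x: "\<exists>x. x \<noteq> 0 \<and> v x \<noteq> 1"
  obtains l where "l \<ge> 2" "\<And>\<epsilon>. \<epsilon> > 0 \<Longrightarrow> finitely_determined l \<epsilon>"
    "\<exists>\<kappa>::nat. \<forall>z::int. z \<noteq> 0 \<longrightarrow> 1 \<le> \<bar>real_of_int z\<bar> ^ \<kappa> * v (of_int z)"
proof (cases "\<exists>k. v (of_nat k) > 1")
  case True
  then obtain s where s: "s > 0" "\<And>z. z \<noteq> 0 \<Longrightarrow> v (of_int z) = \<bar>real_of_int z\<bar> powr s"
    using archimedean_power by metis
  show ?thesis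
  proof (rule that[of 2])
    have "1 \<le> \<bar>real_of_int z\<bar> ^ 0 * v (of_int z)" if "z \<noteq> 0" for z :: int
      using s that by (simp add: ge_one_powr_ge_zero)
    then show "\<exists>\<kappa>::nat. \<forall>z::int. z \<noteq> 0 \<longrightarrow> 1 \<le> \<bar>real_of_int z\<bar> ^ \<kappa> * v (of_int z)" by blast
  qed (use leading_digits_archimedean[OF s] in auto)
next
  case False
  then have le: "v (of_nat k) \<le> 1" for k by (simp add: not_less)
  obtain k where k: "k > 0" "v (of_nat k) \<noteq> 1" using nontrivial_on_nat x by metis
  obtain p where p: "prime p" "v (of_nat p) < 1" "\<And>z. v (of_int z) \<le> 1"
    "\<And>z. \<not> int p dvd z \<Longrightarrow> v (of_int z) = 1"
    using nonarchimedean_prime[OF le k] by blast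
  have p2: "p \<ge> 2" using p(1) by (simp add: prime_ge_2_nat)
  show ?thesis
  proof (rule that[OF p2])
    show "finitely_determined p \<epsilon>" if "\<epsilon> > 0" for \<epsilon>
      by (rule leading_digits_nonarchimedean[OF p that])
    have "v (of_nat p) > 0" using p2 by simp
    \<comment> \<open>With \<open>2 ^ \<kappa> * v p \<ge> 1\<close>, stripping a factor
      \<open>p\<close> from \<open>z\<close> never increases the product in question, and an integer
      prime to \<open>p\<close> has value \<open>1\<close>.\<close>
    then obtain \<kappa> where \<kappa>: "(1 / 2) ^ \<kappa> < v (of_nat p)" using real_arch_pow_inv[of "v (of_nat p)" "1 / 2"] by auto
    have "1 \<le> \<bar>real_of_int z\<bar> ^ \<kappa> * v (of_int z)" if "z \<noteq> 0" for z :: int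
      using that
    proof (induction "nat \<bar>z\<bar>" arbitrary: z rule: less_induct)
      case less
      show ?case
      proof (cases "int p dvd z")
        case True
        then obtain u where u: "z = int p * u" by (elim dvdE)
        have u0: "u \<noteq> 0" using less.prems u by auto
        then have "\<bar>u\<bar> < \<bar>z\<bar>" using p2 by (simp add: u abs_mult)
        then have IH: "1 \<le> \<bar>real_of_int u\<bar> ^ \<kappa> * v (of_int u)" using less.hyps u0 by simp
        have "1 \<le> 2 ^ \<kappa> * v (of_nat p)" using \<kappa> by (simp add: field_simps)
        also have "\<dots> \<le> real p ^ \<kappa> * v (of_nat p)" using p2 by (intro mult_right_mono power_mono) auto
        finally have "1 * 1 \<le> (real p ^ \<kappa> * v (of_nat p)) * (\<bar>real_of_int u\<bar> ^ \<kappa> * v (of_int u))"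
          using IH by (intro mult_mono) auto
        then show ?thesis by (simp add: u mult abs_mult power_mult_distrib mult_ac)
      next
        case False
        then show ?thesis using less.prems by (simp add: p(4))
      qed
    qed
    then show "\<exists>\<kappa>::nat. \<forall>z::int. z \<noteq> 0 \<longrightarrow> 1 \<le> \<bar>real_of_int z\<bar> ^ \<kappa> * v (of_int z)" by blast
  qed
qed

end

section \<open>Two-tape machines\<close>

type_synonym 's two_tape = "'s \<Rightarrow> nat \<Rightarrow> nat \<Rightarrow> 's \<times> (nat \<times> int) \<times> (nat \<times> int)"

definition two_tape_step :: "'s two_tape \<Rightarrow> 's \<Rightarrow> 's \<times> tape \<times> tape \<Rightarrow> 's \<times> tape \<times> tape" where
  "two_tape_step \<delta> h = (\<lambda>(s, t0, t1). if s = h then (s, t0, t1)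
     else case \<delta> s (t0 0) (t1 0) of (s', a0, a1) \<Rightarrow> (s', act_on_tape a0 t0, act_on_tape a1 t1))"

definition two_tape_closed :: "'s two_tape \<Rightarrow> 's set \<Rightarrow> 's \<Rightarrow> nat \<Rightarrow> bool" where
  "two_tape_closed \<delta> Q h S \<longleftrightarrow> (\<forall>s\<in>Q - {h}. \<forall>x<S. \<forall>y<S.
     \<delta> s x y \<in> Q \<times> ({..<S} \<times> {-1, 0, 1}) \<times> ({..<S} \<times> {-1, 0, 1}))"

text \<open>The machine model prescribes the numbers of the initial and the halting state; the other
  states are numbered in between in any order. That symbols stay below \<open>S\<close> and states
  in \<open>Q\<close> has to be carried along as an invariant of the run.\<close>

lemma two_tape_machine:
  assumes Q: "finite Q" "s0 \<in> Q" "h \<in> Q" "s0 \<noteq> h" and S: "S > 0" and closed: "two_tape_closed \<delta> Q h S"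
  obtains M where "wf_turing_machine M" "num_symbols M = S"
    "\<And>w t u t0 t1. \<lbrakk>set w \<subseteq> {..<S}; (two_tape_step \<delta> h ^^ t) (s0, word_tape w, \<lambda>_. 0) = (h, t0, t1);
        0 \<notin> set u; \<forall>i\<le>length u. t0 (int i) = word_tape u (int i)\<rbrakk> \<Longrightarrow> tm_halts_with M w t u"
proof -
  have "card {s0, h} \<le> card Q" using Q by (intro card_mono) auto
  then have card: "card Q \<ge> 2" using Q by simp
  have "card (Q - {s0, h}) = card {1..<card Q - 1}" using Q by (subst card_Diff_subset) auto
  then obtain g where g: "bij_betw g (Q - {s0, h}) {1..<card Q - 1}"
    using finite_same_card_bij[of "Q - {s0, h}" "{1..<card Q - 1}"] Q(1) by auto
  define enc where "enc = g(s0 := 0, h := card Q - 1)"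
  have g_in: "g s \<in> {1..<card Q - 1}" if "s \<in> Q" "s \<noteq> s0" "s \<noteq> h" for s
    using g that by (auto simp: bij_betw_def)
  have inj: "inj_on enc Q"
  proof (rule inj_onI)
    fix x y assume xy: "x \<in> Q" "y \<in> Q" "enc x = enc y"
    have "inj_on g (Q - {s0, h})" using g by (simp add: bij_betw_def)
    then have "x = y" if "x \<notin> {s0, h}" "y \<notin> {s0, h}"
      using xy that by (auto simp: enc_def dest: inj_onD)
    moreover have "x = y" if "x \<in> {s0, h} \<or> y \<in> {s0, h}"
      using xy that g_in[of x] g_in[of y] card Q(4)
      by (cases "x = h"; cases "y = h"; cases "x = s0"; cases "y = s0") (simp_all add: enc_def)
    ultimately show "x = y" by blast
  qed
  have "enc s \<le> card Q - 1" if "s \<in> Q" for s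
    using g_in[OF that] by (auto simp: enc_def)
  then have enc: "enc s0 = 0" "enc h = card Q - 1" "\<And>s. s \<in> Q \<Longrightarrow> enc s \<le> card Q - 1"
    using Q by (auto simp: enc_def)
  have "enc ` Q = {..card Q - 1}"
    using enc(3) card_image[OF inj] card by (intro card_subset_eq) auto
  then have dec: "inv_into Q enc q \<in> Q" "enc (inv_into Q enc q) = q" if "q \<le> card Q - 1" for q
    using that by (auto intro: inv_into_into f_inv_into_f)
  have dec_enc: "inv_into Q enc (enc s) = s" if "s \<in> Q" for s
    using that inj by simp
  define M where "M = \<lparr>num_tapes = 2, num_symbols = S, num_states = card Q - 1,
    transition = (\<lambda>q rs. case \<delta> (inv_into Q enc q) (rs ! 0) (rs ! 1) of (s', a0, a1) \<Rightarrow> (enc s', [a0, a1]))\<rparr>"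
  have "wf_turing_machine M"
    unfolding wf_turing_machine_def
  proof (intro conjI allI impI)
    fix q rs assume q: "q < num_states M" and rs: "length rs = num_tapes M \<and> set rs \<subseteq> {..<num_symbols M}"
    then obtain x y where xy: "rs = [x, y]" "x < S" "y < S"
      by (auto simp: M_def numeral_2_eq_2 length_Suc_conv)
    let ?s = "inv_into Q enc q"
    have "?s \<in> Q" "?s \<noteq> h" using dec[of q] q enc(2) by (auto simp: M_def)
    then have "\<delta> ?s x y \<in> Q \<times> ({..<S} \<times> {-1, 0, 1}) \<times> ({..<S} \<times> {-1, 0, 1})"
      using closed xy by (auto simp: two_tape_closed_def)
    then show "case transition M q rs of (q', acts) \<Rightarrow> q' \<le> num_states M \<and> length acts = num_tapes M \<and>
        set acts \<subseteq> {..<num_symbols M} \<times> {-1, 0, 1}"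
      by (auto simp: M_def xy enc(3)[simplified] split: prod.splits)
  qed (use S in \<open>auto simp: M_def\<close>)
  moreover have "num_symbols M = S" by (simp add: M_def)
  moreover have "tm_halts_with M w t u"
    if w: "set w \<subseteq> {..<S}" and run: "(two_tape_step \<delta> h ^^ t) (s0, word_tape w, \<lambda>_. 0) = (h, t0, t1)"
      and u: "0 \<notin> set u" "\<forall>i\<le>length u. t0 (int i) = word_tape u (int i)" for w t u t0 t1
  proof -
    have "word_tape w i < S" for i
      using w S nth_mem[of "nat i" w] by (force simp: word_tape_def)
    then have "\<exists>s r0 r1. (two_tape_step \<delta> h ^^ t) (s0, word_tape w, \<lambda>_. 0) = (s, r0, r1) \<and>
        s \<in> Q \<and> (\<forall>i. r0 i < S) \<and> (\<forall>i. r1 i < S) \<and> (tm_step M ^^ t) (tm_init M w) = (enc s, [r0, r1])" for t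
    proof (induction t)
      case 0
      then show ?case using Q S enc by (simp add: tm_init_def M_def)
    next
      case (Suc t)
      then obtain s r0 r1 where IH: "(two_tape_step \<delta> h ^^ t) (s0, word_tape w, \<lambda>_. 0) = (s, r0, r1)"
        "s \<in> Q" "\<And>i. r0 i < S" "\<And>i. r1 i < S" "(tm_step M ^^ t) (tm_init M w) = (enc s, [r0, r1])"
        by blast
      show ?case
      proof (cases "s = h")
        case True
        have "tm_step M (enc h, [r0, r1]) = (enc h, [r0, r1])"
          by (simp add: tm_step_def M_def enc)
        moreover have "two_tape_step \<delta> h (h, r0, r1) = (h, r0, r1)" by (simp add: two_tape_step_def)
        ultimately show ?thesis using IH True by simp
      next
        case False
        obtain s' w0 m0 w1 m1 where d: "\<delta> s (r0 0) (r1 0) = (s', (w0, m0), (w1, m1))"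
          by (cases "\<delta> s (r0 0) (r1 0)") auto
        have "\<delta> s (r0 0) (r1 0) \<in> Q \<times> ({..<S} \<times> {-1, 0, 1}) \<times> ({..<S} \<times> {-1, 0, 1})"
          using closed IH False unfolding two_tape_closed_def by blast
        then have s': "s' \<in> Q" "w0 < S" "w1 < S" by (auto simp: d)
        have "enc s \<noteq> card Q - 1" using False IH(2) Q inj enc(2) by (metis inj_onD)
        then have "tm_step M (enc s, [r0, r1]) = (enc s', [act_on_tape (w0, m0) r0, act_on_tape (w1, m1) r1])"
          by (simp add: tm_step_def M_def dec_enc IH d)
        moreover have "two_tape_step \<delta> h (s, r0, r1) = (s', act_on_tape (w0, m0) r0, act_on_tape (w1, m1) r1)"
          using False by (simp add: two_tape_step_def d)
        ultimately show ?thesis using IH s' by (auto simp: act_on_tape_def)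
      qed
    qed
    from this[of t] run have "(tm_step M ^^ t) (tm_init M w) = (enc h, [t0, t1])" by auto
    then show ?thesis using u enc by (simp add: tm_halts_with_def M_def)
  qed
  ultimately show ?thesis using that by blast
qed

text \<open>Tapes are indexed relative to the head, so every move shifts all contents. With the head
  position \<open>h\<close> kept apart from the absolute contents \<open>W\<close>, a step alters
  one cell of \<open>W\<close> and the number \<open>h\<close>.\<close>

definition tape_from :: "int \<Rightarrow> tape \<Rightarrow> tape" where
  "tape_from h W = (\<lambda>i. W (i + h))"

lemma tape_from_0 [simp]: "tape_from h W 0 = W h"
  and tape_from_start: "tape_from 0 W = W"
  by (simp_all add: tape_from_def)

lemma act_on_tape_from: "act_on_tape (w, d) (tape_from h W) = tape_from (h + d) (W(h := w))"
  by (auto simp: act_on_tape_def tape_from_def fun_eq_iff algebra_simps)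

lemma word_tape_nth: "i < length w \<Longrightarrow> word_tape w (int i) = w ! i"
  by (simp add: word_tape_def)

lemma word_tape_blank: "i < 0 \<or> i \<ge> int (length w) \<Longrightarrow> word_tape w i = 0" for i :: int
  by (auto simp: word_tape_def)

lemma word_tape_append_length:
  "word_tape (zs @ ys) (int (length zs)) = (case ys of [] \<Rightarrow> 0 | y # _ \<Rightarrow> y)"
  by (auto simp: word_tape_def nth_append split: list.splits)

lemma word_tape_write:
  "(word_tape (zs @ ys))(int (length zs) := y) = word_tape (zs @ y # tl ys)"
proof
  fix i :: int
  show "((word_tape (zs @ ys))(int (length zs) := y)) i = word_tape (zs @ y # tl ys) i"
  proof (cases "i = int (length zs)")
    case False
    show ?thesis
    proof (cases "i \<ge> 0")
      case True
      then obtain k where k: "i = int k" by (metis nonneg_int_cases)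
      show ?thesis
        using False by (cases ys) (auto simp: word_tape_def k nth_append nth_Cons split: nat.splits)
    qed (simp add: word_tape_def False)
  qed (simp add: word_tape_append_length)
qed

lemma word_tape_erase_last: "(word_tape (zs @ [y]))(int (length zs) := 0) = word_tape zs"
  by (auto simp: word_tape_def nth_append fun_eq_iff)

section \<open>Iterated transducers run in polynomial time\<close>

datatype ('q, 'c, 'd) control =
  Seek | Read 'q | Sweep 'q nat 'c | Rewind 'q | Climb | Fold 'd | Sign | Halt

text \<open>The input is read from right to left.  Every symbol triggers a pass of a sequential
  transducer over the work tape, whose first symbol is the least significant one; the transducer
  keeps extending the word with blanks as input until its carry is back to \<open>c\<^sub>0\<close>.  In the end, the work
  tape is folded from right to left and the outcome decides the answer.\<close>

locale iterated_transducer =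
  fixes S :: nat and Q :: "'q set" and C :: "'c set" and W :: "'d set"
    and q\<^sub>0 :: 'q and c\<^sub>0 :: 'c and d\<^sub>0 :: 'd and i\<^sub>0 :: nat
    and next_control :: "'q \<Rightarrow> nat \<Rightarrow> 'q" and transduce :: "'q \<Rightarrow> nat \<Rightarrow> 'c \<Rightarrow> nat \<Rightarrow> nat \<times> 'c"
    and rank :: "'c \<Rightarrow> nat" and absorb :: "nat \<Rightarrow> 'd \<Rightarrow> 'd" and accept :: "'d \<Rightarrow> bool"
  assumes finite: "finite Q" "finite C" "finite W"
    and start: "q\<^sub>0 \<in> Q" "c\<^sub>0 \<in> C" "d\<^sub>0 \<in> W" "0 < i\<^sub>0" "i\<^sub>0 < S" "6 \<le> S"
    and next_control: "\<lbrakk>q \<in> Q; \<sigma> \<in> {1..5}\<rbrakk> \<Longrightarrow> next_control q \<sigma> \<in> Q"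
    and transduce: "\<lbrakk>q \<in> Q; \<sigma> \<in> {1..5}; c \<in> C; y < S\<rbrakk> \<Longrightarrow> transduce q \<sigma> c y \<in> {1..<S} \<times> C"
    and rank: "\<lbrakk>q \<in> Q; \<sigma> \<in> {1..5}; c \<in> C; c \<noteq> c\<^sub>0\<rbrakk> \<Longrightarrow> rank (snd (transduce q \<sigma> c 0)) < rank c"
    and absorb: "\<lbrakk>y \<in> {1..<S}; d \<in> W\<rbrakk> \<Longrightarrow> absorb y d \<in> W"
begin

text \<open>The number is fuel for the recursion; the rank of the carry is always enough, because
  every blank read lowers it.\<close>

primrec flush :: "'q \<Rightarrow> nat \<Rightarrow> nat \<Rightarrow> 'c \<Rightarrow> nat list" where
  "flush q \<sigma> 0 c = []"
| "flush q \<sigma> (Suc k) c = (if c = c\<^sub>0 then [] else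
     fst (transduce q \<sigma> c 0) # flush q \<sigma> k (snd (transduce q \<sigma> c 0)))"

primrec pass :: "'q \<Rightarrow> nat \<Rightarrow> 'c \<Rightarrow> nat list \<Rightarrow> nat list" where
  "pass q \<sigma> c [] = flush q \<sigma> (rank c) c"
| "pass q \<sigma> c (y # ys) = fst (transduce q \<sigma> c y) # pass q \<sigma> (snd (transduce q \<sigma> c y)) ys"

definition process :: "nat \<Rightarrow> 'q \<times> nat list \<Rightarrow> 'q \<times> nat list" where
  "process \<sigma> = (\<lambda>(q, ys). (next_control q \<sigma>, pass q \<sigma> c\<^sub>0 ys))"

definition outcome :: "nat list \<Rightarrow> 'd" where
  "outcome w = foldr absorb (snd (foldr process w (q\<^sub>0, [i\<^sub>0]))) d\<^sub>0"

text \<open>Reading erases the input, so the first tape is blank when the answer is written. The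
  answer is \<open>2\<close> for the binary digit one; for \<open>-1\<close> the sign
  \<open>3\<close> is put to its left, where the head stops. Work symbols are never
  \<open>0\<close>, so blanks mark both ends of the work word.\<close>

fun \<delta> :: "('q, 'c, 'd) control two_tape" where
  "\<delta> Seek x y = (if x = 0 then (Read q\<^sub>0, (0, -1), (i\<^sub>0, 0)) else (Seek, (x, 1), (y, 0)))"
| "\<delta> (Read q) x y = (if x \<in> {1..5} then (Sweep q x c\<^sub>0, (0, -1), (y, 0)) else (Climb, (x, 0), (y, 0)))"
| "\<delta> (Sweep q \<sigma> c) x y = (if y = 0 \<and> c = c\<^sub>0 then (Rewind (next_control q \<sigma>), (x, 0), (y, -1))
     else (Sweep q \<sigma> (snd (transduce q \<sigma> c y)), (x, 0), (fst (transduce q \<sigma> c y), 1)))"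
| "\<delta> (Rewind q) x y = (if y = 0 then (Read q, (x, 0), (y, 1)) else (Rewind q, (x, 0), (y, -1)))"
| "\<delta> Climb x y = (if y = 0 then (Fold d\<^sub>0, (x, 0), (y, -1)) else (Climb, (x, 0), (y, 1)))"
| "\<delta> (Fold d) x y = (if y = 0 then (if accept d then (Halt, (2, 0), (y, 0)) else (Sign, (2, -1), (y, 0)))
     else (Fold (absorb y d), (x, 0), (y, -1)))"
| "\<delta> Sign x y = (Halt, (3, 0), (y, 0))"
| "\<delta> Halt x y = (Halt, (x, 0), (y, 0))"

definition states :: "('q, 'c, 'd) control set" where
  "states = {Seek, Climb, Sign, Halt} \<union> Read ` Q \<union> Rewind ` Q \<union> Fold ` W \<union>
     (\<lambda>(q, \<sigma>, c). Sweep q \<sigma> c) ` (Q \<times> {1..5} \<times> C)"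

lemma closed: "two_tape_closed \<delta> states Halt S"
  unfolding two_tape_closed_def
proof (intro ballI allI impI)
  fix s x y assume s: "s \<in> states - {Halt}" and xy: "x < S" "y < S"
  have sweep: "Sweep q \<sigma> c \<in> states" if "q \<in> Q" "\<sigma> \<in> {1..5}" "c \<in> C" for q \<sigma> c
    using that unfolding states_def by (intro UnI2 image_eqI[of _ _ "(q, \<sigma>, c)"]) auto
  show "\<delta> s x y \<in> states \<times> ({..<S} \<times> {-1, 0, 1}) \<times> ({..<S} \<times> {-1, 0, 1})"
  proof (cases s)
    case (Read q)
    then have "q \<in> Q" using s by (auto simp: states_def)
    then show ?thesis using Read xy start sweep[of q x "c\<^sub>0"] by (auto simp: states_def)
  next
    case (Sweep q \<sigma> c)
    then have qc: "q \<in> Q" "\<sigma> \<in> {1..5}" "c \<in> C" using s by (auto simp: states_def)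
    have "fst (transduce q \<sigma> c y) < S" "snd (transduce q \<sigma> c y) \<in> C"
      using transduce[OF qc xy(2)] by (auto simp: mem_Times_iff)
    moreover have "Rewind (next_control q \<sigma>) \<in> states" using next_control[OF qc(1,2)] by (simp add: states_def)
    ultimately show ?thesis using Sweep xy sweep[OF qc(1,2)] by simp
  next
    case (Fold d)
    then have "d \<in> W" using s by (auto simp: states_def)
    then show ?thesis using Fold xy start absorb[of y d] by (auto simp: states_def)
  qed (use s xy start in \<open>auto simp: states_def\<close>)
qed

section \<open>Running times and results of the phases of the machine\<close>

abbreviation "steps t \<equiv> two_tape_step \<delta> Halt ^^ t"

lemma steps_trans:
  assumes "steps a x = y" "steps b y = z" shows "steps (a + b) x = z"
proof -
  have "steps (a + b) x = steps b (steps a x)"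
    unfolding add.commute[of a b] funpow_add by simp
  then show ?thesis using assms by simp
qed

lemma steps_Suc:
  assumes "s \<noteq> Halt" "\<delta> s (X h) (Y k) = (s', (x, d), (y, e))"
    "steps t (s', tape_from (h + d) (X(h := x)), tape_from (k + e) (Y(k := y))) = c"
  shows "steps (Suc t) (s, tape_from h X, tape_from k Y) = c"
  using assms by (simp add: funpow_Suc_right two_tape_step_def act_on_tape_from del: funpow.simps)

lemma seek:
  assumes "0 \<notin> set ys"
  shows "steps (length ys) (Seek, tape_from (int (length zs)) (word_tape (zs @ ys)), tape_from k Y) =
    (Seek, tape_from (int (length (zs @ ys))) (word_tape (zs @ ys)), tape_from k Y)"
  using assms
proof (induction ys arbitrary: zs)
  case (Cons y ys)
  show ?case unfolding list.size(4) add_Suc_right add_0_right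
    by (rule steps_Suc[where x = y and d = 1 and y = "Y k" and e = 0 and s' = Seek])
      (use Cons.IH[of "zs @ [y]"] Cons.prems in \<open>auto simp: word_tape_append_length word_tape_write add.commute\<close>)
qed simp

lemma flush_symbols:
  assumes "q \<in> Q" "\<sigma> \<in> {1..5}" "c \<in> C"
  shows "set (flush q \<sigma> k c) \<subseteq> {1..<S} \<and> length (flush q \<sigma> k c) \<le> k"
  using assms(3)
proof (induction k arbitrary: c)
  case (Suc k)
  have "transduce q \<sigma> c 0 \<in> {1..<S} \<times> C" using transduce[OF assms(1,2) Suc.prems] start by simp
  then have t: "fst (transduce q \<sigma> c 0) \<in> {1..<S}" "snd (transduce q \<sigma> c 0) \<in> C" by (auto simp: mem_Times_iff)
  show ?case using Suc.IH[OF t(2)] t(1) by auto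
qed auto

lemma pass_symbols:
  assumes "q \<in> Q" "\<sigma> \<in> {1..5}" "c \<in> C" "set ys \<subseteq> {1..<S}"
  shows "set (pass q \<sigma> c ys) \<subseteq> {1..<S} \<and> length (pass q \<sigma> c ys) \<le> length ys + Max (rank ` C)"
  using assms(3,4)
proof (induction ys arbitrary: c)
  case Nil
  have "rank c \<le> Max (rank ` C)" using Nil finite(2) by (intro Max_ge) auto
  then show ?case using flush_symbols[OF assms(1,2) Nil(1), of "rank c"] by auto
next
  case (Cons y ys)
  have "transduce q \<sigma> c y \<in> {1..<S} \<times> C" using transduce[OF assms(1,2) Cons.prems(1)] Cons.prems by simp
  then have t: "fst (transduce q \<sigma> c y) \<in> {1..<S}" "snd (transduce q \<sigma> c y) \<in> C" by (auto simp: mem_Times_iff)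
  show ?case using Cons.IH[OF t(2)] Cons.prems t(1) by auto
qed

lemma sweep_1:
  assumes "\<not> (ys = [] \<and> c = c\<^sub>0)" "y = (case ys of [] \<Rightarrow> 0 | y # _ \<Rightarrow> y)" "0 \<notin> set ys"
    and "steps t (Sweep q \<sigma> (snd (transduce q \<sigma> c y)), tape_from h X,
      tape_from (int (length (zs @ [fst (transduce q \<sigma> c y)]))) (word_tape ((zs @ [fst (transduce q \<sigma> c y)]) @ tl ys))) = z"
  shows "steps (Suc t) (Sweep q \<sigma> c, tape_from h X, tape_from (int (length zs)) (word_tape (zs @ ys))) = z"
  using assms
  by (intro steps_Suc[where x = "X h" and d = 0 and y = "fst (transduce q \<sigma> c y)" and e = 1
        and s' = "Sweep q \<sigma> (snd (transduce q \<sigma> c y))"])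
    (auto simp: word_tape_append_length word_tape_write add.commute split: list.splits)

lemma sweep_flush:
  assumes "q \<in> Q" "\<sigma> \<in> {1..5}" "c \<in> C" "rank c \<le> k"
  shows "steps (length (flush q \<sigma> k c)) (Sweep q \<sigma> c, tape_from h X, tape_from (int (length zs)) (word_tape zs)) =
    (Sweep q \<sigma> c\<^sub>0, tape_from h X,
      tape_from (int (length (zs @ flush q \<sigma> k c))) (word_tape (zs @ flush q \<sigma> k c)))"
  using assms(3,4)
proof (induction k arbitrary: c zs)
  case 0
  then have "c = c\<^sub>0" using rank[OF assms(1,2) 0(1)] by auto
  then show ?case by simp
next
  case (Suc k)
  show ?case
  proof (cases "c = c\<^sub>0")
    case False
    let ?y = "fst (transduce q \<sigma> c 0)" and ?c = "snd (transduce q \<sigma> c 0)"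
    have "transduce q \<sigma> c 0 \<in> {1..<S} \<times> C" using transduce[OF assms(1,2) Suc.prems(1)] start by simp
    then have c: "?c \<in> C" by (auto simp: mem_Times_iff)
    have "rank ?c \<le> k" using rank[OF assms(1,2) Suc.prems(1) False] Suc.prems(2) by simp
    from Suc.IH[OF c this, of "zs @ [?y]"] False show ?thesis
      using sweep_1[of "[]" c 0 "length (flush q \<sigma> k ?c)" q \<sigma> h X zs] by simp
  qed simp
qed

lemma sweep:
  assumes "q \<in> Q" "\<sigma> \<in> {1..5}" "c \<in> C" "set ys \<subseteq> {1..<S}"
  shows "steps (length (pass q \<sigma> c ys)) (Sweep q \<sigma> c, tape_from h X, tape_from (int (length zs)) (word_tape (zs @ ys))) =
    (Sweep q \<sigma> c\<^sub>0, tape_from h X,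
      tape_from (int (length (zs @ pass q \<sigma> c ys))) (word_tape (zs @ pass q \<sigma> c ys)))"
  using assms(3,4)
proof (induction ys arbitrary: c zs)
  case Nil
  then show ?case using sweep_flush[OF assms(1,2) Nil(1) order_refl] by simp
next
  case (Cons y ys)
  let ?y = "fst (transduce q \<sigma> c y)" and ?c = "snd (transduce q \<sigma> c y)"
  have "transduce q \<sigma> c y \<in> {1..<S} \<times> C" using transduce[OF assms(1,2) Cons.prems(1)] Cons.prems by simp
  then have "?c \<in> C" by (auto simp: mem_Times_iff)
  from Cons.IH[OF this, of "zs @ [?y]"] Cons.prems show ?case
    using sweep_1[of "y # ys" c y "length (pass q \<sigma> ?c ys)" q \<sigma> h X zs] by fastforce
qed

text \<open>The left end is recognised by the blank at \<open>-1\<close>; the extra step is the move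
  back from there to \<open>0\<close>.\<close>

lemma rewind:
  assumes "0 \<notin> set ys" "i \<le> length ys"
  shows "steps (Suc i) (Rewind q, tape_from h X, tape_from (int i - 1) (word_tape ys)) =
    (Read q, tape_from h X, tape_from 0 (word_tape ys))"
  using assms(2)
proof (induction i)
  case 0
  show ?case
    by (rule steps_Suc[where x = "X h" and d = 0 and y = 0 and e = 1 and s' = "Read q"])
      (auto simp: word_tape_blank fun_upd_idem)
next
  case (Suc i)
  then have "ys ! i \<noteq> 0" using assms(1) by (metis Suc_le_eq nth_mem)
  then show ?case
    by - (rule steps_Suc[where x = "X h" and d = 0 and y = "ys ! i" and e = "-1" and s' = "Rewind q"],
      use Suc in \<open>auto simp: word_tape_nth fun_upd_idem\<close>)
qed

lemma process_1:
  assumes q: "q \<in> Q" "\<sigma> \<in> {1..5}" and ys: "set ys \<subseteq> {1..<S}"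
  shows "steps (2 * length (pass q \<sigma> c\<^sub>0 ys) + 3)
     (Read q, tape_from (int (length u)) (word_tape (u @ [\<sigma>])), tape_from 0 (word_tape ys)) =
     (Read (next_control q \<sigma>), tape_from (int (length u) - 1) (word_tape u), tape_from 0 (word_tape (pass q \<sigma> c\<^sub>0 ys)))"
proof -
  let ?zs = "pass q \<sigma> c\<^sub>0 ys" and ?X = "tape_from (int (length u) - 1) (word_tape u)"
  have zs: "0 \<notin> set ?zs" using conjunct1[OF pass_symbols[OF q start(2) ys]] by auto
  have 1: "steps (Suc 0) (Read q, tape_from (int (length u)) (word_tape (u @ [\<sigma>])), tape_from 0 (word_tape ys)) =
     (Sweep q \<sigma> c\<^sub>0, ?X, tape_from 0 (word_tape ys))"
    by (rule steps_Suc[where x = 0 and d = "-1" and y = "word_tape ys 0" and e = 0 and s' = "Sweep q \<sigma> c\<^sub>0"])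
      (use q in \<open>auto simp: word_tape_append_length word_tape_erase_last\<close>)
  have 2: "steps (length ?zs) (Sweep q \<sigma> c\<^sub>0, ?X, tape_from 0 (word_tape ys)) =
     (Sweep q \<sigma> c\<^sub>0, ?X, tape_from (int (length ?zs)) (word_tape ?zs))"
    using sweep[OF q start(2) ys, of _ _ "[]"] by simp
  have 3: "steps (Suc (Suc (length ?zs))) (Sweep q \<sigma> c\<^sub>0, ?X, tape_from (int (length ?zs)) (word_tape ?zs)) =
     (Read (next_control q \<sigma>), ?X, tape_from 0 (word_tape ?zs))"
    by (rule steps_Suc[where x = "word_tape u (int (length u) - 1)" and d = 0 and y = 0 and e = "-1"
          and s' = "Rewind (next_control q \<sigma>)"])
      (use rewind[OF zs order_refl] in \<open>auto simp: word_tape_blank fun_upd_idem\<close>)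
  have "2 * length ?zs + 3 = Suc 0 + (length ?zs + Suc (Suc (length ?zs)))" by simp
  then show ?thesis using steps_trans[OF 1 steps_trans[OF 2 3]] by (simp only:)
qed

text \<open>Machine and \<open>foldr\<close> both consume the input from its right end, hence the
  reverse induction. A pass lengthens the word by at most the largest rank, a constant, so word
  lengths are linear and the total time is quadratic.\<close>

lemma process_all:
  assumes "q \<in> Q" "set u \<subseteq> {1..5}" "set ys \<subseteq> {1..<S}"
  shows "\<exists>q' zs t. foldr process u (q, ys) = (q', zs) \<and> q' \<in> Q \<and> set zs \<subseteq> {1..<S} \<and>
     length zs \<le> length ys + length u * Max (rank ` C) \<and>
     t \<le> length u * (2 * (length ys + length u * Max (rank ` C)) + 3) \<and>
     steps t (Read q, tape_from (int (length u) - 1) (word_tape u), tape_from 0 (word_tape ys)) =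
       (Read q', tape_from (-1) (word_tape []), tape_from 0 (word_tape zs))"
  using assms
proof (induction u arbitrary: q ys rule: rev_induct)
  case Nil
  then show ?case by (intro exI[of _ q] exI[of _ ys] exI[of _ 0]) simp
next
  case (snoc \<sigma> u)
  let ?R = "Max (rank ` C)" and ?ys = "pass q \<sigma> c\<^sub>0 ys"
  have \<sigma>: "\<sigma> \<in> {1..5}" and u: "set u \<subseteq> {1..5}" using snoc.prems by auto
  note p = conjunct1[OF pass_symbols[OF snoc.prems(1) \<sigma> start(2) snoc.prems(3)]]
    conjunct2[OF pass_symbols[OF snoc.prems(1) \<sigma> start(2) snoc.prems(3)]]
  obtain q' zs t where IH: "foldr process u (next_control q \<sigma>, ?ys) = (q', zs)" "q' \<in> Q" "set zs \<subseteq> {1..<S}"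
    "length zs \<le> length ?ys + length u * ?R" "t \<le> length u * (2 * (length ?ys + length u * ?R) + 3)"
    "steps t (Read (next_control q \<sigma>), tape_from (int (length u) - 1) (word_tape u), tape_from 0 (word_tape ?ys)) =
       (Read q', tape_from (-1) (word_tape []), tape_from 0 (word_tape zs))"
    using snoc.IH[OF next_control[OF snoc.prems(1) \<sigma>] u p(1)] by blast
  let ?L = "length ys + length (u @ [\<sigma>]) * ?R"
  have len: "length ?ys + length u * ?R \<le> ?L" using p(2) by simp
  have "2 * length ?ys + 3 \<le> 2 * ?L + 3" using len by simp
  moreover have "length u * (2 * (length ?ys + length u * ?R) + 3) \<le> length u * (2 * ?L + 3)"
    using len by (intro mult_left_mono) auto
  ultimately have "2 * length ?ys + 3 + t \<le> (2 * ?L + 3) + length u * (2 * ?L + 3)"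
    using IH(5) by linarith
  then have time: "2 * length ?ys + 3 + t \<le> length (u @ [\<sigma>]) * (2 * ?L + 3)" by simp
  have "steps (2 * length ?ys + 3 + t)
      (Read q, tape_from (int (length (u @ [\<sigma>])) - 1) (word_tape (u @ [\<sigma>])), tape_from 0 (word_tape ys)) =
       (Read q', tape_from (-1) (word_tape []), tape_from 0 (word_tape zs))"
    using steps_trans[OF process_1[OF snoc.prems(1) \<sigma> snoc.prems(3)] IH(6)] by simp
  moreover have "foldr process (u @ [\<sigma>]) (q, ys) = (q', zs)" using IH(1) by (simp add: process_def)
  moreover have "length zs \<le> ?L" using IH(4) len by simp
  ultimately show ?case using IH(2,3) time by blast
qed

lemma climb:
  assumes "0 \<notin> set ys"
  shows "steps (length ys) (Climb, tape_from h X, tape_from (int (length zs)) (word_tape (zs @ ys))) =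
    (Climb, tape_from h X, tape_from (int (length (zs @ ys))) (word_tape (zs @ ys)))"
  using assms
proof (induction ys arbitrary: zs)
  case (Cons y ys)
  show ?case unfolding list.size(4) add_Suc_right add_0_right
    by (rule steps_Suc[where x = "X h" and d = 0 and y = y and e = 1 and s' = Climb])
      (use Cons.IH[of "zs @ [y]"] Cons.prems in \<open>auto simp: word_tape_append_length word_tape_write add.commute\<close>)
qed simp

lemma fold:
  assumes "0 \<notin> set ys"
  shows "steps (length ys) (Fold d, tape_from h X, tape_from (int (length ys) - 1) (word_tape (ys @ zs))) =
    (Fold (foldr absorb ys d), tape_from h X, tape_from (-1) (word_tape (ys @ zs)))"
  using assms
proof (induction ys arbitrary: d zs rule: rev_induct)
  case (snoc y ys)
  have "length (ys @ [y]) = Suc (length ys)" by simp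
  then show ?case
    by (simp only:) (rule steps_Suc[where x = "X h" and d = 0 and y = y and e = "-1" and s' = "Fold (absorb y d)"],
      use snoc.IH[where zs = "y # zs"] snoc.prems in \<open>auto simp: word_tape_append_length fun_upd_idem\<close>)
qed simp

lemma encode_sign: "encode_int 1 = [2]" "encode_int (- 1) = [3, 2]"
proof -
  have "encode_nat 0 = []" by (subst encode_nat.simps) simp
  then have "encode_nat 1 = [2]" by (subst encode_nat.simps) simp
  then show "encode_int 1 = [2]" "encode_int (- 1) = [3, 2]" by (simp_all add: encode_int_def)
qed

lemma computes:
  assumes w: "set w \<subseteq> {1..5}"
  shows "\<exists>t t0 t1. t \<le> length w * (2 * (1 + length w * Max (rank ` C)) + 3) + 3 * length w + 2 * Max (rank ` C) * length w + 10 \<and>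
    steps t (Seek, word_tape w, \<lambda>_. 0) = (Halt, t0, t1) \<and>
    (let u = encode_int (if accept (outcome w) then 1 else -1) in
      0 \<notin> set u \<and> (\<forall>i\<le>length u. t0 (int i) = word_tape u (int i)))"
proof -
  let ?L = "length w" and ?R = "Max (rank ` C)"
  let ?w = "word_tape w" and ?e = "word_tape []"
  have e: "?e = (\<lambda>_. 0)" by (auto simp: word_tape_def)
  have nz: "0 \<notin> set w" using w by auto
  have 1: "steps ?L (Seek, ?w, \<lambda>_. 0) = (Seek, tape_from (int ?L) ?w, tape_from 0 ?e)"
    using seek[OF nz, of "[]" 0 ?e] by (simp add: tape_from_start e)
  have "?e(0 := i\<^sub>0) = word_tape [i\<^sub>0]" using word_tape_write[of "[]" "[]" "i\<^sub>0"] by simp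
  then have 2: "steps (Suc 0) (Seek, tape_from (int ?L) ?w, tape_from 0 ?e) =
      (Read q\<^sub>0, tape_from (int ?L - 1) ?w, tape_from 0 (word_tape [i\<^sub>0]))"
    by (intro steps_Suc[where x = 0 and d = "-1" and y = "i\<^sub>0" and e = 0 and s' = "Read q\<^sub>0"])
      (auto simp: word_tape_blank fun_upd_idem)
  obtain q' zs t where run: "foldr process w (q\<^sub>0, [i\<^sub>0]) = (q', zs)" "set zs \<subseteq> {1..<S}"
    "length zs \<le> 1 + ?L * ?R" "t \<le> ?L * (2 * (1 + ?L * ?R) + 3)"
    "steps t (Read q\<^sub>0, tape_from (int ?L - 1) ?w, tape_from 0 (word_tape [i\<^sub>0])) =
       (Read q', tape_from (-1) ?e, tape_from 0 (word_tape zs))"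
    using process_all[OF start(1) w, of "[i\<^sub>0]"] start by auto
  have zs: "0 \<notin> set zs" using run(2) by auto
  have 3: "steps (Suc (length zs)) (Read q', tape_from (-1) ?e, tape_from 0 (word_tape zs)) =
      (Climb, tape_from (-1) ?e, tape_from (int (length zs)) (word_tape zs))"
    by (rule steps_Suc[where x = 0 and d = 0 and y = "word_tape zs 0" and e = 0 and s' = Climb])
      (use climb[OF zs, of _ _ "[]"] in \<open>auto simp: word_tape_blank fun_upd_idem\<close>)
  let ?d = "foldr absorb zs d\<^sub>0"
  have 4: "steps (Suc (length zs)) (Climb, tape_from (-1) ?e, tape_from (int (length zs)) (word_tape zs)) =
      (Fold ?d, tape_from (-1) ?e, tape_from (-1) (word_tape zs))"
    by (rule steps_Suc[where x = 0 and d = 0 and y = 0 and e = "-1" and s' = "Fold d\<^sub>0"])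
      (use fold[OF zs, of _ _ _ "[]"] in \<open>auto simp: word_tape_blank fun_upd_idem\<close>)
  have d: "outcome w = ?d" by (simp add: outcome_def run(1))
  note upto = steps_trans[OF steps_trans[OF steps_trans[OF steps_trans[OF 1 2] run(5)] 3] 4]
  let ?t = "?L + Suc 0 + t + Suc (length zs) + Suc (length zs)"
  let ?T = "?L * (2 * (1 + ?L * ?R) + 3) + 3 * ?L + 2 * ?R * ?L + 10"
  have time: "?t + Suc 0 \<le> ?T" "?t + Suc (Suc 0) \<le> ?T"
    using run(3,4) by (simp_all add: algebra_simps)
  have fin: "\<exists>t t0 t1. t \<le> ?T \<and> steps t (Seek, ?w, \<lambda>_. 0) = (Halt, t0, t1) \<and>
      (let u = encode_int (if accept (outcome w) then 1 else -1) in
        0 \<notin> set u \<and> (\<forall>i\<le>length u. t0 (int i) = word_tape u (int i)))"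
    if "?t + k \<le> ?T" and "steps k (Fold ?d, tape_from (-1) ?e, tape_from (-1) (word_tape zs)) = (Halt, t0, tape_from (-1) (word_tape zs))"
      "u = encode_int (if accept ?d then 1 else -1)" "0 \<notin> set u" "\<forall>i\<le>length u. t0 (int i) = word_tape u (int i)"
    for k t0 u
    using that(1,3-) steps_trans[OF upto that(2)] unfolding d Let_def by blast
  show ?thesis
  proof (cases "accept ?d")
    case True
    show ?thesis
    proof (rule fin[OF time(1)])
      show "steps (Suc 0) (Fold ?d, tape_from (-1) ?e, tape_from (-1) (word_tape zs)) =
          (Halt, tape_from (-1) (?e(-1 := 2)), tape_from (-1) (word_tape zs))"
        by (rule steps_Suc[where x = 2 and d = 0 and y = 0 and e = 0 and s' = Halt])
          (use True in \<open>auto simp: word_tape_blank fun_upd_idem\<close>)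
    qed (use True in \<open>auto simp: encode_sign tape_from_def word_tape_def\<close>)
  next
    case False
    show ?thesis
    proof (rule fin[OF time(2)])
      have sign: "steps (Suc 0) (Sign, tape_from (-2) (?e(-1 := 2)), tape_from (-1) (word_tape zs)) =
          (Halt, tape_from (-2) (?e(-1 := 2, -2 := 3)), tape_from (-1) (word_tape zs))"
        by (rule steps_Suc[where x = 3 and d = 0 and y = 0 and e = 0 and s' = Halt])
          (auto simp: word_tape_blank fun_upd_idem)
      show "steps (Suc (Suc 0)) (Fold ?d, tape_from (-1) ?e, tape_from (-1) (word_tape zs)) =
          (Halt, tape_from (-2) (?e(-1 := 2, -2 := 3)), tape_from (-1) (word_tape zs))"
        by (rule steps_Suc[where x = 2 and d = "-1" and y = 0 and e = 0 and s' = Sign])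
          (use False sign in \<open>auto simp: word_tape_blank fun_upd_idem\<close>)
      show "\<forall>i\<le>length [3, 2]. tape_from (-2) (?e(-1 := 2, -2 := 3)) (int i) = word_tape [3, 2] (int i)"
        by (auto simp: tape_from_def word_tape_def nth_Cons split: nat.splits)
    qed (use False in \<open>auto simp: encode_sign\<close>)
  qed
qed

theorem poly_time_computable:
  assumes enc: "\<And>x. x \<in> D \<Longrightarrow> set (enc x) \<subseteq> {1..5}"
    and g: "\<And>x. x \<in> D \<Longrightarrow> g x = (if accept (outcome (enc x)) then 1 else -1)"
  shows "poly_time_computable D enc encode_int g"
proof -
  have "finite states" "Seek \<in> states" "Halt \<in> states" "Seek \<noteq> Halt" "S > 0"
    using finite start by (auto simp: states_def)
  from two_tape_machine[OF this closed]
  obtain M where M: "wf_turing_machine M" "num_symbols M = S"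
    "\<And>w t u t0 t1. \<lbrakk>set w \<subseteq> {..<S}; (two_tape_step \<delta> Halt ^^ t) (Seek, word_tape w, \<lambda>_. 0) = (Halt, t0, t1);
        0 \<notin> set u; \<forall>i\<le>length u. t0 (int i) = word_tape u (int i)\<rbrakk> \<Longrightarrow> tm_halts_with M w t u"
    by blast
  let ?R = "Max (rank ` C)"
  define p where "p = [:10, 8 + 2 * ?R, 2 * ?R:]"
  have p: "length w * (2 * (1 + length w * ?R) + 3) + 3 * length w + 2 * ?R * length w + 10 = poly p (length w)"
    for w :: "nat list"
    by (simp add: p_def algebra_simps)
  show ?thesis
    unfolding poly_time_computable_def
  proof (intro exI[of _ M] exI[of _ p] conjI ballI M(1))
    fix x assume x: "x \<in> D"
    show "set (enc x) \<subseteq> {1..<num_symbols M}" using enc[OF x] start by (force simp: M(2))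
    have w: "set (enc x) \<subseteq> {..<S}" using enc[OF x] start by force
    show "\<exists>t\<le>poly p (length (enc x)). tm_halts_with M (enc x) t (encode_int (g x))"
      using computes[OF enc[OF x]] M(3)[OF w] unfolding p g[OF x] Let_def by metis
  qed
qed

end

section \<open>Linear maps as transducers\<close>

definition mat_apply :: "'i set \<Rightarrow> ('i \<Rightarrow> 'i \<Rightarrow> int) \<Rightarrow> ('i \<Rightarrow> int) \<Rightarrow> 'i \<Rightarrow> int" where
  "mat_apply I M x = (\<lambda>i. if i \<in> I then \<Sum>j\<in>I. M i j * x j else 0)"

definition mat_step ::
    "'i set \<Rightarrow> ('q \<Rightarrow> nat \<Rightarrow> 'q) \<Rightarrow> ('q \<Rightarrow> nat \<Rightarrow> 'i \<Rightarrow> 'i \<Rightarrow> int) \<Rightarrow> nat \<Rightarrow> 'q \<times> ('i \<Rightarrow> int) \<Rightarrow> 'q \<times> ('i \<Rightarrow> int)" where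
  "mat_step I nxt M \<sigma> = (\<lambda>(q, z). (nxt q \<sigma>, mat_apply I (M q \<sigma>) z))"

lemma mat_step_Pair: "mat_step I nxt M \<sigma> (q, z) = (nxt q \<sigma>, mat_apply I (M q \<sigma>) z)"
  by (simp add: mat_step_def)

text \<open>Rounding towards zero makes the carries of negative numbers vanish in the end as well.\<close>

definition quot :: "int \<Rightarrow> int \<Rightarrow> int" where
  "quot B t = sgn t * (\<bar>t\<bar> div B)"

lemma abs_quot: "\<bar>quot B t\<bar> = \<bar>t\<bar> div B" if "B > 0"
  using that by (cases "t = 0") (auto simp: quot_def abs_mult pos_imp_zdiv_nonneg_iff)

lemma abs_diff_quot: "\<bar>t - B * quot B t\<bar> \<le> B - 1" if "B > 0"
proof -
  have "t - B * quot B t = sgn t * (\<bar>t\<bar> mod B)"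
    by (simp add: quot_def minus_div_mult_eq_mod[symmetric] algebra_simps abs_mult_sgn)
  then have "\<bar>t - B * quot B t\<bar> \<le> \<bar>t\<bar> mod B" using that by (simp add: abs_mult abs_sgn_eq)
  then show ?thesis using pos_mod_bound[OF that, of "\<bar>t\<bar>"] by linarith
qed

text \<open>Multiplying a vector in base \<open>B\<close> by a fixed matrix needs only a bounded
  carry, so each pass is a finite transducer. The last hypothesis quantifies over all expansions
  \<open>xs\<close> since the machine produces some expansion in signed digits, not a canonical
  one.\<close>

lemma matrix_process_poly_time:
  fixes I :: "'i set" and M :: "'q \<Rightarrow> nat \<Rightarrow> 'i \<Rightarrow> 'i \<Rightarrow> int" and absorb :: "('i \<Rightarrow> int) \<Rightarrow> 'd \<Rightarrow> 'd"
  assumes I: "finite I" and B: "B \<ge> 2" and Q: "finite Q" "q0 \<in> Q"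
    and next_control: "\<And>q \<sigma>. \<lbrakk>q \<in> Q; \<sigma> \<in> {1..5}\<rbrakk> \<Longrightarrow> next_control q \<sigma> \<in> Q"
    and W: "finite W" "d0 \<in> W" "\<And>x d. \<lbrakk>x \<in> bounded_vectors I (B - 1); d \<in> W\<rbrakk> \<Longrightarrow> absorb x d \<in> W"
    and x0: "x0 \<in> bounded_vectors I (B - 1)"
    and enc: "\<And>x. x \<in> D \<Longrightarrow> set (enc x) \<subseteq> {1..5}"
    and g: "\<And>x xs. \<lbrakk>x \<in> D; set xs \<subseteq> bounded_vectors I (B - 1);
        digits_value B xs = snd (foldr (mat_step I next_control M) (enc x) (q0, x0))\<rbrakk>
        \<Longrightarrow> g x = (if accept (foldr absorb xs d0) then 1 else -1)"
  shows "poly_time_computable D enc encode_int g"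
proof -
  let ?X = "bounded_vectors I (B - 1)"
  \<comment> \<open>A common bound for the absolute row sums of the finitely many matrices in
    use.\<close>
  define K where "K = (\<Sum>q\<in>Q. \<Sum>\<sigma>\<in>{1..5}. \<Sum>i\<in>I. \<Sum>j\<in>I. \<bar>M q \<sigma> i j\<bar>)"
  let ?C = "bounded_vectors I K"
  have K0: "K \<ge> 0" by (auto simp: K_def intro!: sum_nonneg)
  have K: "(\<Sum>j\<in>I. \<bar>M q \<sigma> i j\<bar>) \<le> K" if "q \<in> Q" "\<sigma> \<in> {1..5}" "i \<in> I" for q \<sigma> i
  proof -
    have "(\<Sum>j\<in>I. \<bar>M q \<sigma> i j\<bar>) \<le> (\<Sum>i\<in>I. \<Sum>j\<in>I. \<bar>M q \<sigma> i j\<bar>)"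
      using that I by (intro member_le_sum[of i _ "\<lambda>i. \<Sum>j\<in>I. \<bar>M q \<sigma> i j\<bar>"]) (auto intro: sum_nonneg)
    also have "\<dots> \<le> (\<Sum>\<sigma>\<in>{1..5}. \<Sum>i\<in>I. \<Sum>j\<in>I. \<bar>M q \<sigma> i j\<bar>)"
      using that by (intro member_le_sum[of \<sigma> _ "\<lambda>\<sigma>. \<Sum>i\<in>I. \<Sum>j\<in>I. \<bar>M q \<sigma> i j\<bar>"]) (auto intro!: sum_nonneg)
    also have "\<dots> \<le> K"
      unfolding K_def using that Q
      by (intro member_le_sum[of q _ "\<lambda>q. \<Sum>\<sigma>\<in>{1..5}. \<Sum>i\<in>I. \<Sum>j\<in>I. \<bar>M q \<sigma> i j\<bar>"]) (auto intro!: sum_nonneg)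
    finally show ?thesis .
  qed
  have zero: "(\<lambda>_. 0) \<in> ?X" using B by (intro zero_bounded_vectors) simp
  have finX: "finite ?X" using I by (rule finite_bounded_vectors)
  have "card ?X = card {1..card ?X}" by simp
  then obtain code where code: "bij_betw code ?X {1..card ?X}"
    using finite_same_card_bij[OF finX] by blast
  \<comment> \<open>The blank decodes to the zero vector and so acts as a leading zero beyond the
    end of the word. The zero vector also has a nonblank code, so that inner zeros are not mistaken
    for the end.\<close>
  define dec where "dec y = (if y \<in> {1..card ?X} then inv_into ?X code y else (\<lambda>_. 0))" for y
  have dec: "dec y \<in> ?X" for y
    using code zero by (auto simp: dec_def bij_betw_def inv_into_into)
  have dec_0: "dec 0 = (\<lambda>_. 0)" by (simp add: dec_def)
  have code_in: "code x \<in> {1..card ?X}" if "x \<in> ?X" for x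
    using code that by (auto simp: bij_betw_def)
  have dec_code: "dec (code x) = x" if "x \<in> ?X" for x
    using code that code_in[OF that] by (simp add: dec_def bij_betw_def)
  define S where "S = max 6 (card ?X + 1)"
  define total where "total q \<sigma> c x = (\<lambda>i. mat_apply I (M q \<sigma>) x i + c i)"
    for q \<sigma> and c x :: "'i \<Rightarrow> int"
  define carry where "carry q \<sigma> c x = (\<lambda>i. quot B (total q \<sigma> c x i))" for q \<sigma> c x
  define digit where "digit q \<sigma> c x = (\<lambda>i. total q \<sigma> c x i - B * carry q \<sigma> c x i)" for q \<sigma> c x
  define rank where "rank c = nat (\<Sum>i\<in>I. \<bar>c i\<bar>)" for c :: "'i \<Rightarrow> int"
  define transduce where "transduce q \<sigma> c y = (code (digit q \<sigma> c (dec y)), carry q \<sigma> c (dec y))" for q \<sigma> c y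
  have outside: "total q \<sigma> c x i = 0" if "i \<notin> I" "c \<in> ?C" for q \<sigma> c x i
    using that by (simp add: total_def mat_apply_def bounded_vectors_def)
  have digit: "digit q \<sigma> c x \<in> ?X" if "c \<in> ?C" for q \<sigma> c x
    using that B abs_diff_quot[of B] by (auto simp: bounded_vectors_def digit_def carry_def outside quot_def)
  have carry: "carry q \<sigma> c x \<in> ?C" if asm: "q \<in> Q" "\<sigma> \<in> {1..5}" "c \<in> ?C" "x \<in> ?X" for q \<sigma> c x
  proof -
    have "\<bar>carry q \<sigma> c x i\<bar> \<le> K" if i: "i \<in> I" for i
    proof -
      have "\<bar>\<Sum>j\<in>I. M q \<sigma> i j * x j\<bar> \<le> (\<Sum>j\<in>I. \<bar>M q \<sigma> i j\<bar> * (B - 1))"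
      proof (rule order_trans[OF sum_abs sum_mono])
        fix j assume "j \<in> I"
        then show "\<bar>M q \<sigma> i j * x j\<bar> \<le> \<bar>M q \<sigma> i j\<bar> * (B - 1)"
          unfolding abs_mult using \<open>x \<in> ?X\<close> by (intro mult_left_mono) (auto simp: bounded_vectors_def)
      qed
      also have "\<dots> \<le> K * (B - 1)"
        unfolding sum_distrib_right[symmetric] using K[OF asm(1,2) i] B
        by (intro mult_right_mono) (use \<open>q \<in> Q\<close> \<open>\<sigma> \<in> {1..5}\<close> K i in auto)
      \<comment> \<open>The bound equals \<open>K * B\<close>, so division by \<open>B\<close>
        brings the new carry back below \<open>K\<close>: the set of carries is closed.\<close>
      finally have "\<bar>total q \<sigma> c x i\<bar> \<le> K * (B - 1) + K"
        using \<open>c \<in> ?C\<close> i abs_triangle_ineq[of "\<Sum>j\<in>I. M q \<sigma> i j * x j" "c i"]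
        by (force simp: total_def mat_apply_def bounded_vectors_def)
      then have "\<bar>total q \<sigma> c x i\<bar> div B \<le> (K * B) div B"
        using B by (intro zdiv_mono1) (auto simp: algebra_simps)
      then show ?thesis using B by (simp add: carry_def abs_quot)
    qed
    then show ?thesis using outside[OF _ asm(3)] by (simp add: bounded_vectors_def carry_def quot_def)
  qed
  have mat_zero: "mat_apply I A (\<lambda>_. 0) = (\<lambda>_. 0)" for A by (auto simp: mat_apply_def)
  have rank_less: "rank (carry q \<sigma> c (\<lambda>_. 0)) < rank c" if c: "c \<in> ?C" "c \<noteq> (\<lambda>_. 0)" for q \<sigma> c
  proof -
    obtain i where i: "c i \<noteq> 0" using c by auto
    then have "i \<in> I" using c by (auto simp: bounded_vectors_def)
    have eq: "\<bar>carry q \<sigma> c (\<lambda>_. 0) j\<bar> = \<bar>c j\<bar> div B" for j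
      using B by (simp add: carry_def total_def mat_zero abs_quot)
    have "(\<Sum>j\<in>I. \<bar>c j\<bar> div B) < (\<Sum>j\<in>I. \<bar>c j\<bar>)"
    proof (rule sum_strict_mono_ex1[OF I])
      have "\<bar>c j\<bar> div B \<le> \<bar>c j\<bar>" for j
        using B int_div_less_self[of "\<bar>c j\<bar>" B] by (cases "c j = 0") auto
      then show "\<forall>j\<in>I. \<bar>c j\<bar> div B \<le> \<bar>c j\<bar>" by blast
      show "\<exists>j\<in>I. \<bar>c j\<bar> div B < \<bar>c j\<bar>"
        using \<open>i \<in> I\<close> i B by (intro bexI[of _ i] int_div_less_self) auto
    qed
    moreover have "(\<Sum>j\<in>I. \<bar>c j\<bar> div B) \<ge> 0" using B by (intro sum_nonneg) (simp add: pos_imp_zdiv_nonneg_iff)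
    ultimately show ?thesis by (simp add: rank_def eq)
  qed
  interpret iterated_transducer S Q ?C W q0 "\<lambda>_. 0" d0 "code x0" next_control transduce rank
    "\<lambda>y. absorb (dec y)" accept
  proof
    show "transduce q \<sigma> c y \<in> {1..<S} \<times> ?C" if "q \<in> Q" "\<sigma> \<in> {1..5}" "c \<in> ?C" "y < S" for q \<sigma> c y
      using code_in[OF digit[OF that(3)], of q \<sigma> "dec y"] carry[OF that(1,2,3) dec]
      by (auto simp: transduce_def S_def)
    show "rank (snd (transduce q \<sigma> c 0)) < rank c" if "q \<in> Q" "\<sigma> \<in> {1..5}" "c \<in> ?C" "c \<noteq> (\<lambda>_. 0)" for q \<sigma> c
      using rank_less[OF that(3,4)] by (simp add: transduce_def dec_0)
    show "absorb (dec y) d \<in> W" if "y \<in> {1..<S}" "d \<in> W" for y d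
      using W(3)[OF dec that(2)] .
    show "finite ?C" using I by (rule finite_bounded_vectors)
    show "(\<lambda>_. 0) \<in> ?C" using K0 by (rule zero_bounded_vectors)
    show "0 < code x0" "code x0 < S" using code_in[OF x0] by (auto simp: S_def)
  qed (use Q W next_control in \<open>auto simp: S_def\<close>)
  have tr: "fst (transduce q \<sigma> c y) = code (digit q \<sigma> c (dec y))" "snd (transduce q \<sigma> c y) = carry q \<sigma> c (dec y)"
    for q \<sigma> c y by (simp_all add: transduce_def)
  let ?val = "\<lambda>ys. digits_value B (map dec ys)"
  have flush: "?val (flush q \<sigma> k c) i = c i" if "q \<in> Q" "\<sigma> \<in> {1..5}" "c \<in> ?C" "rank c \<le> k" for q \<sigma> k c i
    using that(3,4)
  proof (induction k arbitrary: c)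
    case 0
    then have "c = (\<lambda>_. 0)" using rank_less[OF 0(1)] by fastforce
    then show ?case by simp
  next
    case (Suc k)
    show ?case
    proof (cases "c = (\<lambda>_. 0)")
      case False
      let ?c = "carry q \<sigma> c (\<lambda>_. 0)"
      have "?val (flush q \<sigma> k ?c) i = ?c i"
        using carry[OF that(1,2) Suc.prems(1) zero] rank_less[OF Suc.prems(1) False, of q \<sigma>] Suc.prems(2)
        by (intro Suc.IH) auto
      then show ?thesis
        using False by (simp add: tr dec_0 dec_code digit[OF Suc.prems(1)])
          (simp add: digit_def total_def mat_zero)
    qed simp
  qed
  \<comment> \<open>Stated for an arbitrary incoming carry, as the induction over the digits
    requires; a pass starts with carry zero.\<close>
  have pass: "?val (pass q \<sigma> c ys) i = mat_apply I (M q \<sigma>) (?val ys) i + c i"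
    if "q \<in> Q" "\<sigma> \<in> {1..5}" "c \<in> ?C" for q \<sigma> c ys i
    using that(3)
  proof (induction ys arbitrary: c)
    case Nil
    then show ?case using flush[OF that(1,2) Nil order_refl] by (simp add: mat_zero)
  next
    case (Cons y ys)
    let ?c = "carry q \<sigma> c (dec y)"
    have "?val (pass q \<sigma> c (y # ys)) i = digit q \<sigma> c (dec y) i + B * (mat_apply I (M q \<sigma>) (?val ys) i + ?c i)"
      using Cons.IH[OF carry[OF that(1,2) Cons.prems dec]]
      by (simp add: tr dec_code digit[OF Cons.prems])
    also have "\<dots> = mat_apply I (M q \<sigma>) (dec y) i + B * mat_apply I (M q \<sigma>) (?val ys) i + c i"
      by (simp add: digit_def total_def algebra_simps)
    also have "mat_apply I (M q \<sigma>) (dec y) i + B * mat_apply I (M q \<sigma>) (?val ys) i =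
        mat_apply I (M q \<sigma>) (?val (y # ys)) i"
      by (simp add: mat_apply_def algebra_simps sum.distrib sum_distrib_left)
    finally show ?case .
  qed
  have run: "\<exists>q ys. foldr process w (q0, [code x0]) = (q, ys) \<and> q \<in> Q \<and>
      foldr (mat_step I next_control M) w (q0, x0) = (q, ?val ys)"
    if "set w \<subseteq> {1..5}" for w
    using that
  proof (induction w)
    case Nil
    then show ?case using Q dec_code[OF x0] by simp
  next
    case (Cons \<sigma> w)
    then obtain q ys where q: "foldr process w (q0, [code x0]) = (q, ys)" "q \<in> Q"
      "foldr (mat_step I next_control M) w (q0, x0) = (q, ?val ys)" by auto
    have "?val (pass q \<sigma> (\<lambda>_. 0) ys) = mat_apply I (M q \<sigma>) (?val ys)"
      using pass[OF q(2) _ zero_bounded_vectors[OF K0]] Cons.prems by auto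
    moreover have "process \<sigma> (q, ys) = (next_control q \<sigma>, pass q \<sigma> (\<lambda>_. 0) ys)" by (simp add: process_def)
    ultimately show ?case using q Cons.prems next_control[OF q(2), of \<sigma>] by (simp add: mat_step_Pair)
  qed
  show ?thesis
  proof (rule poly_time_computable[OF enc])
    fix x assume x: "x \<in> D"
    obtain q ys where ys: "foldr process (enc x) (q0, [code x0]) = (q, ys)"
      "foldr (mat_step I next_control M) (enc x) (q0, x0) = (q, ?val ys)"
      using run[OF enc[OF x]] by blast
    have "g x = (if accept (foldr absorb (map dec ys) d0) then 1 else -1)"
      using dec by (intro g[OF x]) (auto simp: ys)
    then show "g x = (if accept (outcome (enc x)) then 1 else -1)"
      by (simp add: outcome_def ys foldr_map comp_def)
  qed
qed

section \<open>Reading the input\<close>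

lemma less_power_length_encode_nat: "N < 2 ^ length (encode_nat N)"
proof (induction N rule: encode_nat.induct)
  case (1 N)
  show ?case
  proof (cases "N = 0")
    case False
    then have "N div 2 < 2 ^ length (encode_nat (N div 2))" using 1 by simp
    then have "N < 2 * 2 ^ length (encode_nat (N div 2))" by linarith
    then show ?thesis using False by (subst encode_nat.simps) simp
  qed simp
qed

lemma set_encode_nat: "set (encode_nat N) \<subseteq> {1..5}"
proof (induction N rule: encode_nat.induct)
  case (1 N)
  then show ?case by (cases "N = 0"; subst encode_nat.simps) auto
qed

lemma set_encode_rat: "set (encode_rat r) \<subseteq> {1..5}"
  using set_encode_nat by (auto simp: encode_rat_def encode_int_def split: prod.splits)

lemma set_encode_pair: "set (encode_pair m \<theta> x) \<subseteq> {1..5}"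
  using set_encode_rat by (fastforce simp: encode_pair_def encode_element_def split: prod.splits)

lemma abs_int_le_power_length: "\<bar>z\<bar> \<le> 2 ^ length (encode_int z)"
proof -
  have "nat \<bar>z\<bar> < 2 ^ length (encode_nat (nat \<bar>z\<bar>))" by (rule less_power_length_encode_nat)
  also have "\<dots> \<le> 2 ^ length (encode_int z)" by (intro power_increasing) (auto simp: encode_int_def)
  finally show ?thesis by (simp add: nat_less_iff)
qed

lemma encode_rat_bounds:
  assumes "quotient_of r = (i, d)"
  shows "\<bar>i\<bar> \<le> 2 ^ length (encode_rat r)" "\<bar>d\<bar> \<le> 2 ^ length (encode_rat r)"
proof -
  have "(2::int) ^ length (encode_int z) \<le> 2 ^ length (encode_rat r)" if "z = i \<or> z = d" for z
    using that assms by (intro power_increasing) (auto simp: encode_rat_def)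
  then show "\<bar>i\<bar> \<le> 2 ^ length (encode_rat r)" "\<bar>d\<bar> \<le> 2 ^ length (encode_rat r)"
    using abs_int_le_power_length order_trans by blast+
qed

text \<open>\<open>Fst / AccDen\<close> and \<open>Snd / AccDen\<close> are the numbers read so far.  While a denominator is being
  read, the registers \<open>Acc\<dots>\<close> hold the product of its leading binary digits with \<open>Fst\<close>, \<open>Snd\<close>,
  \<open>Den\<close>; while a numerator is being read, \<open>Num\<close> does this for the previous common denominator
  \<open>Den\<close>.  The control consists of the index of the current fraction and of a flag for numerators.\<close>

datatype reg = Fst | Snd | Den | AccFst | AccSnd | AccDen | Num

lemma finite_reg: "finite (UNIV :: reg set)"
proof -
  have "UNIV = {Fst, Snd, Den, AccFst, AccSnd, AccDen, Num}" by (auto intro: reg.exhaust)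
  then show ?thesis by (metis finite.emptyI finite_insert)
qed

text \<open>From right to left a fraction begins with its end mark \<open>5\<close>, so the index
  drops there, starting from \<open>2 * n\<close>, and the denominator precedes the
  numerator.\<close>

definition next_control :: "nat \<times> bool \<Rightarrow> nat \<Rightarrow> nat \<times> bool" where
  "next_control q \<sigma> = (if \<sigma> = 5 then (fst q - 1, False) else if \<sigma> = 4 then (fst q, True) else q)"

section \<open>Evaluating the input in field-valued registers\<close>

context number_field_val
begin

definition target :: "nat \<Rightarrow> reg" where "target k = (if k < n then Fst else Snd)"

text \<open>Horner's rule, as the digits arrive most significant first; the bit is
  \<open>\<sigma> - 1\<close>. Going from \<open>Num\<close> to \<open>2 * Num + bit * Den\<close>
  adds \<open>Num + bit * Den\<close>, and the target receives the same increment times its power of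
  \<theta>. A minus sign arrives after its digits, hence the twofold subtraction. Every update is
  linear in the registers, which lets scalar factors pass through.\<close>

definition upd :: "nat \<times> bool \<Rightarrow> nat \<Rightarrow> (reg \<Rightarrow> 'f) \<Rightarrow> reg \<Rightarrow> 'f" where
  "upd q \<sigma> R =
     (if \<sigma> = 5 then R(Den := R AccDen, AccFst := 0, AccSnd := 0, AccDen := 0, Num := 0)
      else if \<sigma> = 4 then R(Fst := R AccFst, Snd := R AccSnd)
      else if \<sigma> = 3 then R(target (fst q) := R (target (fst q)) - 2 * \<theta> ^ (fst q mod n) * R Num)
      else if snd q then R(Num := 2 * R Num + of_nat (\<sigma> - 1) * R Den,
        target (fst q) := R (target (fst q)) + \<theta> ^ (fst q mod n) * (R Num + of_nat (\<sigma> - 1) * R Den))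
      else R(AccFst := 2 * R AccFst + of_nat (\<sigma> - 1) * R Fst,
        AccSnd := 2 * R AccSnd + of_nat (\<sigma> - 1) * R Snd, AccDen := 2 * R AccDen + of_nat (\<sigma> - 1) * R Den))"

lemma upd_add: "upd q \<sigma> (\<lambda>\<rho>. R \<rho> + R' \<rho>) = (\<lambda>\<rho>. upd q \<sigma> R \<rho> + upd q \<sigma> R' \<rho>)"
  and upd_cmult: "upd q \<sigma> (\<lambda>\<rho>. c * R \<rho>) = (\<lambda>\<rho>. c * upd q \<sigma> R \<rho>)"
  and upd_0: "upd q \<sigma> (\<lambda>\<rho>. 0) = (\<lambda>\<rho>. 0)"
  by (auto simp: upd_def fun_eq_iff algebra_simps)

lemma upd_sum: "upd q \<sigma> (\<lambda>\<rho>. \<Sum>i\<in>A. c i * u i \<rho>) = (\<lambda>\<rho>. \<Sum>i\<in>A. c i * upd q \<sigma> (u i) \<rho>)"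
proof (induction A rule: infinite_finite_induct)
  case (insert i A)
  then show ?case by (simp add: upd_add upd_cmult)
qed (simp_all add: upd_0)

definition reg_step :: "nat \<Rightarrow> (nat \<times> bool) \<times> (reg \<Rightarrow> 'f) \<Rightarrow> (nat \<times> bool) \<times> (reg \<Rightarrow> 'f)" where
  "reg_step \<sigma> = (\<lambda>(q, R). (next_control q \<sigma>, upd q \<sigma> R))"

lemma target_neq [simp]: "target k \<noteq> Num" "target k \<noteq> Den" "target k \<noteq> AccDen" "Num \<noteq> target k" "Den \<noteq> target k"
  by (auto simp: target_def)

lemma encode_nat_Cons:
  "N > 0 \<Longrightarrow> encode_nat N = (N mod 2 + 1) # encode_nat (N div 2)"
  by (subst encode_nat.simps) (auto simp: mod2_eq_if)

lemma encode_nat_0: "encode_nat 0 = []"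
  by (subst encode_nat.simps) simp

lemma of_nat_binary: "(of_nat N :: 'f) = 2 * of_nat (N div 2) + of_nat (N mod 2)"
proof -
  have "(of_nat (2 * (N div 2) + N mod 2) :: 'f) = 2 * of_nat (N div 2) + of_nat (N mod 2)"
    by (simp only: of_nat_add of_nat_mult of_nat_numeral)
  then show ?thesis by simp
qed

lemma read_denominator:
  assumes "R AccFst = 0" "R AccSnd = 0" "R AccDen = 0"
  shows "foldr reg_step (encode_nat N) ((k, False), R) =
    ((k, False), R(AccFst := of_nat N * R Fst, AccSnd := of_nat N * R Snd, AccDen := of_nat N * R Den))"
proof (induction N rule: less_induct)
  case (less N)
  show ?case
  proof (cases "N = 0")
    case True
    then show ?thesis using assms by (simp add: encode_nat_0 fun_eq_iff)
  next
    case False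
    have s: "N mod 2 + 1 \<noteq> 5" "N mod 2 + 1 \<noteq> 4" "N mod 2 + 1 \<noteq> 3" by linarith+
    have IH: "foldr reg_step (encode_nat (N div 2)) ((k, False), R) = ((k, False),
        R(AccFst := of_nat (N div 2) * R Fst, AccSnd := of_nat (N div 2) * R Snd, AccDen := of_nat (N div 2) * R Den))"
      using False by (intro less.IH) simp
    show ?thesis
      unfolding encode_nat_Cons[OF False[folded neq0_conv[symmetric], unfolded neq0_conv]] foldr_Cons comp_def IH
      using s by (simp add: reg_step_def next_control_def upd_def fun_eq_iff del: One_nat_def)
        (simp add: of_nat_binary[of N] algebra_simps)
  qed
qed

lemma read_numerator:
  assumes "R Num = 0"
  shows "foldr reg_step (encode_nat N) ((k, True), R) =
    ((k, True), R(Num := of_nat N * R Den, target k := R (target k) + \<theta> ^ (k mod n) * (of_nat N * R Den)))"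
proof (induction N rule: less_induct)
  case (less N)
  show ?case
  proof (cases "N = 0")
    case True
    then show ?thesis using assms by (simp add: encode_nat_0 fun_eq_iff)
  next
    case False
    then have N: "N > 0" by simp
    have s: "N mod 2 + 1 \<noteq> 5" "N mod 2 + 1 \<noteq> 4" "N mod 2 + 1 \<noteq> 3" by linarith+
    have IH: "foldr reg_step (encode_nat (N div 2)) ((k, True), R) = ((k, True),
        R(Num := of_nat (N div 2) * R Den, target k := R (target k) + \<theta> ^ (k mod n) * (of_nat (N div 2) * R Den)))"
      using False by (intro less.IH) simp
    show ?thesis
      unfolding encode_nat_Cons[OF N] foldr_Cons comp_def IH
      using s by (simp add: reg_step_def next_control_def upd_def fun_eq_iff del: One_nat_def)
        (simp add: of_nat_binary[of N] algebra_simps)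
  qed
qed

lemma read_rat:
  assumes c: "quotient_of c = (i, d)"
  shows "\<exists>R'. foldr reg_step (encode_rat c) ((Suc k, ph), R) = ((k, True), R') \<and>
    R' AccDen = of_int d * R AccDen \<and>
    R' Fst = of_int d * R Fst + (if k < n then \<theta> ^ (k mod n) * (of_int i * R AccDen) else 0) \<and>
    R' Snd = of_int d * R Snd + (if k < n then 0 else \<theta> ^ (k mod n) * (of_int i * R AccDen))"
proof -
  have d: "d > 0" using c by (rule quotient_of_denom_pos)
  define R1 where "R1 = R(Den := R AccDen, AccFst := 0, AccSnd := 0, AccDen := 0, Num := 0)"
  define R2 where "R2 = R1(AccFst := of_int d * R1 Fst, AccSnd := of_int d * R1 Snd, AccDen := of_int d * R1 Den)"
  define R3 where "R3 = R2(Fst := R2 AccFst, Snd := R2 AccSnd)"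
  define R4 where "R4 = R3(Num := of_int \<bar>i\<bar> * R3 Den, target k := R3 (target k) + \<theta> ^ (k mod n) * (of_int \<bar>i\<bar> * R3 Den))"
  have 1: "reg_step 5 ((Suc k, ph), R) = ((k, False), R1)"
    by (simp add: reg_step_def next_control_def upd_def R1_def)
  have 2: "foldr reg_step (encode_int d) ((k, False), R1) = ((k, False), R2)"
    using d read_denominator[of R1 "nat d" k] by (simp add: encode_int_def R1_def R2_def)
  have 3: "reg_step 4 ((k, False), R2) = ((k, True), R3)"
    by (simp add: reg_step_def next_control_def upd_def R3_def)
  have 4: "foldr reg_step (encode_nat (nat \<bar>i\<bar>)) ((k, True), R3) = ((k, True), R4)"
    using read_numerator[of R3 "nat \<bar>i\<bar>" k] by (simp add: R1_def R2_def R3_def R4_def)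
  define R5 where "R5 = (if i < 0 then R4(target k := R4 (target k) - 2 * \<theta> ^ (k mod n) * R4 Num) else R4)"
  have 5: "foldr reg_step (encode_int i) ((k, True), R3) = ((k, True), R5)"
    using 4 by (simp add: encode_int_def R5_def reg_step_def next_control_def upd_def)
  have run: "foldr reg_step (encode_rat c) ((Suc k, ph), R) = ((k, True), R5)"
    by (simp add: encode_rat_def c 1 2 3 5)
  show ?thesis
    by (rule exI[of _ R5], intro conjI run)
      (auto simp: R1_def R2_def R3_def R4_def R5_def target_def algebra_simps)
qed

text \<open>\<open>d\<close> accumulates the denominators. Only \<open>d \<noteq> 0\<close> matters,
  because \<open>Fst\<close> and \<open>Snd\<close> are used relative to \<open>AccDen\<close>. The
  last fraction is read first, so the control index agrees with the list index.\<close>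

lemma read_rats:
  "\<exists>R' d. foldr reg_step (concat (map encode_rat cs)) ((length cs, ph), R) = ((0, ph \<or> cs \<noteq> []), R') \<and> d \<noteq> (0::int) \<and>
    R' AccDen = of_int d * R AccDen \<and>
    R' Fst = of_int d * (R Fst + R AccDen * (\<Sum>k<length cs. if k < n then of_rat (cs ! k) * \<theta> ^ (k mod n) else 0)) \<and>
    R' Snd = of_int d * (R Snd + R AccDen * (\<Sum>k<length cs. if k < n then 0 else of_rat (cs ! k) * \<theta> ^ (k mod n)))"
proof (induction cs arbitrary: ph R rule: rev_induct)
  case Nil
  then show ?case by (intro exI[of _ R] exI[of _ 1]) simp
next
  case (snoc c cs)
  obtain i d where c: "quotient_of c = (i, d)" by (cases "quotient_of c")
  then have d: "d > 0" "c = of_int i / of_int d" using quotient_of_denom_pos quotient_of_div by blast+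
  then have i: "(of_int i :: 'f) = of_int d * of_rat c" by (simp add: of_rat_divide)
  obtain R1 where R1: "foldr reg_step (encode_rat c) ((Suc (length cs), ph), R) = ((length cs, True), R1)"
    "R1 AccDen = of_int d * R AccDen"
    "R1 Fst = of_int d * R Fst + (if length cs < n then \<theta> ^ (length cs mod n) * (of_int i * R AccDen) else 0)"
    "R1 Snd = of_int d * R Snd + (if length cs < n then 0 else \<theta> ^ (length cs mod n) * (of_int i * R AccDen))"
    using read_rat[OF c] by blast
  obtain R' e where R': "foldr reg_step (concat (map encode_rat cs)) ((length cs, True), R1) = ((0, True), R')" "e \<noteq> (0::int)"
    "R' AccDen = of_int e * R1 AccDen"
    "R' Fst = of_int e * (R1 Fst + R1 AccDen * (\<Sum>k<length cs. if k < n then of_rat (cs ! k) * \<theta> ^ (k mod n) else 0))"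
    "R' Snd = of_int e * (R1 Snd + R1 AccDen * (\<Sum>k<length cs. if k < n then 0 else of_rat (cs ! k) * \<theta> ^ (k mod n)))"
    using snoc.IH[of True R1] by auto
  have s: "(\<Sum>k<length cs. if k < n then f k ((cs @ [c]) ! k) else 0) = (\<Sum>k<length cs. if k < n then f k (cs ! k) else 0)"
    "(\<Sum>k<length cs. if k < n then 0 else f k ((cs @ [c]) ! k)) = (\<Sum>k<length cs. if k < n then 0 else f k (cs ! k))"
    for f :: "nat \<Rightarrow> rat \<Rightarrow> 'f"
    by (auto intro!: sum.cong simp: nth_append)
  show ?case
    by (intro exI[of _ R'] exI[of _ "e * d"])
      (use R1(1) R'(1,2) d in \<open>simp add: R1(2-4) R'(3-5) i s[of "\<lambda>k x. of_rat x * \<theta> ^ (k mod n)"] algebra_simps\<close>)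
qed

lemma coordinates:
  "length (coordinates m \<theta> x) = n" "x = (\<Sum>k<n. of_rat (coordinates m \<theta> x ! k) * \<theta> ^ k)"
proof -
  let ?P = "\<lambda>cs. length cs = n \<and> x = (\<Sum>k<n. of_rat (cs ! k) * \<theta> ^ k)"
  have "?P (coordinates m \<theta> x)"
    unfolding coordinates_def
  proof (rule theI)
    show "?P (map (coeff (crd x)) [0..<n])"
      using ev_altdef[OF degree_crd[of x]] by simp
    fix cs assume cs: "?P cs"
    define q where "q = (\<Sum>k<n. monom (cs ! k) k)"
    have c: "coeff q k = (if k < n then cs ! k else 0)" for k
      by (simp add: q_def coeff_sum if_distrib cong: if_cong)
    have deg: "degree q < n" using n_pos by (intro degree_lessI) (auto simp: c)
    then have "ev q = x" using cs by (simp add: ev_altdef[OF deg] c)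
    then have "crd x = q" using deg by (rule crd_unique)
    then show "cs = map (coeff (crd x)) [0..<n]" using cs by (intro nth_equalityI) (auto simp: c)
  qed
  then show "length (coordinates m \<theta> x) = n" "x = (\<Sum>k<n. of_rat (coordinates m \<theta> x ! k) * \<theta> ^ k)" by auto
qed

lemma read_pair:
  "\<exists>q R d. foldr reg_step (encode_pair m \<theta> (a, b)) ((2 * n, True), (\<lambda>\<rho>. if \<rho> = AccDen then 1 else 0)) = (q, R) \<and>
    d \<noteq> (0::int) \<and> R AccDen = of_int d \<and> R Fst = of_int d * a \<and> R Snd = of_int d * b"
proof -
  define cs where "cs = coordinates m \<theta> a @ coordinates m \<theta> b"
  have len: "length cs = 2 * n" by (simp add: cs_def coordinates(1))
  have enc: "encode_pair m \<theta> (a, b) = concat (map encode_rat cs)"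
    by (simp add: encode_pair_def encode_element_def cs_def)
  have "(\<Sum>k<2 * n. if k < n then of_rat (cs ! k) * \<theta> ^ (k mod n) else 0) = (\<Sum>k<n. of_rat (cs ! k) * \<theta> ^ (k mod n))"
    by (intro sum.mono_neutral_cong_right) auto
  also have "\<dots> = (\<Sum>k<n. of_rat (coordinates m \<theta> a ! k) * \<theta> ^ k)"
    by (intro sum.cong) (auto simp: cs_def nth_append coordinates(1))
  also have "\<dots> = a" using coordinates(2)[of a] by simp
  finally have a: "(\<Sum>k<2 * n. if k < n then of_rat (cs ! k) * \<theta> ^ (k mod n) else 0) = a" .
  have "(\<Sum>k<2 * n. if k < n then 0 else of_rat (cs ! k) * \<theta> ^ (k mod n)) = (\<Sum>k\<in>{n..<2 * n}. of_rat (cs ! k) * \<theta> ^ (k mod n))"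
    by (intro sum.mono_neutral_cong_right) auto
  also have "\<dots> = (\<Sum>k<n. of_rat (coordinates m \<theta> b ! k) * \<theta> ^ k)"
    by (rule sum.reindex_bij_witness[of _ "\<lambda>k. k + n" "\<lambda>k. k - n"])
      (auto simp: cs_def nth_append coordinates(1) mod_if)
  also have "\<dots> = b" using coordinates(2)[of b] by simp
  finally have b: "(\<Sum>k<2 * n. if k < n then 0 else of_rat (cs ! k) * \<theta> ^ (k mod n)) = b" .
  show ?thesis
    using read_rats[of cs True "\<lambda>\<rho>. if \<rho> = AccDen then 1 else 0"] unfolding enc len a b by force
qed

text \<open>Clear denominators by their product \<open>P\<close>. Each resulting integer coordinate
  is a product of one numerator and the other denominators, so its bit size is bounded by the sum of
  the encoding lengths. The factor \<open>P\<close> scales both sides alike.\<close>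

lemma nrm_le_exp_length:
  assumes C1: "\<And>y L. iv y \<noteq> 0 \<Longrightarrow> (\<And>k. k < n \<Longrightarrow> \<bar>y k\<bar> \<le> 2 ^ L) \<Longrightarrow>
      nrm (iv y) \<le> exp (C1 * (real L + 1)) * v (iv y)"
    and a: "a \<noteq> 0" and L: "length (encode_element m \<theta> a) \<le> L"
  shows "nrm a \<le> exp (C1 * (real L + 1)) * v a"
proof -
  let ?c = "\<lambda>k. coordinates m \<theta> a ! k"
  define i d where "i k = fst (quotient_of (?c k))" and "d k = snd (quotient_of (?c k))" for k
  have q: "quotient_of (?c k) = (i k, d k)" for k by (simp add: i_def d_def)
  have d: "d k > 0" "?c k = of_int (i k) / of_int (d k)" for k
    using quotient_of_denom_pos[OF q] quotient_of_div[OF q] by auto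
  define P where "P = (\<Prod>k<n. d k)"
  have P: "P > 0" using d by (auto simp: P_def intro: prod_pos)
  define y where "y k = i k * (\<Prod>l\<in>{..<n} - {k}. d l)" for k
  have "of_int P * a = (\<Sum>k<n. of_int P * of_rat (?c k) * \<theta> ^ k)"
    using arg_cong[OF coordinates(2)[of a], of "\<lambda>x. of_int P * x"]
    by (simp only: sum_distrib_left mult.assoc)
  also have "\<dots> = iv y"
    unfolding iv_def
  proof (intro sum.cong refl)
    fix k assume "k \<in> {..<n}"
    then have "P = d k * (\<Prod>l\<in>{..<n} - {k}. d l)" unfolding P_def by (intro prod.remove) auto
    then show "of_int P * of_rat (?c k) * \<theta> ^ k = of_int (y k) * \<theta> ^ k"
      using d[of k] by (simp add: y_def of_rat_divide)
  qed
  finally have y: "of_int P * a = iv y" .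
  have bound: "\<bar>y k\<bar> \<le> 2 ^ L" if "k < n" for k
  proof -
    define h where "h l = (2::int) ^ length (encode_rat (?c l))" for l
    have "\<bar>y k\<bar> = \<bar>i k\<bar> * (\<Prod>l\<in>{..<n} - {k}. \<bar>d l\<bar>)" by (simp add: y_def abs_mult abs_prod)
    also have "\<dots> \<le> h k * (\<Prod>l\<in>{..<n} - {k}. h l)"
      unfolding h_def using encode_rat_bounds[OF q] by (intro mult_mono prod_mono) (auto intro!: prod_nonneg)
    also have "\<dots> = (\<Prod>l<n. h l)" using that by (intro prod.remove[symmetric]) auto
    also have "\<dots> = 2 ^ (\<Sum>l<n. length (encode_rat (?c l)))" by (simp add: h_def power_sum)
    also have "(\<Sum>l<n. length (encode_rat (?c l))) = length (encode_element m \<theta> a)"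
      by (simp add: encode_element_def length_concat sum_list_sum_nth coordinates(1) atLeast0LessThan comp_def)
    also have "(2::int) ^ \<dots> \<le> 2 ^ L" using L by (intro power_increasing) auto
    finally show ?thesis .
  qed
  have "iv y \<noteq> 0" using y P a by (metis mult_eq_0_iff of_int_eq_0_iff less_irrefl)
  from C1[OF this bound] have "nrm (of_int P * a) \<le> exp (C1 * (real L + 1)) * v (of_int P * a)"
    unfolding y by blast
  then have "v (of_int P) * nrm a \<le> v (of_int P) * (exp (C1 * (real L + 1)) * v a)"
    unfolding nrm_of_int_mult mult by (simp only: mult_ac)
  then show ?thesis using P by (subst (asm) mult_le_cancel_left_pos) auto
qed

section \<open>Registers as integer vectors and updates as integer matrices\<close>

definition reg_value :: "(reg \<times> nat \<Rightarrow> int) \<Rightarrow> reg \<Rightarrow> 'f" where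
  "reg_value z \<rho> = iv (\<lambda>k. z (\<rho>, k))"

definition reg_unit :: "reg \<times> nat \<Rightarrow> reg \<Rightarrow> 'f" where
  "reg_unit i \<rho> = (if \<rho> = fst i then \<theta> ^ snd i else 0)"

lemma reg_value_sum: "reg_value z = (\<lambda>\<rho>. \<Sum>i\<in>UNIV \<times> {..<n}. of_int (z i) * reg_unit i \<rho>)"
proof
  fix \<rho>
  have "(\<Sum>i\<in>UNIV \<times> {..<n}. of_int (z i) * reg_unit i \<rho>) =
      (\<Sum>i\<in>{\<rho>} \<times> {..<n}. of_int (z i) * reg_unit i \<rho>)"
    by (intro sum.mono_neutral_right) (auto simp: finite_reg reg_unit_def)
  also have "\<dots> = (\<Sum>k<n. of_int (z (\<rho>, k)) * \<theta> ^ k)"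
    by (rule sum.reindex_bij_witness[of _ "\<lambda>k. (\<rho>, k)" snd]) (auto simp: reg_unit_def)
  finally show "reg_value z \<rho> = (\<Sum>i\<in>UNIV \<times> {..<n}. of_int (z i) * reg_unit i \<rho>)"
    by (simp add: reg_value_def iv_def)
qed

lemma iv_floor_crd: "integral x \<Longrightarrow> iv (\<lambda>k. \<lfloor>coeff (crd x) k\<rfloor>) = x"
proof -
  assume "integral x"
  then obtain y where x: "x = iv y" by (auto simp: integral_def)
  show ?thesis unfolding x coeff_crd_iv by (simp add: iv_def)
qed

text \<open>Columns are the images of the basis vectors. The floor only converts types: it is exact
  as soon as \<gamma> clears the denominators.\<close>

definition reg_matrix :: "'f \<Rightarrow> nat \<times> bool \<Rightarrow> nat \<Rightarrow> reg \<times> nat \<Rightarrow> reg \<times> nat \<Rightarrow> int" where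
  "reg_matrix \<gamma> q \<sigma> i j = \<lfloor>coeff (crd (\<gamma> * upd q \<sigma> (reg_unit j) (fst i))) (snd i)\<rfloor>"

lemma reg_value_mat_apply:
  assumes int: "\<And>i \<rho>. i \<in> UNIV \<times> {..<n} \<Longrightarrow> integral (\<gamma> * upd q \<sigma> (reg_unit i) \<rho>)"
  shows "reg_value (mat_apply (UNIV \<times> {..<n}) (reg_matrix \<gamma> q \<sigma>) z) \<rho> = \<gamma> * upd q \<sigma> (reg_value z) \<rho>"
proof -
  let ?I = "UNIV \<times> {..<n}"
  have "\<gamma> * upd q \<sigma> (reg_value z) \<rho> = (\<Sum>i\<in>?I. of_int (z i) * (\<gamma> * upd q \<sigma> (reg_unit i) \<rho>))"
    unfolding reg_value_sum upd_sum by (simp add: sum_distrib_left mult_ac)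
  also have "\<dots> = (\<Sum>i\<in>?I. of_int (z i) * iv (\<lambda>k. reg_matrix \<gamma> q \<sigma> (\<rho>, k) i))"
    by (intro sum.cong refl) (simp add: reg_matrix_def iv_floor_crd[OF int])
  also have "\<dots> = iv (\<lambda>k. \<Sum>i\<in>?I. z i * reg_matrix \<gamma> q \<sigma> (\<rho>, k) i)"
    unfolding iv_sum iv_cmult ..
  also have "\<dots> = reg_value (mat_apply ?I (reg_matrix \<gamma> q \<sigma>) z) \<rho>"
    unfolding reg_value_def iv_def by (intro sum.cong refl) (simp add: mat_apply_def mult.commute)
  finally show ?thesis ..
qed

text \<open>Every symbol contributes one factor \<gamma>, which commutes with all later updates by
  linearity. The power with exponent \<open>L\<close> thus arises while the input is read, without
  any separate computation of the length.\<close>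

lemma reg_value_foldr:
  assumes int: "\<And>q \<sigma> i \<rho>. fst q \<le> 2 * n \<Longrightarrow> \<sigma> \<in> {1..5} \<Longrightarrow> i \<in> UNIV \<times> {..<n} \<Longrightarrow>
      integral (\<gamma> * upd q \<sigma> (reg_unit i) \<rho>)"
    and q0: "fst q0 \<le> 2 * n" and w: "set w \<subseteq> {1..5}"
  shows "\<exists>q z R. foldr (mat_step (UNIV \<times> {..<n}) next_control (reg_matrix \<gamma>)) w (q0, z0) = (q, z) \<and>
    foldr reg_step w (q0, reg_value z0) = (q, R) \<and> fst q \<le> 2 * n \<and> reg_value z = (\<lambda>\<rho>. \<gamma> ^ length w * R \<rho>)"
  using w
proof (induction w)
  case Nil
  then show ?case using q0 by simp
next
  case (Cons \<sigma> w)
  then obtain q z R where *: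
    "foldr (mat_step (UNIV \<times> {..<n}) next_control (reg_matrix \<gamma>)) w (q0, z0) = (q, z)"
    "foldr reg_step w (q0, reg_value z0) = (q, R)" "fst q \<le> 2 * n" "reg_value z = (\<lambda>\<rho>. \<gamma> ^ length w * R \<rho>)"
    by auto
  have "reg_value (mat_apply (UNIV \<times> {..<n}) (reg_matrix \<gamma> q \<sigma>) z) \<rho> = \<gamma> ^ length (\<sigma> # w) * upd q \<sigma> R \<rho>" for \<rho>
    using Cons.prems *(3) by (subst reg_value_mat_apply[OF int]) (auto simp: *(4) upd_cmult)
  moreover have "fst (next_control q \<sigma>) \<le> 2 * n" using *(3) by (auto simp: next_control_def)
  moreover have "reg_step \<sigma> (q, R) = (next_control q \<sigma>, upd q \<sigma> R)" by (simp add: reg_step_def)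
  ultimately show ?case
    by (intro exI[of _ "next_control q \<sigma>"] exI[of _ "upd q \<sigma> R"]
        exI[of _ "mat_apply (UNIV \<times> {..<n}) (reg_matrix \<gamma> q \<sigma>) z"]) (simp add: *(1,2) mat_step_Pair fun_eq_iff)
qed

end

section \<open>The Hilbert symbol\<close>

context number_field_val
begin

text \<open>A relative error in \<open>nrm\<close> becomes one in \<open>v\<close> at the cost of
  \<open>\<Theta> ^ n\<close> for passing to \<open>v\<close> and of \<open>R\<close> for passing
  back, which explains the precision \<open>\<eta> / (\<Theta> ^ n * R)\<close>. The witness is the
  quotient of the powers of \<open>l\<close> by which the digits were shifted.\<close>

lemma leading_digits_square_class:
  assumes det: "leading_digits_determine l (\<eta> / (\<Theta> ^ n * R)) f d0" and R: "R > 0" and l: "l > 0"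
    and xs: "\<forall>x\<in>set xs. digit n (int l ^ 2) x" and ys: "\<forall>y\<in>set ys. digit n (int l ^ 2) y"
    and X: "X = iv (digits_value (int l ^ 2) xs)" and Y: "Y = iv (digits_value (int l ^ 2) ys)"
    and nz: "X \<noteq> 0" "Y \<noteq> 0" and eq: "foldr f xs d0 = foldr f ys d0" and dom: "nrm X \<le> R * v X"
    and \<eta>: "\<eta> > 0"
  shows "\<exists>s. s \<noteq> 0 \<and> v (Y * s\<^sup>2 / X - 1) \<le> \<eta>"
proof -
  obtain i j where ij: "nrm (X / of_nat l ^ (2 * i) - Y / of_nat l ^ (2 * j)) \<le>
      \<eta> / (\<Theta> ^ n * R) * nrm (X / of_nat l ^ (2 * i))"
    using det xs ys nz eq unfolding X Y leading_digits_determine_def by blast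
  let ?x = "X / of_nat l ^ (2 * i)" and ?y = "Y / of_nat l ^ (2 * j)"
  have l0: "(of_nat l :: 'f) \<noteq> 0" using l by simp
  have x0: "?x \<noteq> 0" using nz l0 by simp
  have T: "\<Theta> ^ n > 0" by (simp add: \<Theta>_def)
  have "nrm ?x = nrm X / v (of_nat l ^ (2 * i))"
    using nrm_divide_int[of X "int l ^ (2 * i)"] by simp
  also have "\<dots> \<le> R * v X / v (of_nat l ^ (2 * i))" by (intro divide_right_mono dom) auto
  finally have nx: "nrm ?x \<le> R * v ?x" by (simp add: divide)
  have "v (?x - ?y) \<le> \<Theta> ^ n * nrm (?x - ?y)" by (rule v_le_nrm)
  also have "\<dots> \<le> \<Theta> ^ n * (\<eta> / (\<Theta> ^ n * R) * (R * v ?x))"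
    using T R \<eta> by (intro mult_left_mono order_trans[OF ij] nx) auto
  also have "\<dots> = \<eta> * v ?x"
  proof -
    have "c * (\<eta> / (c * R) * (R * y)) = \<eta> * y" if "c > 0" for c y
      using that R by (simp add: field_simps)
    then show ?thesis using T by blast
  qed
  finally have "v (?x - ?y) \<le> \<eta> * v ?x" .
  then have "v (?x - ?y) / v ?x \<le> \<eta>" using x0 by (simp add: pos_divide_le_eq)
  moreover have "v (?x - ?y) / v ?x = v ((?y - ?x) / ?x)"
    unfolding divide[of "?y - ?x"] by (subst diff_commute) simp
  moreover have "(?y - ?x) / ?x = ?y / ?x - 1"
    unfolding diff_divide_distrib divide_self[OF x0] ..
  moreover have "?y / ?x = Y * (of_nat l ^ i / of_nat l ^ j)\<^sup>2 / X"
    using l0 nz by (simp add: power_divide power_mult[symmetric] mult.commute)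
  ultimately show ?thesis using l0 by (intro exI[of _ "of_nat l ^ i / of_nat l ^ j"]) auto
qed

end

locale number_field_place = place v V + number_field_val v m \<theta>
  for v :: "'f::field_char_0 \<Rightarrow> real" and V m \<theta>
begin

lemma hilbert_symbol_poly_time:
  "poly_time_computable {(a, b). a \<noteq> 0 \<and> b \<noteq> 0} (encode_pair m \<theta>) encode_int
     (\<lambda>(a, b). hilbert_symbol (completion V) (to_completion V a) (to_completion V b))"
proof -
  let ?H = "\<lambda>a b. hilbert_symbol (completion V) (to_completion V a) (to_completion V b)"
  obtain \<epsilon> where \<epsilon>: "\<epsilon> > 0"
    "\<And>a b a' b' s t. \<lbrakk>a \<noteq> 0; b \<noteq> 0; s \<noteq> 0; t \<noteq> 0; v (a' * s\<^sup>2 / a - 1) \<le> \<epsilon>; v (b' * t\<^sup>2 / b - 1) \<le> \<epsilon>;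
        a' \<noteq> 0; b' \<noteq> 0\<rbrakk> \<Longrightarrow> ?H a' b' = ?H a b"
    using hilbert_symbol_locally_constant by blast
  obtain l where l: "l \<ge> 2" "\<And>\<epsilon>. \<epsilon> > 0 \<Longrightarrow> finitely_determined l \<epsilon>"
    and \<kappa>: "\<exists>\<kappa>::nat. \<forall>z::int. z \<noteq> 0 \<longrightarrow> 1 \<le> \<bar>real_of_int z\<bar> ^ \<kappa> * v (of_int z)"
    using leading_digits[OF nontrivial] by blast
  obtain C1 where C1: "\<And>y L. iv y \<noteq> 0 \<Longrightarrow> (\<And>k. k < n \<Longrightarrow> \<bar>y k\<bar> \<le> 2 ^ L) \<Longrightarrow>
      nrm (iv y) \<le> exp (C1 * (real L + 1)) * v (iv y)"
    using nrm_iv_le_exp[OF \<kappa>] by blast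
  obtain \<beta> R where \<beta>: "\<beta> \<noteq> 0" "R > 0" "\<And>L x. x \<noteq> 0 \<Longrightarrow> nrm x \<le> exp (C1 * (real L + 1)) * v x \<Longrightarrow>
      nrm (\<beta> ^ L * x) \<le> R * v (\<beta> ^ L * x)"
    using domination by blast
  let ?Q = "{..2 * n} \<times> (UNIV :: bool set)" and ?I = "(UNIV :: reg set) \<times> {..<n}"
  \<comment> \<open>All images of basis vectors under an update followed by \<beta>. The set is
    finite, so one integer \<open>E\<close> makes every matrix integral.\<close>
  let ?S = "(\<lambda>(q, \<sigma>, i, \<rho>). \<beta> * upd q \<sigma> (reg_unit i) \<rho>) ` (?Q \<times> {1..5} \<times> ?I \<times> UNIV)"
  have finI: "finite ?I" using finite_reg by blast
  have "finite ?S" using finI finite_reg by (intro finite_imageI finite_cartesian_product) auto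
  then obtain E :: int where E: "E > 0" "\<And>x. x \<in> ?S \<Longrightarrow> integral (of_int E * x)"
    using common_denominator by metis
  define \<gamma> where "\<gamma> = of_int E * \<beta>"
  have \<gamma>0: "\<gamma> \<noteq> 0" using E \<beta> by (simp add: \<gamma>_def)
  have int: "integral (\<gamma> * upd q \<sigma> (reg_unit i) \<rho>)"
    if "fst q \<le> 2 * n" "\<sigma> \<in> {1..5}" "i \<in> ?I" for q \<sigma> i \<rho>
  proof -
    have "\<beta> * upd q \<sigma> (reg_unit i) \<rho> \<in> ?S"
      using that by (intro image_eqI[of _ _ "(q, \<sigma>, i, \<rho>)"]) (auto simp: mem_Times_iff)
    then show ?thesis using E(2) by (simp add: \<gamma>_def mult.assoc)
  qed
  \<comment> \<open>Numerator and denominator each bring an error \<eta>, and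
    \<open>(1 + \<eta>)^2 - 1 \<le> 3 * \<eta>\<close> for \<open>\<eta> \<le> 1\<close>.\<close>
  define \<eta> where "\<eta> = min 1 (\<epsilon> / 3)"
  have \<eta>: "\<eta> > 0" "\<eta> \<le> 1" "3 * \<eta> \<le> \<epsilon>" using \<epsilon>(1) by (auto simp: \<eta>_def)
  have "\<eta> / (\<Theta> ^ n * R) > 0" using \<eta> \<beta>(2) by (simp add: \<Theta>_def)
  from l(2)[OF this] obtain W f d0 where W: "finite W" "d0 \<in> W"
    "\<And>x d. digit n (int l ^ 2) x \<Longrightarrow> d \<in> W \<Longrightarrow> f x d \<in> W"
    and det: "leading_digits_determine l (\<eta> / (\<Theta> ^ n * R)) f d0"
    unfolding finitely_determined_def by blast
  define B where "B = int l ^ 2"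
  have B2: "B \<ge> 2"
  proof -
    have "int l * int l \<ge> 2 * 2" using l(1) by (intro mult_mono) auto
    then show ?thesis by (simp add: B_def power2_eq_square)
  qed
  let ?X = "bounded_vectors ?I (B - 1)"
  define x0 where "x0 = (\<lambda>i. if i = (AccDen, 0 :: nat) then 1 else 0 :: int)"
  define row where "row \<rho> x = (\<lambda>k. x (\<rho>, k))" for \<rho> and x :: "reg \<times> nat \<Rightarrow> int"
  define absorb where "absorb x d = (f (row Fst x) (fst d), f (row Snd x) (fst (snd d)), f (row AccDen x) (snd (snd d)))"
    for x d
  have digit: "digit n (int l ^ 2) (row \<rho> x)" if "x \<in> ?X" for \<rho> x
    using that by (auto simp: bounded_vectors_def digit_def row_def B_def)
  have fold: "foldr absorb xs (d0, d0, d0) =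
      (foldr f (map (row Fst) xs) d0, foldr f (map (row Snd) xs) d0, foldr f (map (row AccDen) xs) d0)" for xs
    by (induction xs) (simp_all add: absorb_def)
  have val: "digits_value B (map (row \<rho>) xs) = row \<rho> (digits_value B xs)" for \<rho> xs
    by (induction xs) (simp_all add: row_def)
  let ?z = "\<lambda>x. snd (foldr (mat_step ?I next_control (reg_matrix \<gamma>)) (encode_pair m \<theta> x)
      ((2 * n, True), x0))"
  have init: "reg_value x0 = (\<lambda>\<rho>. if \<rho> = AccDen then 1 else 0)"
  proof
    fix \<rho>
    have "iv (\<lambda>k. if k = 0 then 1 else 0) = 1"
      using n_pos by (simp add: iv_def if_distrib[of of_int] if_distrib[of "\<lambda>x. x * _"] cong: if_cong)
    then show "reg_value x0 \<rho> = (if \<rho> = AccDen then 1 else 0)"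
      by (simp add: reg_value_def x0_def iv_def)
  qed
  have regs: "\<exists>P A D. P = iv (row Fst (?z (a, b))) \<and> A = iv (row Snd (?z (a, b))) \<and> D = iv (row AccDen (?z (a, b))) \<and>
      P \<noteq> 0 \<and> A \<noteq> 0 \<and> D \<noteq> 0 \<and> a = P / D \<and> b = A / D \<and>
      nrm P \<le> R * v P \<and> nrm A \<le> R * v A \<and> nrm D \<le> R * v D"
    if ab: "a \<noteq> 0" "b \<noteq> 0" for a b
  proof -
    let ?L = "length (encode_pair m \<theta> (a, b))"
    obtain q r d where r: "foldr reg_step (encode_pair m \<theta> (a, b)) ((2 * n, True), reg_value x0) = (q, r)"
      "d \<noteq> (0::int)" "r AccDen = of_int d" "r Fst = of_int d * a" "r Snd = of_int d * b"
      using read_pair[of a b] unfolding init by blast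
    have "fst (2 * n, True) \<le> 2 * n" by simp
    from reg_value_foldr[OF int this set_encode_pair[of m \<theta> "(a, b)"], of x0] r(1)
    have z: "reg_value (?z (a, b)) = (\<lambda>\<rho>. \<gamma> ^ ?L * r \<rho>)" by fastforce
    have row: "iv (row \<rho> (?z (a, b))) = \<gamma> ^ ?L * r \<rho>" for \<rho>
      using fun_cong[OF z, of \<rho>] by (simp add: reg_value_def row_def)
    \<comment> \<open>Integer factors scale \<open>nrm\<close> and \<open>v\<close> in the same way,
      so \<open>E ^ ?L\<close> and \<open>d\<close> do not disturb the domination achieved by the
      power of \<beta>.\<close>
    have dom: "nrm (\<gamma> ^ ?L * (of_int d * x)) \<le> R * v (\<gamma> ^ ?L * (of_int d * x))"
      if "x \<noteq> 0" "nrm x \<le> exp (C1 * (real ?L + 1)) * v x" for x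
    proof -
      have eq: "\<gamma> ^ ?L * (of_int d * x) = of_int (E ^ ?L * d) * (\<beta> ^ ?L * x)"
        by (simp add: \<gamma>_def power_mult_distrib mult_ac)
      have "nrm (of_int (E ^ ?L * d) * (\<beta> ^ ?L * x)) = v (of_int (E ^ ?L * d)) * nrm (\<beta> ^ ?L * x)"
        by (rule nrm_of_int_mult)
      also have "\<dots> \<le> v (of_int (E ^ ?L * d)) * (R * v (\<beta> ^ ?L * x))"
        by (intro mult_left_mono \<beta>(3) that) auto
      finally show ?thesis unfolding eq mult[of "of_int (E ^ ?L * d)"] by (simp add: mult_ac)
    qed
    have "nrm a \<le> exp (C1 * (real ?L + 1)) * v a" "nrm b \<le> exp (C1 * (real ?L + 1)) * v b"
      by (rule nrm_le_exp_length[OF C1]; simp add: ab encode_pair_def)+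
    moreover have "nrm 1 \<le> exp (C1 * (real ?L + 1)) * v 1"
      using C1[of "row AccDen x0" ?L] fun_cong[OF init, of AccDen] by (simp add: reg_value_def row_def x0_def)
    ultimately have "nrm (\<gamma> ^ ?L * (of_int d * a)) \<le> R * v (\<gamma> ^ ?L * (of_int d * a))"
      "nrm (\<gamma> ^ ?L * (of_int d * b)) \<le> R * v (\<gamma> ^ ?L * (of_int d * b))"
      "nrm (\<gamma> ^ ?L * of_int d) \<le> R * v (\<gamma> ^ ?L * of_int d)"
      using dom[of a] dom[of b] dom[of 1] ab by simp_all
    then show ?thesis
      unfolding row r(3-5) using \<gamma>0 r(2) ab
      by - (rule exI[of _ "\<gamma> ^ ?L * (of_int d * a)"], rule exI[of _ "\<gamma> ^ ?L * (of_int d * b)"],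
        rule exI[of _ "\<gamma> ^ ?L * of_int d"], simp)
  qed
  define good where "good x xs \<longleftrightarrow> fst x \<noteq> 0 \<and> snd x \<noteq> 0 \<and> set xs \<subseteq> ?X \<and> digits_value B xs = ?z x" for x xs
  have same: "?H (fst x') (snd x') = ?H (fst x) (snd x)"
    if good: "good x xs" "good x' xs'" and eq: "foldr absorb xs (d0, d0, d0) = foldr absorb xs' (d0, d0, d0)"
    for x x' xs xs'
  proof -
    obtain a b a' b' where x: "x = (a, b)" "x' = (a', b')" by (cases x, cases x')
    have nz: "a \<noteq> 0" "b \<noteq> 0" "a' \<noteq> 0" "b' \<noteq> 0" using good by (auto simp: good_def x)
    obtain P A D where P: "P = iv (row Fst (?z x))" "A = iv (row Snd (?z x))" "D = iv (row AccDen (?z x))"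
      "P \<noteq> 0" "A \<noteq> 0" "D \<noteq> 0" "a = P / D" "b = A / D"
      "nrm P \<le> R * v P" "nrm A \<le> R * v A" "nrm D \<le> R * v D"
      using regs[OF nz(1,2)] unfolding x by blast
    obtain P' A' D' where P': "P' = iv (row Fst (?z x'))" "A' = iv (row Snd (?z x'))" "D' = iv (row AccDen (?z x'))"
      "P' \<noteq> 0" "A' \<noteq> 0" "D' \<noteq> 0" "a' = P' / D'" "b' = A' / D'"
      using regs[OF nz(3,4)] unfolding x by blast
    have "\<exists>s. s \<noteq> 0 \<and> v (Y * s\<^sup>2 / X - 1) \<le> \<eta>"
      if "X = iv (row \<rho> (?z x))" "Y = iv (row \<rho> (?z x'))" "X \<noteq> 0" "Y \<noteq> 0" "nrm X \<le> R * v X"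
        "foldr f (map (row \<rho>) xs) d0 = foldr f (map (row \<rho>) xs') d0" for X Y \<rho>
    proof (rule leading_digits_square_class[OF det \<beta>(2)])
      show "l > 0" using l(1) by simp
      show "\<forall>y\<in>set (map (row \<rho>) xs). digit n (int l ^ 2) y" "\<forall>y\<in>set (map (row \<rho>) xs'). digit n (int l ^ 2) y"
        using good digit by (auto simp: good_def)
      show "X = iv (digits_value (int l ^ 2) (map (row \<rho>) xs))" "Y = iv (digits_value (int l ^ 2) (map (row \<rho>) xs'))"
        using good that(1,2) val by (simp_all add: good_def flip: B_def)
    qed (use that \<eta> in auto)
    note close = this
    obtain s where s: "s \<noteq> 0" "v (P' * s\<^sup>2 / P - 1) \<le> \<eta>"
      using close[OF P(1) P'(1) P(4) P'(4) P(9)] eq by (auto simp: fold)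
    obtain t where t: "t \<noteq> 0" "v (A' * t\<^sup>2 / A - 1) \<le> \<eta>"
      using close[OF P(2) P'(2) P(5) P'(5) P(10)] eq by (auto simp: fold)
    obtain u where u: "u \<noteq> 0" "v (D' * u\<^sup>2 / D - 1) \<le> \<eta>"
      using close[OF P(3) P'(3) P(6) P'(6) P(11)] eq by (auto simp: fold)
    have prod: "v (y * z - 1) \<le> \<epsilon>" if "v (y - 1) \<le> \<eta>" "v (z - 1) \<le> \<eta>" for y z
    proof -
      have "y * z - 1 = (y - 1) * (z - 1) + ((y - 1) + (z - 1))" by (simp add: algebra_simps)
      then have "v (y * z - 1) = v ((y - 1) * (z - 1) + ((y - 1) + (z - 1)))" by (simp only:)
      moreover have "v ((y - 1) * (z - 1) + ((y - 1) + (z - 1))) \<le> v (y - 1) * v (z - 1) + v ((y - 1) + (z - 1))"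
        unfolding mult[symmetric] by (rule triangle)
      moreover have "v ((y - 1) + (z - 1)) \<le> v (y - 1) + v (z - 1)" by (rule triangle)
      moreover have "v (y - 1) * v (z - 1) \<le> \<eta> * 1" using that \<eta> by (intro mult_mono) auto
      ultimately show ?thesis using that \<eta> by linarith
    qed
    \<comment> \<open>Modulo squares, dividing by \<open>D\<close> is the same as multiplying by
      \<open>D\<close>. With \<open>D' / D\<close> in the witness, the relation between the
      quotients splits into one for the numerators and one for the denominators.\<close>
    have quot: "(Y / D') * (r * u * D' / D)\<^sup>2 / (X / D) = (Y * r\<^sup>2 / X) * (D' * u\<^sup>2 / D)"
      if "X \<noteq> 0" for X Y r
      using that P(6) P'(6) by (simp add: field_simps power2_eq_square)
    show ?thesis
      unfolding x fst_conv snd_conv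
    proof (rule \<epsilon>(2))
      show "s * u * D' / D \<noteq> 0" "t * u * D' / D \<noteq> 0" using s t u P P' by auto
      show "v (a' * (s * u * D' / D)\<^sup>2 / a - 1) \<le> \<epsilon>"
        unfolding P(7) P'(7) quot[OF P(4)] by (rule prod[OF s(2) u(2)])
      show "v (b' * (t * u * D' / D)\<^sup>2 / b - 1) \<le> \<epsilon>"
        unfolding P(8) P'(8) quot[OF P(5)] by (rule prod[OF t(2) u(2)])
    qed (use nz in auto)
  qed
  \<comment> \<open>The finite table, defined by mere existence of an input with these leading
    digits and symbol \<open>1\<close>. By \<open>same\<close> all inputs with these leading digits
    have the same symbol; as field and place are fixed, the table is built into the machine.\<close>
  define accept where "accept d \<longleftrightarrow> (\<exists>x xs. good x xs \<and> foldr absorb xs (d0, d0, d0) = d \<and> ?H (fst x) (snd x) = 1)" for d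
  show ?thesis
  proof (rule matrix_process_poly_time[where I = ?I and B = B and Q = ?Q and next_control = next_control
        and M = "reg_matrix \<gamma>" and absorb = absorb and W = "W \<times> W \<times> W" and ?d0.0 = "(d0, d0, d0)"
        and ?q0.0 = "(2 * n, True)" and ?x0.0 = x0 and accept = accept])
    show "next_control q \<sigma> \<in> ?Q" if "q \<in> ?Q" "\<sigma> \<in> {1..5}" for q \<sigma>
      using that by (auto simp: next_control_def)
    show "absorb x d \<in> W \<times> W \<times> W" if "x \<in> ?X" "d \<in> W \<times> W \<times> W" for x d
      using that W(3) digit by (auto simp: absorb_def mem_Times_iff)
    show "set (encode_pair m \<theta> x) \<subseteq> {1..5}" for x by (rule set_encode_pair)
    show "x0 \<in> ?X" using n_pos B2 by (auto simp: x0_def bounded_vectors_def)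
    fix x xs
    assume x: "x \<in> {(a, b). a \<noteq> 0 \<and> b \<noteq> (0 :: 'f)}" and xs: "set xs \<subseteq> ?X" "digits_value B xs = ?z x"
    have g: "good x xs" using x xs by (auto simp: good_def)
    have "?H (fst x) (snd x) = 1 \<longleftrightarrow> accept (foldr absorb xs (d0, d0, d0))"
    proof
      assume "?H (fst x) (snd x) = 1"
      then show "accept (foldr absorb xs (d0, d0, d0))" unfolding accept_def using g by blast
    next
      assume "accept (foldr absorb xs (d0, d0, d0))"
      then obtain x' xs' where x': "good x' xs'" "?H (fst x') (snd x') = 1"
        "foldr absorb xs' (d0, d0, d0) = foldr absorb xs (d0, d0, d0)"
        unfolding accept_def by blast
      show "?H (fst x) (snd x) = 1" using same[OF x'(1) g x'(3)] x'(2) by simp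
    qed
    then show "(case x of (a, b) \<Rightarrow> ?H a b) = (if accept (foldr absorb xs (d0, d0, d0)) then 1 else - 1)"
      by (auto simp: hilbert_symbol_def split: prod.splits if_splits)
  qed (use finI B2 W in auto)
qed

end

theorem theorem6p1:
  fixes m :: "rat poly" and \<theta> :: "'f::field_char_0" and v :: "('f \<Rightarrow> real) set"
  assumes "number_field m \<theta>"
    and "v \<in> places"
  shows "poly_time_computable {(a, b). a \<noteq> 0 \<and> b \<noteq> 0} (encode_pair m \<theta>) encode_int
           (\<lambda>(a, b). hilbert_symbol (completion v) (to_completion v a) (to_completion v b))"
proof -
  obtain w where w: "absolute_value w" "\<exists>x. x \<noteq> 0 \<and> w x \<noteq> 1"
    "v = {w'. absolute_value w' \<and> equivalent_av w w'}"
    using assms(2) unfolding places_def by blast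
  interpret number_field_place w v m \<theta>
    by unfold_locales (use assms w in auto)
  show ?thesis by (rule hilbert_symbol_poly_time)
qed

end
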